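(* Let $n\ge2$ and let $F\in\mathcal C^2(\mathbb R)$ satisfy: $F\ge0$; $F(s)\to\infty$ as $|s|\to\infty$; $F^{-1}(0)=\{-1,+1\}$; $F''(\pm1)>0$; $sF'(s)\ge0$ for $|s|\ge1$; and the only other critical point of $F$ is a local maximum at $s=0$. Put $f=F'$, $\lambda=-f'(0)>0$, and let $L$ be the Lipschitz constant of $f$ on $[-1,1]$. Let $\alpha_-\le \alpha_+$ be the roots of $\alpha^2-(n-1)\alpha+\lambda=0$ and $\beta_-\le\beta_+$ the roots of $\alpha^2-(n-1)\alpha+L=0$. Let $u$ be an arbitrary bounded solution of $\Delta_g u=f(u)$ on $\mathbb H^n$. \begin{itemize} \item[(i)] Let $\eta\in\{-1,+1\}$. If $|u(z)-\eta|\to0$ as $z\to\infty$ in $\mathbb H^n$, then $u\equiv\eta$. On the other hand, suppose $f$ is Lipschitz with Lipschitz constant $L\le (n-1)^2/4$ and $f\in\mathcal C^{1,\delta}$ in some neighbourhood of $s=0$ for some $\delta>0$. If, in the ball model, $|u(z)|/(1-|z|)^{\alpha}\le C$ for some $\alpha>\alpha_-$, then $u\equiv0$. The same conclusion holds assuming only that $f$ is Lipschitz (with $L\le(n-1)^2/4$) if the exponent satisfies $\alpha>\beta_-$. \item[(ii)] Suppose $f$ is Lipschitz with Lipschitz constant $L\le(n-1)^2/4$. In the upper half-space model, if $|u|\le Cx^{\alpha}$ on all of $\mathbb H^n$ for some $\alpha>\alpha_-$, and $u\to+1$ as $(x,y)\to\infty$ within any conic region $x>C_1|y-y_0|+C_2$,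 then $u$ is invariant under $H_p$ (the group of Euclidean motions in $y$), and hence is a function of $x$ alone. \item[(iii)] Let $P\cong\mathbb H^{n-1}$ be a totally geodesic hyperplane in $\mathbb H^n$, $S_-,S_+$ the two components of $S^{n-1}\setminus\partial_\infty P$, and $t$ the signed distance to $P$. If $u\to-1$ uniformly on compact subsets of $S_-$ and $u\to+1$ uniformly on compact subsets of $S_+$, then $u$ depends only on $t$. \end{itemize}
   Context: $\mathbb H^n$ is hyperbolic $n$-space, with the upper half-space model $\{(x,y):x>0,y\in\mathbb R^{n-1}\}$, metric $(dx^2+|dy|^2)/x^2$, and the Poincaré ball model $\{|z|<1\}$, metric $4|dz|^2/(1-|z|^2)^2$; $\Delta_g$ is its Laplace–Beltrami operator. $S^{n-1}=\partial_\infty\mathbb H^n$ is the sphere at infinity (in the ball model the unit sphere, in the upper half-space model $\{x=0\}\cup\{\infty\}$); convergence of $u$ on subsets of $S^{n-1}$ means convergence as points of $\mathbb H^n$ approach those boundary points in $\overline{\mathbb H^n}$. $H_p$ denotes the group of isometries acting by Euclidean motions of $y\in\mathbb R^{n-1}$ (fixing the boundary point $\infty$). *)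

theory Defs
  imports "HOL-Analysis.Analysis"
begin

(* Points of R^n are represented as  real \<times> real^'k  with CARD('k) = n - 1,
   so n = CARD('k) + 1 \<ge> 2 automatically.  The first coordinate is the
   distinguished one (the x-coordinate of the upper half-space model). *)

type_synonym 'k pt = "real \<times> (real ^ 'k)"

abbreviation hball :: "'k::finite pt set" where
  "hball \<equiv> ball 0 1"

definition C2_on :: "'a::euclidean_space set \<Rightarrow> ('a \<Rightarrow> real) \<Rightarrow> bool" where
  "C2_on S u \<longleftrightarrow> (\<exists>Du D2u.
     (\<forall>z\<in>S. (u has_derivative blinfun_apply (Du z)) (at z)) \<and>
     (\<forall>z\<in>S. (Du has_derivative blinfun_apply (D2u z)) (at z)) \<and>
     continuous_on S D2u)"

definition euclid_lap :: "('a::euclidean_space \<Rightarrow> real) \<Rightarrow> 'a \<Rightarrow> real" where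
  "euclid_lap u z = (\<Sum>b\<in>Basis. deriv (deriv (\<lambda>s. u (z + s *\<^sub>R b))) 0)"

(* Laplace-Beltrami operator of the ball metric 4|dz|^2/(1-|z|^2)^2 on R^n, n = DIM('a):
   Delta_g u = (1-|z|^2)^2/4 * Delta u + (n-2)(1-|z|^2)/2 * <z, grad u> *)
definition ball_lap :: "('a::euclidean_space \<Rightarrow> real) \<Rightarrow> 'a \<Rightarrow> real" where
  "ball_lap u z =
     (1 - (norm z)\<^sup>2)\<^sup>2 / 4 * euclid_lap u z
     + (real DIM('a) - 2) * (1 - (norm z)\<^sup>2) / 2 * deriv (\<lambda>s. u (z + s *\<^sub>R z)) 0"

definition ball_hdist :: "'a::euclidean_space \<Rightarrow> 'a \<Rightarrow> real" where
  "ball_hdist z w =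
     arcosh (1 + 2 * (norm (z - w))\<^sup>2 / ((1 - (norm z)\<^sup>2) * (1 - (norm w)\<^sup>2)))"

definition ball_isometry :: "('a::euclidean_space \<Rightarrow> 'a) \<Rightarrow> bool" where
  "ball_isometry \<phi> \<longleftrightarrow> bij_betw \<phi> (ball 0 1) (ball 0 1) \<and>
     (\<forall>z\<in>ball 0 1. \<forall>w\<in>ball 0 1. ball_hdist (\<phi> z) (\<phi> w) = ball_hdist z w)"

definition P0 :: "'k::finite pt set" where
  "P0 = {z \<in> ball 0 1. fst z = 0}"

definition signed_dist :: "('k::finite pt \<Rightarrow> 'k pt) \<Rightarrow> 'k pt \<Rightarrow> real" where
  "signed_dist \<phi> z =
     (if 0 \<le> fst (inv_into (ball 0 1) \<phi> z) then 1 else -1) *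
     (INF p\<in>\<phi> ` P0. ball_hdist z p)"

(* e_1 and the isometry (inversion in the sphere of radius sqrt 2 about -e_1) from the
   ball model onto the upper half-space model {(x,y). x > 0}; it is an involution,
   so the half-space point w corresponds to the ball point cayley w *)
definition e1 :: "'k::finite pt" where
  "e1 = (1, 0)"

definition cayley :: "'k::finite pt \<Rightarrow> 'k pt" where
  "cayley z = (2 / (norm (z + e1))\<^sup>2) *\<^sub>R (z + e1) - e1"

(* smaller root of a^2 - (n-1) a + c = 0 *)
definition root_minus :: "real \<Rightarrow> real \<Rightarrow> real" where
  "root_minus n c = ((n - 1) - sqrt ((n - 1)\<^sup>2 - 4 * c)) / 2"

definition conv_to_boundary_set :: "('a::euclidean_space \<Rightarrow> real) \<Rightarrow> 'a set \<Rightarrow> real \<Rightarrow> bool" where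
  "conv_to_boundary_set u K a \<longleftrightarrow>
     (\<forall>\<epsilon>>0. \<exists>\<delta>>0. \<forall>z\<in>ball 0 1. (\<exists>k\<in>K. dist z k < \<delta>) \<longrightarrow> \<bar>u z - a\<bar> < \<epsilon>)"

end

theory Submission
  imports Defs
begin

text \<open>Every step compares the solution with explicit functions at an extremal point, so only the
  second derivative test is needed. Penalizing with \<open>- ln (1 - |z|\<^sup>2)\<close>, whose Laplacian is bounded,
  gives a maximum principle at infinity, hence \<open>|u| \<le> 1\<close>.

  If \<open>u\<close> tends to 1 everywhere at infinity, let \<open>v\<close> be the Euclidean layer, \<open>v' = sqrt (2 F(v))\<close>, and
  \<open>b\<close> a Busemann function with \<open>\<Delta>b = n - 1\<close>. All \<open>v(b + s)\<close> are strict subsolutions; the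
  largest one below \<open>u\<close> on the compact set \<open>u \<le> 1 - \<epsilon>\<close> lies below \<open>u\<close> everywhere and touches it,
  which is impossible unless that set is empty.

  The decay statements reduce to one Liouville theorem in the half-space: if \<open>|u| \<le> C x\<^sup>\<alpha>\<close>
  with \<open>\<alpha> > \<alpha>\<^sub>-\<close>, comparison with \<open>M x\<^sup>\<sigma>\<^sup>+\<^sup>d + \<eta> x\<^sup>\<sigma>\<^sup>-\<^sup>d\<close>, \<open>\<sigma> = (n - 1)/2\<close>, improves the exponent
  beyond \<open>\<sigma>\<close>, and then comparison with \<open>\<eta> x\<^sup>\<sigma>\<close> gives \<open>u = 0\<close>. In particular the hypotheses of
  part (ii) are contradictory.

  For part (iii), slide \<open>u\<close> by translations orthogonal to the hyperplane \<open>P\<close>, composed with a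
  hyperbolic reflection \<open>h\<close> that preserves \<open>P\<close>; far out, one of the two compared functions is
  always near its well, where \<open>f\<close> is increasing. The limit of small translations gives
  \<open>u \<le> u \<circ> h\<close>, hence \<open>u = u \<circ> h\<close> because \<open>h\<close> is an involution, and these reflections
  act transitively on the equidistant hypersurfaces of \<open>P\<close>.\<close>

section \<open>The Laplacian of a conformal metric\<close>

text \<open>The Laplacian is kept for a general conformal weight so that one inversion lemma serves
  the reflections of the ball as well as the passage to the half-space. Two obstacles shape the
  argument. Hyperbolic space is not compact, so an extremum has to be forced: by a logarithmic
  penalty in the ball, by a growing barrier on Euclidean strips. And f is not monotone on [-1,1], so
  comparison is available only where the values are near a well; the remaining region is enclosed in
  a compact set, where a one-parameter family of competitors is moved until first contact. The
  number \<sigma> = (n - 1)/2 is critical because \<Delta> x^p = (p^2 - 2 \<sigma> p) x^p, so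
  \<sigma>^2 is the largest c for which \<Delta> \<phi> = - c \<phi> has a power solution with real
  exponent: this is the threshold in L \<le> (n - 1)^2/4. Sliding by pure translations would give
  monotonicity only; the inserted reflection turns the limit of vanishing translation into a
  symmetry.\<close>

text \<open>\<open>lapl S \<omega> d\<omega> u g l\<close> says that on \<open>S\<close> the function \<open>u\<close> is twice differentiable with Euclidean
  gradient field \<open>g\<close>, and that \<open>l\<close> is its Laplacian for the conformal metric \<open>\<omega>\<^sup>-\<^sup>2 |dz|\<^sup>2\<close>;
  \<open>d\<omega>\<close> is the Euclidean gradient of \<open>\<omega>\<close>, and \<open>A z\<close> below is the Hessian of \<open>u\<close>.\<close>

definition lapl ::
  "'a::euclidean_space set \<Rightarrow> ('a \<Rightarrow> real) \<Rightarrow> ('a \<Rightarrow> 'a) \<Rightarrow> ('a \<Rightarrow> real) \<Rightarrow> ('a \<Rightarrow> 'a) \<Rightarrow> ('a \<Rightarrow> real) \<Rightarrow> bool"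
  where "lapl S \<omega> d\<omega> u g l \<longleftrightarrow> (\<exists>A. \<forall>z\<in>S.
    (u has_derivative (\<lambda>h. g z \<bullet> h)) (at z) \<and> (g has_derivative A z) (at z) \<and>
    l z = (\<omega> z)\<^sup>2 * (\<Sum>b\<in>Basis. A z b \<bullet> b) - (real DIM('a) - 2) * \<omega> z * (d\<omega> z \<bullet> g z))"

lemma laplI:
  assumes "\<And>z. z \<in> S \<Longrightarrow> (u has_derivative (\<lambda>h. g z \<bullet> h)) (at z)"
    and "\<And>z. z \<in> S \<Longrightarrow> (g has_derivative A z) (at z)"
    and "\<And>z. z \<in> S \<Longrightarrow> l z = (\<omega> z)\<^sup>2 * (\<Sum>b\<in>Basis. A z b \<bullet> b)
           - (real DIM('a::euclidean_space) - 2) * \<omega> z * (d\<omega> z \<bullet> g z)"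
  shows "lapl (S :: 'a set) \<omega> d\<omega> u g l"
  using assms unfolding lapl_def by blast

lemma lapl_cong:
  assumes "lapl S \<omega> d\<omega> u g l" "\<And>z. z \<in> S \<Longrightarrow> l z = l' z"
  shows "lapl S \<omega> d\<omega> u g l'"
  using assms unfolding lapl_def by auto

lemma lapl_continuous_on: "lapl S \<omega> d\<omega> u g l \<Longrightarrow> continuous_on S u"
  unfolding lapl_def
  by (meson continuous_at_imp_continuous_on has_derivative_continuous)

lemma lapl_add:
  assumes "lapl S \<omega> d\<omega> u g l" "lapl S \<omega> d\<omega> v k m"
  shows "lapl S \<omega> d\<omega> (\<lambda>z. u z + v z) (\<lambda>z. g z + k z) (\<lambda>z. l z + m z)"
proof -
  obtain A where A: "\<And>z. z \<in> S \<Longrightarrow> (u has_derivative (\<lambda>h. g z \<bullet> h)) (at z) \<and>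
      (g has_derivative A z) (at z) \<and>
      l z = (\<omega> z)\<^sup>2 * (\<Sum>b\<in>Basis. A z b \<bullet> b) - (real DIM('a) - 2) * \<omega> z * (d\<omega> z \<bullet> g z)"
    using assms(1) unfolding lapl_def by blast
  obtain B where B: "\<And>z. z \<in> S \<Longrightarrow> (v has_derivative (\<lambda>h. k z \<bullet> h)) (at z) \<and>
      (k has_derivative B z) (at z) \<and>
      m z = (\<omega> z)\<^sup>2 * (\<Sum>b\<in>Basis. B z b \<bullet> b) - (real DIM('a) - 2) * \<omega> z * (d\<omega> z \<bullet> k z)"
    using assms(2) unfolding lapl_def by blast
  show ?thesis
  proof (rule laplI[where A = "\<lambda>z h. A z h + B z h"])
    fix z assume z: "z \<in> S"
    show "((\<lambda>z. u z + v z) has_derivative (\<lambda>h. (g z + k z) \<bullet> h)) (at z)"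
      unfolding inner_add_left using A[OF z] B[OF z] by (intro has_derivative_add) auto
    show "((\<lambda>z. g z + k z) has_derivative (\<lambda>h. A z h + B z h)) (at z)"
      using A[OF z] B[OF z] by (intro has_derivative_add) auto
    have t: "(\<Sum>b\<in>Basis. (A z b + B z b) \<bullet> b) = (\<Sum>b\<in>Basis. A z b \<bullet> b) + (\<Sum>b\<in>Basis. B z b \<bullet> b)"
      by (simp add: inner_add_left sum.distrib)
    show "l z + m z = (\<omega> z)\<^sup>2 * (\<Sum>b\<in>Basis. (A z b + B z b) \<bullet> b)
       - (real DIM('a) - 2) * \<omega> z * (d\<omega> z \<bullet> (g z + k z))"
      using A[OF z] B[OF z] unfolding t by (simp add: inner_add_right ring_distribs)
  qed
qed

lemma lapl_const: "lapl S \<omega> d\<omega> (\<lambda>z. c) (\<lambda>z. 0) (\<lambda>z. 0)"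
  by (rule laplI[where A = "\<lambda>z h. 0"]) auto

text \<open>The factor \<open>(\<omega> z)\<^sup>2 * (g z \<bullet> g z)\<close> is the squared
  length of the gradient in the conformal metric, so this is the Riemannian chain rule.\<close>

lemma lapl_compose:
  assumes "lapl S \<omega> d\<omega> u g l"
    and "\<And>z. z \<in> S \<Longrightarrow> (P has_real_derivative P1 (u z)) (at (u z))"
    and "\<And>z. z \<in> S \<Longrightarrow> (P1 has_real_derivative P2 (u z)) (at (u z))"
  shows "lapl S \<omega> d\<omega> (\<lambda>z. P (u z)) (\<lambda>z. P1 (u z) *\<^sub>R g z)
           (\<lambda>z. P1 (u z) * l z + P2 (u z) * ((\<omega> z)\<^sup>2 * (g z \<bullet> g z)))"
proof -
  obtain A where A: "\<And>z. z \<in> S \<Longrightarrow> (u has_derivative (\<lambda>h. g z \<bullet> h)) (at z) \<and>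
      (g has_derivative A z) (at z) \<and>
      l z = (\<omega> z)\<^sup>2 * (\<Sum>b\<in>Basis. A z b \<bullet> b) - (real DIM('a) - 2) * \<omega> z * (d\<omega> z \<bullet> g z)"
    using assms(1) unfolding lapl_def by blast
  show ?thesis
  proof (rule laplI[where A = "\<lambda>z h. P1 (u z) *\<^sub>R A z h + (P2 (u z) * (g z \<bullet> h)) *\<^sub>R g z"])
    fix z assume z: "z \<in> S"
    have d1: "((\<lambda>z. Q (u z)) has_derivative (\<lambda>h. Q' * (g z \<bullet> h))) (at z)"
      if "(Q has_real_derivative Q') (at (u z))" for Q Q'
      using has_derivative_compose[of u "\<lambda>h. g z \<bullet> h" z UNIV Q "(*) Q'"] A[OF z] that
      by (auto simp: has_field_derivative_def)
    show "((\<lambda>z. P (u z)) has_derivative (\<lambda>h. (P1 (u z) *\<^sub>R g z) \<bullet> h)) (at z)"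
      using d1[OF assms(2)[OF z]] by simp
    show "((\<lambda>z. P1 (u z) *\<^sub>R g z) has_derivative
        (\<lambda>h. P1 (u z) *\<^sub>R A z h + (P2 (u z) * (g z \<bullet> h)) *\<^sub>R g z)) (at z)"
      using d1[OF assms(3)[OF z]] A[OF z] by (intro has_derivative_scaleR) auto
    have t: "(\<Sum>b\<in>Basis. (P1 (u z) *\<^sub>R A z b + (P2 (u z) * (g z \<bullet> b)) *\<^sub>R g z) \<bullet> b)
      = P1 (u z) * (\<Sum>b\<in>Basis. A z b \<bullet> b) + P2 (u z) * (g z \<bullet> g z)"
      unfolding euclidean_inner[of "g z" "g z"]
      by (simp add: inner_add_left sum.distrib sum_distrib_left mult.assoc)
    show "P1 (u z) * l z + P2 (u z) * ((\<omega> z)\<^sup>2 * (g z \<bullet> g z)) =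
      (\<omega> z)\<^sup>2 * (\<Sum>b\<in>Basis. (P1 (u z) *\<^sub>R A z b + (P2 (u z) * (g z \<bullet> b)) *\<^sub>R g z) \<bullet> b)
       - (real DIM('a) - 2) * \<omega> z * (d\<omega> z \<bullet> P1 (u z) *\<^sub>R g z)"
      using A[OF z] unfolding t by (simp add: ring_distribs)
  qed
qed

lemma lapl_mult:
  assumes "lapl S \<omega> d\<omega> u g l" "lapl S \<omega> d\<omega> v k m"
  shows "lapl S \<omega> d\<omega> (\<lambda>z. u z * v z) (\<lambda>z. u z *\<^sub>R k z + v z *\<^sub>R g z)
           (\<lambda>z. u z * m z + v z * l z + 2 * ((\<omega> z)\<^sup>2 * (g z \<bullet> k z)))"
proof -
  obtain A where A: "\<And>z. z \<in> S \<Longrightarrow> (u has_derivative (\<lambda>h. g z \<bullet> h)) (at z) \<and>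
      (g has_derivative A z) (at z) \<and>
      l z = (\<omega> z)\<^sup>2 * (\<Sum>b\<in>Basis. A z b \<bullet> b) - (real DIM('a) - 2) * \<omega> z * (d\<omega> z \<bullet> g z)"
    using assms(1) unfolding lapl_def by blast
  obtain B where B: "\<And>z. z \<in> S \<Longrightarrow> (v has_derivative (\<lambda>h. k z \<bullet> h)) (at z) \<and>
      (k has_derivative B z) (at z) \<and>
      m z = (\<omega> z)\<^sup>2 * (\<Sum>b\<in>Basis. B z b \<bullet> b) - (real DIM('a) - 2) * \<omega> z * (d\<omega> z \<bullet> k z)"
    using assms(2) unfolding lapl_def by blast
  show ?thesis
  proof (rule laplI[where A = "\<lambda>z h. (u z *\<^sub>R B z h + (g z \<bullet> h) *\<^sub>R k z)
      + (v z *\<^sub>R A z h + (k z \<bullet> h) *\<^sub>R g z)"])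
    fix z assume z: "z \<in> S"
    have "((\<lambda>z. u z * v z) has_derivative (\<lambda>h. u z * (k z \<bullet> h) + (g z \<bullet> h) * v z)) (at z)"
      using A[OF z] B[OF z] by (intro has_derivative_mult) auto
    then show "((\<lambda>z. u z * v z) has_derivative (\<lambda>h. (u z *\<^sub>R k z + v z *\<^sub>R g z) \<bullet> h)) (at z)"
      by (simp add: inner_add_left mult.commute)
    show "((\<lambda>z. u z *\<^sub>R k z + v z *\<^sub>R g z) has_derivative
        (\<lambda>h. (u z *\<^sub>R B z h + (g z \<bullet> h) *\<^sub>R k z) + (v z *\<^sub>R A z h + (k z \<bullet> h) *\<^sub>R g z))) (at z)"
      using A[OF z] B[OF z] by (intro has_derivative_add has_derivative_scaleR) auto
    have t: "(\<Sum>b\<in>Basis. ((u z *\<^sub>R B z b + (g z \<bullet> b) *\<^sub>R k z)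
          + (v z *\<^sub>R A z b + (k z \<bullet> b) *\<^sub>R g z)) \<bullet> b)
      = u z * (\<Sum>b\<in>Basis. B z b \<bullet> b) + v z * (\<Sum>b\<in>Basis. A z b \<bullet> b) + 2 * (g z \<bullet> k z)"
      unfolding euclidean_inner[of "g z" "k z"]
      by (simp add: inner_add_left sum.distrib sum_distrib_left mult.assoc mult.commute[of "k z \<bullet> _"])
    show "u z * m z + v z * l z + 2 * ((\<omega> z)\<^sup>2 * (g z \<bullet> k z)) =
      (\<omega> z)\<^sup>2 * (\<Sum>b\<in>Basis. ((u z *\<^sub>R B z b + (g z \<bullet> b) *\<^sub>R k z)
          + (v z *\<^sub>R A z b + (k z \<bullet> b) *\<^sub>R g z)) \<bullet> b)
       - (real DIM('a) - 2) * \<omega> z * (d\<omega> z \<bullet> (u z *\<^sub>R k z + v z *\<^sub>R g z))"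
      using A[OF z] B[OF z] unfolding t by (simp add: inner_add_right ring_distribs)
  qed
qed

lemma lapl_cmult:
  assumes "lapl S \<omega> d\<omega> u g l"
  shows "lapl S \<omega> d\<omega> (\<lambda>z. c * u z) (\<lambda>z. c *\<^sub>R g z) (\<lambda>z. c * l z)"
  using lapl_mult[OF lapl_const[of S \<omega> d\<omega> c] assms] by (simp add: lapl_def)

lemma lapl_diff:
  assumes "lapl S \<omega> d\<omega> u g l" "lapl S \<omega> d\<omega> v k m"
  shows "lapl S \<omega> d\<omega> (\<lambda>z. u z - v z) (\<lambda>z. g z - k z) (\<lambda>z. l z - m z)"
  using lapl_add[OF assms(1) lapl_cmult[OF assms(2), of "-1"]] by simp

text \<open>If D were negative, \<phi>' would be negative just to the right of its zero at 0, and
  the mean value theorem would give a value below \<phi> 0. Only the derivative of \<phi>' at 0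
  itself enters, no continuity of second derivatives.\<close>

lemma second_derivative_nonneg_at_local_min:
  fixes \<phi> :: "real \<Rightarrow> real"
  assumes d: "d > 0" "\<And>s. \<bar>s\<bar> < d \<Longrightarrow> (\<phi> has_real_derivative \<phi>' s) (at s)"
    and D: "(\<phi>' has_real_derivative D) (at 0)"
    and m: "\<And>s. \<bar>s\<bar> < d \<Longrightarrow> \<phi> 0 \<le> \<phi> s"
  shows "\<phi>' 0 = 0" "0 \<le> D"
proof -
  show 0: "\<phi>' 0 = 0"
    using DERIV_local_min[of \<phi> "\<phi>' 0" 0 d] d m by force
  show "0 \<le> D"
  proof (rule ccontr)
    assume "\<not> 0 \<le> D"
    then obtain e where e: "e > 0" "\<And>h. 0 < h \<Longrightarrow> h < e \<Longrightarrow> \<phi>' h < 0"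
      using DERIV_neg_dec_right[OF D] 0 by force
    define s where "s = min d e / 2"
    have s: "0 < s" "s < d" "s < e" using d e by (auto simp: s_def)
    have "\<exists>\<xi>. 0 < \<xi> \<and> \<xi> < s \<and> \<phi> s - \<phi> 0 = (s - 0) * \<phi>' \<xi>"
      using s d(2) by (intro MVT2) auto
    then obtain \<xi> where "0 < \<xi>" "\<xi> < s" "\<phi> s - \<phi> 0 = s * \<phi>' \<xi>" by auto
    moreover from this have "\<phi>' \<xi> < 0" using e s by auto
    ultimately have "\<phi> s < \<phi> 0" using s by (smt (verit) mult_pos_neg)
    then show False using m[of s] s by auto
  qed
qed

text \<open>The one-dimensional test along each coordinate line makes the diagonal of the Hessian
  nonnegative. The gradient vanishes too, which removes the first-order term of the conformal
  Laplacian.\<close>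

lemma lapl_nonneg_at_local_min:
  assumes L: "lapl S \<omega> d\<omega> u g l" and S: "open S" "z \<in> S"
    and e: "e > 0" "\<And>w. dist w z < e \<Longrightarrow> u z \<le> u w"
  shows "0 \<le> l z"
proof -
  obtain A where A: "\<And>z. z \<in> S \<Longrightarrow> (u has_derivative (\<lambda>h. g z \<bullet> h)) (at z) \<and>
      (g has_derivative A z) (at z) \<and>
      l z = (\<omega> z)\<^sup>2 * (\<Sum>b\<in>Basis. A z b \<bullet> b) - (real DIM('a) - 2) * \<omega> z * (d\<omega> z \<bullet> g z)"
    using assms(1) unfolding lapl_def by blast
  obtain r where r: "r > 0" "ball z r \<subseteq> S" using S open_contains_ball by blast
  define d where "d = min e r"
  have line: "g z \<bullet> b = 0 \<and> 0 \<le> A z b \<bullet> b" if b: "b \<in> Basis" for b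
  proof -
    have d0: "d > 0" using e r by (simp add: d_def)
    have in_S: "z + s *\<^sub>R b \<in> S" "dist (z + s *\<^sub>R b) z < e" if "\<bar>s\<bar> < d" for s
      using that r b by (auto simp: d_def dist_norm subset_iff)
    have i: "((\<lambda>s. z + s *\<^sub>R b) has_derivative (\<lambda>t. t *\<^sub>R b)) (at s)" for s
      by (auto intro!: derivative_eq_intros)
    have 1: "((\<lambda>s. u (z + s *\<^sub>R b)) has_real_derivative g (z + s *\<^sub>R b) \<bullet> b) (at s)" if "\<bar>s\<bar> < d" for s
      using has_derivative_compose[OF i, of u "\<lambda>h. g (z + s *\<^sub>R b) \<bullet> h" s] A[OF in_S(1)[OF that]]
      by (auto intro: has_derivative_imp_has_field_derivative)
    have "((\<lambda>s. g (z + s *\<^sub>R b)) has_derivative (\<lambda>t. A z (t *\<^sub>R b))) (at 0)"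
      using has_derivative_compose[OF i, of g "A z" 0] A[OF S(2)] by simp
    then have "((\<lambda>s. g (z + s *\<^sub>R b) \<bullet> b) has_derivative (\<lambda>t. A z (t *\<^sub>R b) \<bullet> b)) (at 0)"
      by (rule has_derivative_inner_left)
    moreover have "A z (t *\<^sub>R b) = t *\<^sub>R A z b" for t
      using A[OF S(2)] has_derivative_bounded_linear linear_simps(5) by blast
    ultimately have 2: "((\<lambda>s. g (z + s *\<^sub>R b) \<bullet> b) has_real_derivative A z b \<bullet> b) (at 0)"
      by (auto intro: has_derivative_imp_has_field_derivative)
    have m: "u (z + 0 *\<^sub>R b) \<le> u (z + s *\<^sub>R b)" if "\<bar>s\<bar> < d" for s
      using e(2)[OF in_S(2)[OF that]] by simp
    show ?thesis
      using second_derivative_nonneg_at_local_min[OF d0 1 2 m] by simp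
  qed
  have "g z = 0" using line euclidean_all_zero_iff by blast
  moreover have "0 \<le> (\<Sum>b\<in>Basis. A z b \<bullet> b)" using line by (simp add: sum_nonneg)
  ultimately show ?thesis using A[OF S(2)] by simp
qed

section \<open>Maximum principles in the ball model\<close>

text \<open>The metric 4 |dz|^2 / (1 - |z|^2)^2 has conformal weight (1 - |z|^2)/2, whose Euclidean
  gradient is - z.\<close>

abbreviation blapl :: "('a::euclidean_space \<Rightarrow> real) \<Rightarrow> ('a \<Rightarrow> 'a) \<Rightarrow> ('a \<Rightarrow> real) \<Rightarrow> bool"
  where "blapl \<equiv> lapl (ball 0 1) (\<lambda>z. (1 - z \<bullet> z) / 2) uminus"

lemma inner_self_lt_1: "z \<in> ball 0 1 \<Longrightarrow> z \<bullet> z < 1" for z :: "'a::real_inner"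
  by (simp add: norm_eq_sqrt_inner)

text \<open>Bridge from \<open>ball_lap\<close>, which is written with iterated directional
  \<open>deriv\<close>, to a gradient field: \<open>g\<close> represents the functional
  \<open>Du z\<close> by an inner product, and \<open>A\<close> does the same for the second
  derivative.\<close>

lemma C2_on_imp_blapl:
  fixes u :: "'a::euclidean_space \<Rightarrow> real"
  assumes "C2_on (ball 0 1) u"
  obtains g where "blapl u g (ball_lap u)"
proof -
  obtain Du D2u where D: "\<And>z. z \<in> ball 0 1 \<Longrightarrow> (u has_derivative blinfun_apply (Du z)) (at z)"
    "\<And>z. z \<in> ball 0 1 \<Longrightarrow> (Du has_derivative blinfun_apply (D2u z)) (at z)"
    using assms unfolding C2_on_def by blast
  define g where "g z = (\<Sum>b\<in>Basis. Du z b *\<^sub>R b)" for z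
  define A where "A z h = (\<Sum>b\<in>Basis. blinfun_apply (D2u z h) b *\<^sub>R b)" for z h
  have g: "g z \<bullet> h = Du z h" for z h
  proof -
    have "Du z h = Du z (\<Sum>b\<in>Basis. (h \<bullet> b) *\<^sub>R b)" by (simp add: euclidean_representation)
    also have "\<dots> = (\<Sum>b\<in>Basis. (h \<bullet> b) * Du z b)" by (simp add: blinfun.sum_right blinfun.scaleR_right)
    finally show ?thesis unfolding g_def inner_sum_left
      by (simp add: inner_commute[of _ h] mult.commute)
  qed
  have A: "A z h \<bullet> b = D2u z h b" if "b \<in> Basis" for z h b
    using that by (simp add: A_def inner_sum_left inner_Basis if_distrib cong: if_cong)
  have line: "((\<lambda>s. u (z + s *\<^sub>R b)) has_real_derivative g (z + s *\<^sub>R b) \<bullet> b) (at s)"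
    if "z + s *\<^sub>R b \<in> ball 0 1" for z s b
  proof -
    have "((\<lambda>s. z + s *\<^sub>R b) has_derivative (\<lambda>t. t *\<^sub>R b)) (at s)"
      by (auto intro!: derivative_eq_intros)
    from has_derivative_compose[OF this D(1)[OF that]] show ?thesis
      by (auto intro!: has_derivative_imp_has_field_derivative simp: g blinfun.scaleR_right)
  qed
  have dg: "(g has_derivative A z) (at z)" if "z \<in> ball 0 1" for z
    unfolding g_def A_def
    by (auto intro!: derivative_eq_intros D(2)[OF that])
  have "blapl u g (ball_lap u)"
  proof (rule laplI[where A = A])
    fix z :: 'a assume z: "z \<in> ball 0 1"
    have "(\<bullet>) (g z) = blinfun_apply (Du z)" by (rule ext) (rule g)
    then show "(u has_derivative (\<bullet>) (g z)) (at z)" using D(1)[OF z] by simp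
    show "(g has_derivative A z) (at z)" by (rule dg[OF z])
    have "deriv (deriv (\<lambda>s. u (z + s *\<^sub>R b))) 0 = A z b \<bullet> b" if b: "b \<in> Basis" for b
    proof -
      have "((\<lambda>s. z + s *\<^sub>R b) has_derivative (\<lambda>t. t *\<^sub>R b)) (at 0)"
        by (auto intro!: derivative_eq_intros)
      from has_derivative_compose[OF this, of g "A z"] dg[OF z]
      have "((\<lambda>s. g (z + s *\<^sub>R b)) has_derivative (\<lambda>t. A z (t *\<^sub>R b))) (at 0)" by simp
      then have "((\<lambda>s. g (z + s *\<^sub>R b) \<bullet> b) has_derivative (\<lambda>t. A z (t *\<^sub>R b) \<bullet> b)) (at 0)"
        by (rule has_derivative_inner_left)
      then have 2: "((\<lambda>s. g (z + s *\<^sub>R b) \<bullet> b) has_real_derivative A z b \<bullet> b) (at 0)"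
        by (auto intro!: has_derivative_imp_has_field_derivative
            simp: A[OF b] blinfun.scaleR_right blinfun.scaleR_left)
      \<comment> \<open>The outer \<open>deriv\<close> at 0 sees the inner one on a whole
        neighbourhood, so the line has to stay in the ball for all small s.\<close>
      have "open ((\<lambda>s. z + s *\<^sub>R b) -` ball 0 1)"
        by (intro open_vimage continuous_intros) auto
      moreover have "0 \<in> (\<lambda>s. z + s *\<^sub>R b) -` ball 0 1" using z by simp
      ultimately have "\<forall>\<^sub>F s in nhds 0. z + s *\<^sub>R b \<in> ball 0 1"
        unfolding eventually_nhds by blast
      then have "\<forall>\<^sub>F s in nhds 0. deriv (\<lambda>s. u (z + s *\<^sub>R b)) s = g (z + s *\<^sub>R b) \<bullet> b"
        by eventually_elim (rule DERIV_imp_deriv[OF line])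
      then have "deriv (deriv (\<lambda>s. u (z + s *\<^sub>R b))) 0 = deriv (\<lambda>s. g (z + s *\<^sub>R b) \<bullet> b) 0"
        by (rule deriv_cong_ev) simp
      then show ?thesis using DERIV_imp_deriv[OF 2] by simp
    qed
    then have "euclid_lap u z = (\<Sum>b\<in>Basis. A z b \<bullet> b)" unfolding euclid_lap_def by simp
    moreover have "deriv (\<lambda>s. u (z + s *\<^sub>R z)) 0 = z \<bullet> g z"
      using DERIV_imp_deriv[OF line[of z 0 z]] z by (simp add: inner_commute)
    ultimately show "ball_lap u z = ((1 - z \<bullet> z) / 2)\<^sup>2 * (\<Sum>b\<in>Basis. A z b \<bullet> b)
        - (real DIM('a) - 2) * ((1 - z \<bullet> z) / 2) * (- z \<bullet> g z)"
      unfolding ball_lap_def by (simp add: power2_norm_eq_inner power_divide)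
  qed
  then show ?thesis by (rule that)
qed

text \<open>The centre is left free because three choices are needed: the origin for the logarithmic
  penalty, the boundary point \<open>- e\<close> for the Busemann function, and a point off the zero
  set for the barrier in the strong maximum principle.\<close>

lemma blapl_dist_square:
  fixes c :: "'a::euclidean_space"
  shows "blapl (\<lambda>z. (z - c) \<bullet> (z - c)) (\<lambda>z. 2 *\<^sub>R (z - c))
    (\<lambda>z. ((1 - z \<bullet> z) / 2)\<^sup>2 * (2 * real DIM('a))
      + (real DIM('a) - 2) * (1 - z \<bullet> z) * (z \<bullet> (z - c)))"
proof (rule laplI[where A = "\<lambda>z h. 2 *\<^sub>R h"])
  fix z :: 'a
  show "((\<lambda>z. (z - c) \<bullet> (z - c)) has_derivative (\<lambda>h. 2 *\<^sub>R (z - c) \<bullet> h)) (at z)"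
    by (auto intro!: derivative_eq_intros simp: inner_commute)
  show "((\<lambda>z. 2 *\<^sub>R (z - c)) has_derivative (\<lambda>h. 2 *\<^sub>R h)) (at z)"
    by (auto intro!: derivative_eq_intros)
  show "((1 - z \<bullet> z) / 2)\<^sup>2 * (2 * real DIM('a)) + (real DIM('a) - 2) * (1 - z \<bullet> z) * (z \<bullet> (z - c))
    = ((1 - z \<bullet> z) / 2)\<^sup>2 * (\<Sum>b\<in>(Basis :: 'a set). 2 *\<^sub>R b \<bullet> b)
      - (real DIM('a) - 2) * ((1 - z \<bullet> z) / 2) * (- z \<bullet> 2 *\<^sub>R (z - c))"
    by (simp add: mult.commute)
qed

text \<open>This function equals 2 ln cosh(d/2), where d is the hyperbolic distance to the origin.
  It tends to infinity at the boundary, while its Laplacian interpolates linearly in |z|^2 between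
  N/2 and N - 1, N being the dimension.\<close>

lemma blapl_neg_ln:
  "blapl (\<lambda>z::'a::euclidean_space. - ln (1 - z \<bullet> z)) (\<lambda>z. (2 / (1 - z \<bullet> z)) *\<^sub>R z)
    (\<lambda>z. real DIM('a) * (1 - z \<bullet> z) / 2 + (real DIM('a) - 1) * (z \<bullet> z))"
proof -
  have sq: "blapl (\<lambda>z::'a. z \<bullet> z) (\<lambda>z. 2 *\<^sub>R z)
    (\<lambda>z. ((1 - z \<bullet> z) / 2)\<^sup>2 * (2 * real DIM('a)) + (real DIM('a) - 2) * (1 - z \<bullet> z) * (z \<bullet> z))"
    using blapl_dist_square[of "0::'a"] by simp
  have *: "blapl (\<lambda>z::'a. - ln (1 - z \<bullet> z)) (\<lambda>z. (1 / (1 - z \<bullet> z)) *\<^sub>R 2 *\<^sub>R z)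
    (\<lambda>z. 1 / (1 - z \<bullet> z) * (((1 - z \<bullet> z) / 2)\<^sup>2 * (2 * real DIM('a))
        + (real DIM('a) - 2) * (1 - z \<bullet> z) * (z \<bullet> z))
      + 1 / (1 - z \<bullet> z)\<^sup>2 * (((1 - z \<bullet> z) / 2)\<^sup>2 * (2 *\<^sub>R z \<bullet> 2 *\<^sub>R z)))"
  proof (rule lapl_compose[OF sq, where P = "\<lambda>s. - ln (1 - s)"])
    fix z :: 'a assume "z \<in> ball 0 1"
    then have s: "z \<bullet> z < 1" by (rule inner_self_lt_1)
    show "((\<lambda>s. - ln (1 - s)) has_real_derivative 1 / (1 - z \<bullet> z)) (at (z \<bullet> z))"
      using s by (auto intro!: derivative_eq_intros)
    show "((\<lambda>s. 1 / (1 - s)) has_real_derivative 1 / (1 - z \<bullet> z)\<^sup>2) (at (z \<bullet> z))"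
      using s by (auto intro!: derivative_eq_intros simp: power2_eq_square)
  qed
  have "blapl (\<lambda>z::'a. - ln (1 - z \<bullet> z)) (\<lambda>z. (1 / (1 - z \<bullet> z)) *\<^sub>R 2 *\<^sub>R z)
    (\<lambda>z. real DIM('a) * (1 - z \<bullet> z) / 2 + (real DIM('a) - 1) * (z \<bullet> z))"
  proof (rule lapl_cong[OF *])
    fix z :: 'a assume "z \<in> ball 0 1"
    then have s: "1 - z \<bullet> z \<noteq> 0" using inner_self_lt_1 by force
    have e: "1 / t * ((t / 2)\<^sup>2 * (2 * N) + (N - 2) * t * s) + 1 / t\<^sup>2 * ((t / 2)\<^sup>2 * (4 * s))
        = N * t / 2 + (N - 1) * s" if "t \<noteq> 0" for t s N :: real
      using that by (simp add: field_simps power2_eq_square)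
    show "1 / (1 - z \<bullet> z) * (((1 - z \<bullet> z) / 2)\<^sup>2 * (2 * real DIM('a))
        + (real DIM('a) - 2) * (1 - z \<bullet> z) * (z \<bullet> z))
      + 1 / (1 - z \<bullet> z)\<^sup>2 * (((1 - z \<bullet> z) / 2)\<^sup>2 * (2 *\<^sub>R z \<bullet> 2 *\<^sub>R z))
      = real DIM('a) * (1 - z \<bullet> z) / 2 + (real DIM('a) - 1) * (z \<bullet> z)"
      using e[OF s, of "real DIM('a)" "z \<bullet> z"] by simp
  qed
  then show ?thesis by simp
qed

text \<open>The infimum of w need not be attained, so \<open>neg\<close> asks for a uniform bound
  \<kappa> on each set w < - \<delta>: the sign of the Laplacian must survive the perturbation by
  \<eta> \<phi>, whose Laplacian is at most \<eta> times the dimension.\<close>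

lemma maximum_principle_at_infinity:
  fixes w :: "'a::euclidean_space \<Rightarrow> real"
  assumes w: "blapl w g l" and bdd: "\<And>z. z \<in> ball 0 1 \<Longrightarrow> - B \<le> w z"
    and neg: "\<And>\<delta>. \<delta> > 0 \<Longrightarrow> \<exists>\<kappa>>0. \<forall>z\<in>ball 0 1. w z < - \<delta> \<longrightarrow> l z \<le> - \<kappa>"
    and z0: "z0 \<in> ball 0 1"
  shows "0 \<le> w z0"
proof (rule ccontr)
  assume "\<not> 0 \<le> w z0"
  define \<delta> where "\<delta> = - w z0 / 2"
  have \<delta>: "\<delta> > 0" using \<open>\<not> 0 \<le> w z0\<close> by (simp add: \<delta>_def)
  obtain \<kappa> where \<kappa>: "\<kappa> > 0" "\<And>z. z \<in> ball 0 1 \<Longrightarrow> w z < - \<delta> \<Longrightarrow> l z \<le> - \<kappa>"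
    using neg[OF \<delta>] by blast
  define \<phi> where "\<phi> z = - ln (1 - z \<bullet> z)" for z :: 'a
  define h m where "h z = (2 / (1 - z \<bullet> z)) *\<^sub>R z"
    and "m z = real DIM('a) * (1 - z \<bullet> z) / 2 + (real DIM('a) - 1) * (z \<bullet> z)" for z :: 'a
  have hm: "blapl \<phi> h m" unfolding \<phi>_def h_def m_def by (rule blapl_neg_ln)
  have m_le: "m z \<le> real DIM('a)" if "z \<in> ball 0 1" for z
  proof -
    have "0 \<le> real DIM('a) * (1 - z \<bullet> z)" using inner_self_lt_1[OF that] by simp
    moreover have "real DIM('a) * (1 - z \<bullet> z) / 2 + (real DIM('a) - 1) * (z \<bullet> z)
      = real DIM('a) - real DIM('a) * (1 - z \<bullet> z) / 2 - z \<bullet> z" by (simp add: field_simps)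
    ultimately show ?thesis unfolding m_def using inner_ge_zero[of z] by linarith
  qed
  have \<phi>_nn: "0 \<le> \<phi> z" if "z \<in> ball 0 1" for z
    using inner_self_lt_1[OF that] by (simp add: \<phi>_def)
  \<comment> \<open>The first bound keeps the perturbed function below - \<delta> at
    \<open>z0\<close>, where w is - 2 \<delta>; the second makes \<eta> times the Laplacian of
    \<phi> smaller than \<kappa>.\<close>
  define \<eta> where "\<eta> = min (\<delta> / (\<phi> z0 + 1)) (\<kappa> / (real DIM('a) + 1)) / 2"
  have \<eta>: "\<eta> > 0" "\<eta> * \<phi> z0 < \<delta>" "\<eta> * real DIM('a) < \<kappa>"
  proof -
    have p: "0 < \<phi> z0 + 1" using \<phi>_nn[OF z0] by simp
    show 1: "\<eta> > 0" using p \<delta> \<kappa> by (simp add: \<eta>_def)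
    have "\<eta> \<le> \<delta> / (\<phi> z0 + 1)" "\<eta> \<le> \<kappa> / (real DIM('a) + 1)"
      using 1 unfolding \<eta>_def by linarith+
    then have "\<eta> * (\<phi> z0 + 1) \<le> \<delta>" "\<eta> * (real DIM('a) + 1) \<le> \<kappa>"
      using p by (simp_all add: pos_le_divide_eq add_pos_nonneg)
    then show "\<eta> * \<phi> z0 < \<delta>" "\<eta> * real DIM('a) < \<kappa>" using 1 by (simp_all add: algebra_simps)
  qed
  define W where "W z = w z + \<eta> * \<phi> z" for z
  have W: "blapl W (\<lambda>z. g z + \<eta> *\<^sub>R h z) (\<lambda>z. l z + \<eta> * m z)"
    unfolding W_def by (rule lapl_add[OF w lapl_cmult[OF hm]])
  \<comment> \<open>Outside this radius \<eta> \<phi> is at least \<open>\<bar>B\<bar>\<close>,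
    hence W is nonnegative there. Including \<open>norm z0\<close> puts \<open>z0\<close> into the
    compact ball, so the minimum over that ball is a global one.\<close>
  define r where "r = max (norm z0) (sqrt (1 - exp (- \<bar>B\<bar> / \<eta>)))"
  have r: "r < 1" "norm z0 \<le> r" using z0 by (auto simp: r_def)
  have far: "0 \<le> W z" if z: "z \<in> ball 0 1" "r < norm z" for z
  proof -
    have "sqrt (1 - exp (- \<bar>B\<bar> / \<eta>)) < norm z" using z by (simp add: r_def)
    then have "1 - exp (- \<bar>B\<bar> / \<eta>) < z \<bullet> z"
      by (simp add: norm_eq_sqrt_inner)
    then have "1 - z \<bullet> z < exp (- \<bar>B\<bar> / \<eta>)" by simp
    then have "ln (1 - z \<bullet> z) < - \<bar>B\<bar> / \<eta>"
      using inner_self_lt_1[OF z(1)] by (metis diff_gt_0_iff_gt exp_gt_zero ln_exp ln_less_cancel_iff)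
    then have "\<bar>B\<bar> \<le> \<eta> * \<phi> z" using \<eta>(1) by (simp add: \<phi>_def field_simps)
    then show ?thesis using bdd[OF z(1)] by (simp add: W_def)
  qed
  have "continuous_on (cball 0 r) W"
    using lapl_continuous_on[OF W] r(1) by (rule_tac continuous_on_subset) auto
  moreover have "cball 0 r \<noteq> ({} :: 'a set)" using r(2) z0 by (auto simp: not_less intro: order_trans[OF norm_ge_zero])
  ultimately obtain p where p: "p \<in> cball 0 r" "\<And>z. z \<in> cball 0 r \<Longrightarrow> W p \<le> W z"
    using continuous_attains_inf[of "cball 0 r" W] by auto
  have pb: "p \<in> ball 0 1" using p r by auto
  have Wz0: "W z0 < - \<delta>" using \<eta>(2) unfolding W_def \<delta>_def by simp
  have Wp: "W p < - \<delta>" using p(2)[of z0] r Wz0 by simp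
  have gmin: "W p \<le> W z" if "z \<in> ball 0 1" for z
    using that p(2)[of z] far[of z] Wp \<delta> by (cases "norm z \<le> r") auto
  obtain e where e: "e > 0" "ball p e \<subseteq> ball 0 1" using pb open_contains_ball open_ball by metis
  have "0 \<le> l p + \<eta> * m p"
    by (rule lapl_nonneg_at_local_min[OF W open_ball pb e(1)])
      (use gmin e(2) in \<open>auto simp: subset_iff dist_commute\<close>)
  moreover have "\<eta> * m p \<le> \<eta> * real DIM('a)" using m_le[OF pb] \<eta>(1) by simp
  moreover have "w p \<le> W p" using \<phi>_nn[OF pb] \<eta>(1) by (simp add: W_def)
  then have "l p \<le> - \<kappa>" using \<kappa>(2)[OF pb] Wp by simp
  ultimately show False using \<eta>(3) by linarith
qed

text \<open>The barrier is centred off the zero set, so it is a strict subsolution near the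
  touching point, and only the second derivative test is needed there.\<close>

lemma strong_maximum_principle_touching:
  fixes w :: "'a::euclidean_space \<Rightarrow> real"
  assumes w: "blapl w g l" and nn: "\<And>z. z \<in> ball 0 1 \<Longrightarrow> 0 \<le> w z"
    and lC: "\<And>z. z \<in> ball 0 1 \<Longrightarrow> l z \<le> C * w z" and C: "0 \<le> C"
    and y: "y \<in> ball 0 1" "w y = 0" "dist y c = \<rho>" "\<rho> > 0" and sub: "c \<in> ball 0 1"
    and pos: "\<And>z. z \<in> ball 0 1 \<Longrightarrow> dist z c \<le> \<rho> \<Longrightarrow> z \<noteq> y \<Longrightarrow> 0 < w z"
  shows False
proof -
  \<comment> \<open>The bound \<open>\<rho> / 2\<close> keeps the small ball away from
    \<open>c\<close>, where the gradient of the barrier vanishes; the other bound keeps it inside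
    the unit ball.\<close>
  define d where "d = min (\<rho> / 2) ((1 - norm y) / 2)"
  have d: "d > 0" "d \<le> \<rho> / 2" "norm y + d < 1" using y by (auto simp: d_def min_def field_simps)
  have in_ball: "z \<in> ball 0 1" "norm z \<le> norm y + d" if "z \<in> cball y d" for z
  proof -
    have "norm z \<le> norm y + norm (z - y)" by (metis add.commute diff_add_cancel norm_triangle_ineq)
    then show "norm z \<le> norm y + d" using that by (simp add: dist_norm norm_minus_commute)
    then show "z \<in> ball 0 1" using d by simp
  qed
  define t where "t = norm y + d"
  define N where "N = real DIM('a)"
  define \<omega>0 where "\<omega>0 = (1 - t\<^sup>2) / 2"
  have t: "0 \<le> t" "t < 1" using d by (auto simp: t_def)
  have \<omega>0: "\<omega>0 > 0" using t by (simp add: \<omega>0_def abs_square_less_1)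
  define m0 where "m0 = \<omega>0\<^sup>2 * \<rho>\<^sup>2"
  have m0: "m0 > 0" using \<omega>0 y by (simp add: m0_def)
  \<comment> \<open>Bound for the Laplacian of the squared distance to \<open>c\<close>: 2 N from
    the second-order part and 2 (N + 2) from the first-order part.\<close>
  define Q where "Q = 4 * N + 4"
  have N: "N \<ge> 1" unfolding N_def by (simp add: Suc_leI)
  \<comment> \<open>In the Laplacian of the barrier the gradient term carries a^2 and a factor of at
    least \<open>m0\<close>, the other term only a; a large \<open>a\<close> therefore beats both
    \<open>Q\<close> and \<open>C\<close>.\<close>
  define a where "a = max 1 ((C + Q + 1) / m0)"
  have a: "a \<ge> 1" "(C + Q + 1) \<le> a * m0"
    using m0 by (auto simp: a_def pos_divide_le_eq[symmetric])
  have a2: "C + a * Q < a\<^sup>2 * m0"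
  proof -
    have "1 * C \<le> a * C" using a(1) C by (intro mult_right_mono) auto
    then have "C + a * Q < a * (C + Q + 1)" using a(1) by (simp add: ring_distribs)
    also have "\<dots> \<le> a * (a * m0)" using a by (intro mult_left_mono) auto
    finally show ?thesis by (simp add: power2_eq_square)
  qed
  define q where "q z = (z - c) \<bullet> (z - c)" for z
  define lq where "lq z = ((1 - z \<bullet> z) / 2)\<^sup>2 * (2 * real DIM('a))
      + (real DIM('a) - 2) * (1 - z \<bullet> z) * (z \<bullet> (z - c))" for z
  have q: "blapl q (\<lambda>z. 2 *\<^sub>R (z - c)) lq"
    unfolding q_def lq_def by (rule blapl_dist_square)
  \<comment> \<open>Positive inside the ball of radius \<rho> about \<open>c\<close>, zero on its
    boundary sphere, which contains \<open>y\<close>, and negative outside.\<close>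
  define \<psi> where "\<psi> z = exp (- a * q z) + - exp (- a * \<rho>\<^sup>2)" for z
  define l\<psi> where "l\<psi> z = - a * exp (- a * q z) * lq z
      + a\<^sup>2 * exp (- a * q z) * (((1 - z \<bullet> z) / 2)\<^sup>2 * (2 *\<^sub>R (z - c) \<bullet> 2 *\<^sub>R (z - c)))" for z
  have "blapl \<psi> (\<lambda>z. (- a * exp (- a * q z)) *\<^sub>R 2 *\<^sub>R (z - c) + 0) (\<lambda>z. l\<psi> z + 0)"
    unfolding \<psi>_def l\<psi>_def
    by (rule lapl_add[OF lapl_compose[OF q, where P = "\<lambda>s. exp (- a * s)"] lapl_const])
      (auto intro!: derivative_eq_intros simp: power2_eq_square)
  then have \<psi>: "blapl \<psi> (\<lambda>z. (- a * exp (- a * q z)) *\<^sub>R 2 *\<^sub>R (z - c)) l\<psi>" by simp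
  have l\<psi>: "C * exp (- a * q z) < l\<psi> z" if z: "z \<in> cball y d" for z
  proof -
    have z1: "z \<bullet> z < 1" using inner_self_lt_1[OF in_ball(1)[OF z]] .
    have nz: "norm z \<le> 1" using in_ball(1)[OF z] by simp
    have zc: "norm (z - c) \<le> 2" using nz sub norm_triangle_ineq4[of z c] by simp
    have "lq z \<le> Q"
    proof -
      have "0 \<le> (1 - z \<bullet> z) / 2" using z1 by simp
      moreover have "(1 - z \<bullet> z) / 2 \<le> 1" using inner_ge_zero[of z] by (simp del: inner_ge_zero)
      ultimately have "((1 - z \<bullet> z) / 2)\<^sup>2 \<le> 1" by (rule power_le_one)
      then have 1: "((1 - z \<bullet> z) / 2)\<^sup>2 * (2 * N) \<le> 2 * N" using N by simp
      have "\<bar>z \<bullet> (z - c)\<bar> \<le> norm z * norm (z - c)" by (rule Cauchy_Schwarz_ineq2)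
      also have "\<dots> \<le> 1 * 2" using nz zc by (intro mult_mono) auto
      finally have i: "\<bar>z \<bullet> (z - c)\<bar> \<le> 2" by simp
      have "(N - 2) * (1 - z \<bullet> z) * (z \<bullet> (z - c)) \<le> \<bar>(N - 2) * (1 - z \<bullet> z) * (z \<bullet> (z - c))\<bar>"
        by (rule abs_ge_self)
      also have "\<dots> = \<bar>N - 2\<bar> * \<bar>1 - z \<bullet> z\<bar> * \<bar>z \<bullet> (z - c)\<bar>"
        by (simp only: abs_mult)
      also have "\<dots> \<le> (N + 2) * 1 * 2"
        using i z1 N inner_ge_zero[of z] by (intro mult_mono) auto
      finally show ?thesis using 1 unfolding lq_def N_def[symmetric] Q_def by simp
    qed
    then have 1: "a * lq z \<le> a * Q" using a by simp
    have "\<rho> \<le> norm (z - c) + norm (z - y)"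
      using y(3) dist_triangle[of y c z] by (simp add: dist_norm norm_minus_commute)
    then have "\<rho> / 2 \<le> norm (z - c)" using z d by (simp add: dist_norm norm_minus_commute)
    then have "(\<rho> / 2)\<^sup>2 \<le> (norm (z - c))\<^sup>2" using y by (intro power_mono) auto
    then have 2: "\<rho>\<^sup>2 \<le> 4 * q z" by (simp add: q_def power2_norm_eq_inner power_divide)
    have "(norm z)\<^sup>2 \<le> t\<^sup>2" using in_ball(2)[OF z] unfolding t_def by (intro power_mono) auto
    then have "\<omega>0 \<le> (1 - z \<bullet> z) / 2" unfolding \<omega>0_def power2_norm_eq_inner by simp
    then have 3: "\<omega>0\<^sup>2 \<le> ((1 - z \<bullet> z) / 2)\<^sup>2" using \<omega>0 by (intro power_mono) auto
    have "m0 \<le> ((1 - z \<bullet> z) / 2)\<^sup>2 * (4 * q z)"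
      unfolding m0_def using 2 3 by (intro mult_mono) auto
    then have "a\<^sup>2 * m0 \<le> a\<^sup>2 * (((1 - z \<bullet> z) / 2)\<^sup>2 * (4 * q z))" by (intro mult_left_mono) auto
    then have "C < a\<^sup>2 * (((1 - z \<bullet> z) / 2)\<^sup>2 * (4 * q z)) - a * lq z" using 1 a2 by linarith
    then have "C * exp (- a * q z) < (a\<^sup>2 * (((1 - z \<bullet> z) / 2)\<^sup>2 * (4 * q z)) - a * lq z) * exp (- a * q z)"
      by simp
    also have "\<dots> = l\<psi> z" unfolding l\<psi>_def q_def by (simp add: algebra_simps)
    finally show ?thesis .
  qed
  have cont: "continuous_on (cball y d) w"
    using lapl_continuous_on[OF w] in_ball(1) by (rule_tac continuous_on_subset) auto
  \<comment> \<open>On this part of the small sphere w is bounded below by some \<mu> > 0; on the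
    rest the barrier is negative. Hence w - (\<mu>/2) \<psi> is positive on the small sphere but
    zero at its centre \<open>y\<close>, so its minimum is interior.\<close>
  define Kc where "Kc = sphere y d \<inter> cball c \<rho>"
  have "compact Kc" unfolding Kc_def by (simp add: compact_Int_closed)
  moreover have "continuous_on Kc w" using cont by (rule continuous_on_subset) (auto simp: Kc_def)
  moreover have "0 < w z" if "z \<in> Kc" for z
    using that d(1) by (intro pos in_ball(1)) (auto simp: Kc_def dist_commute)
  ultimately obtain \<mu> where \<mu>: "\<mu> > 0" "\<And>z. z \<in> Kc \<Longrightarrow> \<mu> \<le> w z"
  proof (cases "Kc = {}")
    case False
    then show ?thesis using that continuous_attains_inf[of Kc w] \<open>compact Kc\<close> \<open>continuous_on Kc w\<close>
      \<open>\<And>z. z \<in> Kc \<Longrightarrow> 0 < w z\<close> by metis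
  qed (use that[of 1] in auto)
  define W where "W z = w z - (\<mu> / 2) * \<psi> z" for z
  have W: "blapl W (\<lambda>z. g z - (\<mu> / 2) *\<^sub>R (- a * exp (- a * q z)) *\<^sub>R 2 *\<^sub>R (z - c))
      (\<lambda>z. l z - (\<mu> / 2) * l\<psi> z)"
    unfolding W_def by (rule lapl_diff[OF w lapl_cmult[OF \<psi>]])
  have q_nn: "0 \<le> q z" for z by (simp add: q_def)
  have Wy: "W y = 0" using y by (simp add: W_def \<psi>_def q_def power2_norm_eq_inner[symmetric] dist_norm)
  have W_sphere: "0 < W z" if z: "z \<in> sphere y d" for z
  proof (cases "dist z c \<le> \<rho>")
    case True
    then have "\<mu> \<le> w z" using z \<mu>(2) by (auto simp: Kc_def dist_commute)
    moreover have "exp (- a * q z) \<le> 1" using a(1) q_nn by (simp add: mult_nonneg_nonneg)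
    then have "\<psi> z < 1" unfolding \<psi>_def by (smt (verit) exp_gt_zero)
    then have "(\<mu> / 2) * \<psi> z < \<mu> / 2 * 1" using \<mu>(1) by (intro mult_strict_left_mono) auto
    ultimately show ?thesis using \<mu>(1) unfolding W_def by linarith
  next
    case False
    then have "\<rho>\<^sup>2 < q z" unfolding q_def power2_norm_eq_inner[symmetric] using y
      by (intro power_strict_mono) (auto simp: dist_norm)
    then have "\<psi> z < 0" using a(1) by (simp add: \<psi>_def)
    moreover have "0 \<le> w z" using z in_ball(1)[of z] by (intro nn) auto
    ultimately show ?thesis using \<mu>(1) unfolding W_def by (smt (verit) half_gt_zero mult_pos_neg)
  qed
  have "continuous_on (cball y d) W"
    using lapl_continuous_on[OF W] in_ball(1) by (rule_tac continuous_on_subset) auto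
  then obtain p where p: "p \<in> cball y d" "\<And>z. z \<in> cball y d \<Longrightarrow> W p \<le> W z"
    using continuous_attains_inf[of "cball y d" W] d by auto
  have Wp: "W p \<le> 0" using p(2)[of y] Wy d by auto
  then have pb: "p \<in> ball y d" using W_sphere[of p] p(1) by (force simp: less_le)
  have pB: "p \<in> ball 0 1" using in_ball(1)[OF p(1)] .
  obtain e where e: "e > 0" "ball p e \<subseteq> ball y d" using pb open_contains_ball open_ball by metis
  have "0 \<le> l p - (\<mu> / 2) * l\<psi> p"
    by (rule lapl_nonneg_at_local_min[OF W open_ball pB e(1)])
      (use p(2) e(2) in \<open>force simp: subset_iff dist_commute\<close>)
  moreover have "l p \<le> C * ((\<mu> / 2) * \<psi> p)"
    using lC[OF pB] Wp C mult_left_mono[of "w p" "(\<mu> / 2) * \<psi> p" C] by (simp add: W_def)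
  ultimately have "(\<mu> / 2) * l\<psi> p \<le> (\<mu> / 2) * (C * \<psi> p)" by (simp add: algebra_simps)
  then have "l\<psi> p \<le> C * \<psi> p" using \<mu>(1) by simp
  also have "\<dots> \<le> C * exp (- a * q p)" using C by (intro mult_left_mono) (auto simp: \<psi>_def)
  finally show False using l\<psi>[OF p(1)] by simp
qed

text \<open>The zero set is open: around a point \<open>c\<close> near a zero with w c \<noteq> 0,
  the largest ball free of zeros has a zero \<open>x\<close> on its boundary, where the touching
  lemma applies. Connectedness of the ball finishes.\<close>

lemma strong_maximum_principle:
  fixes w :: "'a::euclidean_space \<Rightarrow> real"
  assumes w: "blapl w g l" and nn: "\<And>z. z \<in> ball 0 1 \<Longrightarrow> 0 \<le> w z"
    and lC: "\<And>z. z \<in> ball 0 1 \<Longrightarrow> l z \<le> C * w z"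
    and p: "p \<in> ball 0 1" "w p = 0" and z: "z \<in> ball 0 1"
  shows "w z = 0"
proof -
  \<comment> \<open>\<open>C\<close> may be negative here; since w is nonnegative it can be replaced
    by its positive part.\<close>
  have lC': "l z \<le> max C 0 * w z" if "z \<in> ball 0 1" for z
    using lC[OF that] mult_right_mono[of C "max C 0" "w z"] nn[OF that] by simp
  define Z where "Z = {z \<in> ball 0 1. w z = 0}"
  have cont: "continuous_on (ball 0 1) w" by (rule lapl_continuous_on[OF w])
  have "\<exists>e>0. ball y e \<subseteq> Z" if y: "y \<in> Z" for y
  proof -
    \<comment> \<open>A third of the distance to the boundary: the ball about \<open>c\<close> up to
      its nearest zero then stays within \<open>2 * R\<close> of \<open>y\<close>, inside the unit
      ball.\<close>
    define R where "R = (1 - norm y) / 3"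
    have R: "R > 0" using y by (auto simp: Z_def R_def)
    have sub: "cball y (2 * R) \<subseteq> ball 0 1"
    proof
      fix z assume "z \<in> cball y (2 * R)"
      moreover have "norm z \<le> norm y + norm (z - y)"
        by (metis add.commute diff_add_cancel norm_triangle_ineq)
      ultimately show "z \<in> ball 0 1" using R by (simp add: R_def dist_norm norm_minus_commute)
    qed
    have "w c = 0" if c: "c \<in> ball y R" for c
    proof (rule ccontr)
      assume wc: "w c \<noteq> 0"
      define Y where "Y = {z \<in> cball y (2 * R). w z = 0}"
      have "closed Y" unfolding Y_def
        using continuous_closed_preimage_constant[of "cball y (2*R)" w 0] cont continuous_on_subset sub
        by auto
      moreover have yY: "y \<in> Y" using y R by (auto simp: Y_def Z_def)
      ultimately obtain x where x: "x \<in> Y" "\<And>z. z \<in> Y \<Longrightarrow> dist c x \<le> dist c z"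
        using distance_attains_inf[of Y c] by blast
      define \<rho> where "\<rho> = dist c x"
      have \<rho>: "\<rho> < R" using x(2)[OF yY] c by (simp add: \<rho>_def dist_commute)
      have \<rho>0: "\<rho> > 0" using x wc by (auto simp: \<rho>_def Y_def)
      have cb: "cball c \<rho> \<subseteq> cball y (2 * R)"
      proof
        fix z assume "z \<in> cball c \<rho>"
        then show "z \<in> cball y (2 * R)"
          using dist_triangle[of y z c] c \<rho> by (simp add: dist_commute)
      qed
      have pos: "0 < w z" if "dist c z < \<rho>" for z
      proof -
        have "z \<in> cball y (2 * R)" using cb that by (auto simp: subset_iff)
        then have "w z \<noteq> 0" using x(2)[of z] that by (auto simp: Y_def \<rho>_def)
        then show ?thesis using nn[of z] sub \<open>z \<in> cball y (2 * R)\<close> by force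
      qed
      \<comment> \<open>The ball about \<open>c\<close> may touch several zeros. The ball of half
        the radius, internally tangent at \<open>x\<close>, has \<open>x\<close> as its only zero,
        as the touching lemma requires.\<close>
      define c' where "c' = midpoint c x"
      have d': "dist x c' = \<rho> / 2" "dist c c' = \<rho> / 2"
        by (auto simp: c'_def \<rho>_def dist_midpoint dist_commute)
      have "c' \<in> cball c \<rho>" using d' \<rho>0 by simp
      then have c'b: "c' \<in> ball 0 1" using cb sub by blast
      have inside: "dist c z < \<rho>" if zc: "dist z c' \<le> \<rho> / 2" "z \<noteq> x" for z
      proof (rule ccontr)
        assume "\<not> dist c z < \<rho>"
        moreover have "dist c z \<le> dist c c' + dist c' z" by (rule dist_triangle)
        ultimately have eq: "dist c z = dist c c' + dist c' z" "dist c' z = \<rho> / 2"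
          using zc d' by (auto simp: dist_commute)
        \<comment> \<open>Equality in the triangle inequality forces z to be the point opposite to
          \<open>c\<close> across \<open>c'\<close>, which is \<open>x\<close>.\<close>
        have "norm ((c - c') + (c' - z)) = norm (c - c') + norm (c' - z)"
          using eq by (simp add: dist_norm)
        then have "norm (c - c') *\<^sub>R (c' - z) = norm (c' - z) *\<^sub>R (c - c')"
          using norm_triangle_eq by blast
        moreover have "norm (c - c') = \<rho> / 2" "norm (c' - z) = \<rho> / 2"
          using eq d' by (simp_all add: dist_norm)
        ultimately have "c' - z = c - c'" using \<rho>0 by simp
        then have "z = c' + c' - c" by (simp add: algebra_simps)
        also have "\<dots> = x"
          by (simp add: c'_def midpoint_def algebra_simps flip: scaleR_2)
        finally show False using zc by simp
      qed
      show False
      proof (rule strong_maximum_principle_touching[OF w nn lC' _ _ _ d'(1) _ c'b])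
        show "x \<in> ball 0 1" "w x = 0" using x(1) sub by (auto simp: Y_def)
        show "0 < w z" if "z \<in> ball 0 1" "dist z c' \<le> \<rho> / 2" "z \<noteq> x" for z
          using pos inside that by blast
      qed (use \<rho>0 in auto)
    qed
    moreover have "ball y R \<subseteq> ball 0 1" using sub R by (auto simp: subset_iff)
    ultimately show ?thesis using R by (intro exI[of _ R]) (auto simp: Z_def)
  qed
  then have "open Z" unfolding open_contains_ball by blast
  then have "openin (top_of_set (ball 0 1)) Z" by (auto simp: openin_open_eq Z_def)
  moreover have "closedin (top_of_set (ball 0 1)) Z"
    unfolding Z_def by (rule continuous_closedin_preimage_constant[OF cont])
  ultimately have "Z = {} \<or> Z = ball 0 1" using connected_clopen[of "ball (0::'a) 1"] by auto
  moreover have "p \<in> Z" using p by (simp add: Z_def)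
  ultimately have "z \<in> Z" using z by blast
  then show ?thesis by (simp add: Z_def)
qed

section \<open>Conformal invariance\<close>

text \<open>The derivative of the inversion is r/|z - c|^2 times the reflection in the hyperplane
  orthogonal to z - c. The hypothesis on \<open>\<omega>2\<close> says that the inversion is
  isometric between the two conformal metrics; the one on \<open>d\<omega>2\<close> is what
  differentiating it gives. Both the Cayley transform and the reflections of the ball are
  instances.\<close>

lemma lapl_inversion:
  fixes c :: "'a::euclidean_space" and r :: real
  defines "\<Phi> \<equiv> \<lambda>z. c + (r / ((z - c) \<bullet> (z - c))) *\<^sub>R (z - c)"
  assumes L: "lapl S2 \<omega>2 d\<omega>2 u g l"
    and c: "c \<notin> S1" and maps: "\<And>z. z \<in> S1 \<Longrightarrow> \<Phi> z \<in> S2"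
    and \<omega>: "\<And>z. z \<in> S1 \<Longrightarrow> \<omega>2 (\<Phi> z) = r / ((z - c) \<bullet> (z - c)) * \<omega>1 z"
    and d\<omega>: "\<And>z. z \<in> S1 \<Longrightarrow> d\<omega>2 (\<Phi> z) =
      d\<omega>1 z + ((2 * \<omega>1 z - 2 * ((z - c) \<bullet> d\<omega>1 z)) / ((z - c) \<bullet> (z - c))) *\<^sub>R (z - c)"
  shows "lapl S1 \<omega>1 d\<omega>1 (\<lambda>z. u (\<Phi> z))
    (\<lambda>z. (r / ((z - c) \<bullet> (z - c))) *\<^sub>R
      (g (\<Phi> z) - (2 * ((z - c) \<bullet> g (\<Phi> z)) / ((z - c) \<bullet> (z - c))) *\<^sub>R (z - c)))
    (\<lambda>z. l (\<Phi> z))"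
proof -
  obtain A where A: "\<And>z. z \<in> S2 \<Longrightarrow> (u has_derivative (\<lambda>h. g z \<bullet> h)) (at z) \<and>
      (g has_derivative A z) (at z) \<and>
      l z = (\<omega>2 z)\<^sup>2 * (\<Sum>b\<in>Basis. A z b \<bullet> b) - (real DIM('a) - 2) * \<omega>2 z * (d\<omega>2 z \<bullet> g z)"
    using L unfolding lapl_def by blast
  define K where "K z k = (r / ((z - c) \<bullet> (z - c))) *\<^sub>R
      (k - (2 * ((z - c) \<bullet> k) / ((z - c) \<bullet> (z - c))) *\<^sub>R (z - c))" for z k
  define A' where "A' z k =
     (- 2 * r * ((z - c) \<bullet> k) / ((z - c) \<bullet> (z - c))\<^sup>2) *\<^sub>R
        (g (\<Phi> z) - (2 * ((z - c) \<bullet> g (\<Phi> z)) / ((z - c) \<bullet> (z - c))) *\<^sub>R (z - c))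
     + (r / ((z - c) \<bullet> (z - c))) *\<^sub>R (A (\<Phi> z) (K z k)
        - ((2 * (k \<bullet> g (\<Phi> z) + (z - c) \<bullet> A (\<Phi> z) (K z k)) / ((z - c) \<bullet> (z - c))
             - 4 * ((z - c) \<bullet> g (\<Phi> z)) * ((z - c) \<bullet> k) / ((z - c) \<bullet> (z - c))\<^sup>2) *\<^sub>R (z - c)
           + (2 * ((z - c) \<bullet> g (\<Phi> z)) / ((z - c) \<bullet> (z - c))) *\<^sub>R k))" for z k
  show ?thesis
  proof (rule laplI[where A = A'])
    fix z assume z: "z \<in> S1"
    define v where "v = z - c"
    define s where "s = v \<bullet> v"
    define G where "G = g (\<Phi> z)"
    define B where "B = A (\<Phi> z)"
    have s: "s \<noteq> 0" using z c by (auto simp: s_def v_def)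
    have dv: "((\<lambda>z. z - c) has_derivative (\<lambda>h. h)) (at z)" by (auto intro!: derivative_eq_intros)
    have ds: "((\<lambda>z. (z - c) \<bullet> (z - c)) has_derivative (\<lambda>h. 2 * (v \<bullet> h))) (at z)"
      by (auto intro!: derivative_eq_intros simp: v_def inner_commute)
    have d\<rho>: "((\<lambda>z. r / ((z - c) \<bullet> (z - c))) has_derivative (\<lambda>h. - 2 * r * (v \<bullet> h) / s\<^sup>2)) (at z)"
      by (rule derivative_eq_intros refl ds)+
        (use s in \<open>auto simp: s_def v_def power2_eq_square divide_simps\<close>)
    have d\<Phi>: "(\<Phi> has_derivative K z) (at z)"
    proof -
      have "((\<lambda>z. c + (r / ((z - c) \<bullet> (z - c))) *\<^sub>R (z - c)) has_derivative
        (\<lambda>h. 0 + ((r / s) *\<^sub>R h + (- 2 * r * (v \<bullet> h) / s\<^sup>2) *\<^sub>R v))) (at z)"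
        using has_derivative_add[OF has_derivative_const has_derivative_scaleR[OF d\<rho> dv]]
        unfolding v_def s_def by blast
      moreover have "(\<lambda>h. 0 + ((r / s) *\<^sub>R h + (- 2 * r * (v \<bullet> h) / s\<^sup>2) *\<^sub>R v)) = K z"
        using s by (auto simp: K_def fun_eq_iff v_def[symmetric] s_def[symmetric] scaleR_diff_right
            power2_eq_square mult.commute)
      ultimately show ?thesis unfolding \<Phi>_def by simp
    qed
    have Az: "(u has_derivative (\<lambda>h. G \<bullet> h)) (at (\<Phi> z))" "(g has_derivative B) (at (\<Phi> z))"
      "l (\<Phi> z) = (\<omega>2 (\<Phi> z))\<^sup>2 * (\<Sum>b\<in>Basis. B b \<bullet> b)
        - (real DIM('a) - 2) * \<omega>2 (\<Phi> z) * (d\<omega>2 (\<Phi> z) \<bullet> G)"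
      using A[OF maps[OF z]] by (auto simp: G_def B_def)
    have "((\<lambda>z. u (\<Phi> z)) has_derivative (\<lambda>h. G \<bullet> K z h)) (at z)"
      by (rule has_derivative_compose[OF d\<Phi> Az(1)])
    moreover have "(\<lambda>h. G \<bullet> K z h) = (\<bullet>) ((r / s) *\<^sub>R (G - (2 * (v \<bullet> G) / s) *\<^sub>R v))"
      by (simp add: fun_eq_iff K_def v_def[symmetric] s_def[symmetric] inner_diff_left inner_diff_right
          inner_commute[of G] inner_commute[of h])
    ultimately show "((\<lambda>z. u (\<Phi> z)) has_derivative
      (\<bullet>) ((r / ((z - c) \<bullet> (z - c))) *\<^sub>R
      (g (\<Phi> z) - (2 * ((z - c) \<bullet> g (\<Phi> z)) / ((z - c) \<bullet> (z - c))) *\<^sub>R (z - c)))) (at z)"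
      unfolding v_def s_def G_def by metis
    have dG: "((\<lambda>z. g (\<Phi> z)) has_derivative (\<lambda>k. B (K z k))) (at z)"
      by (rule has_derivative_compose[OF d\<Phi> Az(2)])
    have dvG: "((\<lambda>z. (z - c) \<bullet> g (\<Phi> z)) has_derivative (\<lambda>k. v \<bullet> B (K z k) + k \<bullet> G)) (at z)"
      using has_derivative_inner[OF dv dG] by (simp add: v_def G_def)
    have dq: "((\<lambda>z. 2 * ((z - c) \<bullet> g (\<Phi> z)) / ((z - c) \<bullet> (z - c))) has_derivative
      (\<lambda>k. 2 * (k \<bullet> G + v \<bullet> B (K z k)) / s - 4 * (v \<bullet> G) * (v \<bullet> k) / s\<^sup>2)) (at z)"
      by (rule derivative_eq_intros refl ds dvG)+
        (use s in \<open>auto simp: s_def[symmetric] v_def[symmetric] G_def[symmetric] power2_eq_square field_simps\<close>)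
    have "((\<lambda>z. (r / ((z - c) \<bullet> (z - c))) *\<^sub>R
      (g (\<Phi> z) - (2 * ((z - c) \<bullet> g (\<Phi> z)) / ((z - c) \<bullet> (z - c))) *\<^sub>R (z - c))) has_derivative
      (\<lambda>k. (r / s) *\<^sub>R (B (K z k) - ((2 * (v \<bullet> G) / s) *\<^sub>R k +
         (2 * (k \<bullet> G + v \<bullet> B (K z k)) / s - 4 * (v \<bullet> G) * (v \<bullet> k) / s\<^sup>2) *\<^sub>R v))
       + (- 2 * r * (v \<bullet> k) / s\<^sup>2) *\<^sub>R (G - (2 * (v \<bullet> G) / s) *\<^sub>R v))) (at z)"
      using has_derivative_scaleR[OF d\<rho> has_derivative_diff[OF dG has_derivative_scaleR[OF dq dv]]]
      unfolding v_def s_def G_def B_def by blast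
    moreover have "(\<lambda>k. (r / s) *\<^sub>R (B (K z k) - ((2 * (v \<bullet> G) / s) *\<^sub>R k +
         (2 * (k \<bullet> G + v \<bullet> B (K z k)) / s - 4 * (v \<bullet> G) * (v \<bullet> k) / s\<^sup>2) *\<^sub>R v))
       + (- 2 * r * (v \<bullet> k) / s\<^sup>2) *\<^sub>R (G - (2 * (v \<bullet> G) / s) *\<^sub>R v)) = A' z"
      unfolding A'_def v_def[symmetric] s_def[symmetric] G_def[symmetric] B_def[symmetric]
      by (simp add: add.commute)
    ultimately show "((\<lambda>z. (r / ((z - c) \<bullet> (z - c))) *\<^sub>R
      (g (\<Phi> z) - (2 * ((z - c) \<bullet> g (\<Phi> z)) / ((z - c) \<bullet> (z - c))) *\<^sub>R (z - c))) has_derivative A' z) (at z)"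
      by simp
    have linB: "linear B" using Az(2) has_derivative_linear by blast
    have BK: "B (K z b) = (r / s) *\<^sub>R (B b - (2 * (v \<bullet> b) / s) *\<^sub>R B v)" for b
      unfolding K_def v_def[symmetric] s_def[symmetric]
      by (simp add: linear_diff[OF linB] linear_cmul[OF linB])
    have Bv: "(\<Sum>b\<in>Basis. (v \<bullet> b) * (w \<bullet> B b)) = w \<bullet> B v" for w
    proof -
      have "B v = B (\<Sum>b\<in>Basis. (v \<bullet> b) *\<^sub>R b)" by (simp add: euclidean_representation)
      also have "\<dots> = (\<Sum>b\<in>Basis. (v \<bullet> b) *\<^sub>R B b)"
        by (simp add: linear_sum[OF linB] linear_cmul[OF linB])
      finally show ?thesis by (simp add: inner_sum_right)
    qed
    have e: "A' z b \<bullet> b = (- 4 * r / s\<^sup>2) * ((v \<bullet> b) * (G \<bullet> b))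
        + (8 * r * (v \<bullet> G) / s ^ 3 + 4 * r\<^sup>2 * (v \<bullet> B v) / s ^ 4) * ((v \<bullet> b) * (v \<bullet> b))
        + (r / s)\<^sup>2 * (B b \<bullet> b) - 2 * r\<^sup>2 / s ^ 3 * ((v \<bullet> b) * (B v \<bullet> b))
        - 2 * r\<^sup>2 / s ^ 3 * ((v \<bullet> b) * (v \<bullet> B b)) - 2 * r * (v \<bullet> G) / s\<^sup>2 * (b \<bullet> b)" for b
      unfolding A'_def v_def[symmetric] s_def[symmetric] G_def[symmetric] B_def[symmetric] BK
      using s by (simp add: inner_add_left inner_diff_left inner_add_right inner_diff_right
          inner_commute[of b G] divide_inverse algebra_simps power2_eq_square power3_eq_cube power4_eq_xxxx)
    have "(\<Sum>b\<in>Basis. A' z b \<bullet> b) = (- 4 * r / s\<^sup>2) * (v \<bullet> G)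
        + (8 * r * (v \<bullet> G) / s ^ 3 + 4 * r\<^sup>2 * (v \<bullet> B v) / s ^ 4) * s
        + (r / s)\<^sup>2 * (\<Sum>b\<in>Basis. B b \<bullet> b) - 2 * r\<^sup>2 / s ^ 3 * (v \<bullet> B v)
        - 2 * r\<^sup>2 / s ^ 3 * (v \<bullet> B v) - 2 * r * (v \<bullet> G) / s\<^sup>2 * real DIM('a)"
      unfolding e sum.distrib sum_subtractf sum_distrib_left[symmetric] Bv s_def
        euclidean_inner[symmetric]
      by simp
    also have "\<dots> = (r / s)\<^sup>2 * (\<Sum>b\<in>Basis. B b \<bullet> b) + (4 - 2 * real DIM('a)) * r * (v \<bullet> G) / s\<^sup>2"
    proof -
      have "x / s ^ 3 * s = x / s\<^sup>2" "x / s ^ 4 * s = x / s ^ 3" for x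
        using s by (simp_all add: power2_eq_square power3_eq_cube power4_eq_xxxx)
      then have p: "(8 * r * (v \<bullet> G) / s ^ 3 + 4 * r\<^sup>2 * (v \<bullet> B v) / s ^ 4) * s
          = 8 * r * (v \<bullet> G) / s\<^sup>2 + 4 * r\<^sup>2 * (v \<bullet> B v) / s ^ 3"
        by (simp add: distrib_right)
      show ?thesis unfolding p by (simp add: ring_distribs add_divide_distrib diff_divide_distrib mult_ac)
    qed
    \<comment> \<open>The trace is invariant under the reflection, so only the derivative of the
      conformal factor leaves an extra term, proportional to 4 - 2 n; the change of the first-order
      term matches it.\<close>
    finally have tr: "(\<Sum>b\<in>Basis. A' z b \<bullet> b) = (r / s)\<^sup>2 * (\<Sum>b\<in>Basis. B b \<bullet> b)
        + (4 - 2 * real DIM('a)) * r * (v \<bullet> G) / s\<^sup>2" .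
    show "l (\<Phi> z) = (\<omega>1 z)\<^sup>2 * (\<Sum>b\<in>Basis. A' z b \<bullet> b) - (real DIM('a) - 2) * \<omega>1 z *
        (d\<omega>1 z \<bullet> (r / ((z - c) \<bullet> (z - c))) *\<^sub>R
      (g (\<Phi> z) - (2 * ((z - c) \<bullet> g (\<Phi> z)) / ((z - c) \<bullet> (z - c))) *\<^sub>R (z - c)))"
      unfolding Az(3) tr \<omega>[OF z] d\<omega>[OF z] v_def[symmetric] s_def[symmetric] G_def[symmetric]
      by (simp add: inner_add_left inner_diff_right inner_commute[of "d\<omega>1 z" v]
          power_mult_distrib divide_inverse algebra_simps power2_eq_square)
  qed
qed

lemma inner_orthogonal_transformation_inv:
  assumes "orthogonal_transformation (Q :: 'a::euclidean_space \<Rightarrow> 'a)"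
  shows "inv Q x \<bullet> y = x \<bullet> Q y"
proof -
  have "inv Q x \<bullet> y = Q (inv Q x) \<bullet> Q y" using assms unfolding orthogonal_transformation_def by simp
  also have "Q (inv Q x) = x" by (simp add: assms surj_f_inv_f orthogonal_transformation_surj)
  finally show ?thesis .
qed

text \<open>Expanding \<open>Q b\<close> in the basis and exchanging the two sums turns the left
  side into inner products of images under \<open>inv Q\<close>, which \<open>inv Q\<close>
  preserves.\<close>

lemma trace_orthogonal_conjugate:
  fixes A Q :: "'a::euclidean_space \<Rightarrow> 'a"
  assumes Q: "orthogonal_transformation Q" and A: "linear A"
  shows "(\<Sum>b\<in>Basis. A (Q b) \<bullet> Q b) = (\<Sum>b\<in>Basis. A b \<bullet> b)"
proof -
  have "A (Q b) \<bullet> Q b = (\<Sum>c\<in>Basis. (inv Q c \<bullet> b) * (inv Q (A c) \<bullet> b))" for b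
  proof -
    have "A (Q b) = A (\<Sum>c\<in>Basis. (Q b \<bullet> c) *\<^sub>R c)" by (simp add: euclidean_representation)
    also have "\<dots> = (\<Sum>c\<in>Basis. (Q b \<bullet> c) *\<^sub>R A c)" by (simp add: linear_sum[OF A] linear_cmul[OF A])
    finally show ?thesis
      by (simp add: inner_sum_left inner_orthogonal_transformation_inv[OF Q] inner_commute[of "Q b" c for c])
  qed
  then have "(\<Sum>b\<in>Basis. A (Q b) \<bullet> Q b)
    = (\<Sum>b\<in>Basis. \<Sum>c\<in>Basis. (inv Q c \<bullet> b) * (inv Q (A c) \<bullet> b))" by simp
  also have "\<dots> = (\<Sum>c\<in>Basis. \<Sum>b\<in>Basis. (inv Q c \<bullet> b) * (inv Q (A c) \<bullet> b))"
    by (rule sum.swap)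
  also have "\<dots> = (\<Sum>c\<in>Basis. inv Q c \<bullet> inv Q (A c))" unfolding euclidean_inner[symmetric] ..
  also have "\<dots> = (\<Sum>c\<in>Basis. A c \<bullet> c)"
    using orthogonal_transformation_inv[OF Q]
    by (simp add: orthogonal_transformation_def inner_commute)
  finally show ?thesis .
qed

lemma lapl_orthogonal:
  fixes Q :: "'a::euclidean_space \<Rightarrow> 'a"
  assumes L: "lapl S2 \<omega>2 d\<omega>2 u g l" and Q: "orthogonal_transformation Q"
    and maps: "\<And>z. z \<in> S1 \<Longrightarrow> Q z \<in> S2"
    and \<omega>: "\<And>z. z \<in> S1 \<Longrightarrow> \<omega>2 (Q z) = \<omega>1 z"
    and d\<omega>: "\<And>z. z \<in> S1 \<Longrightarrow> d\<omega>2 (Q z) = Q (d\<omega>1 z)"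
  shows "lapl S1 \<omega>1 d\<omega>1 (\<lambda>z. u (Q z)) (\<lambda>z. inv Q (g (Q z))) (\<lambda>z. l (Q z))"
proof -
  obtain A where A: "\<And>z. z \<in> S2 \<Longrightarrow> (u has_derivative (\<lambda>h. g z \<bullet> h)) (at z) \<and>
      (g has_derivative A z) (at z) \<and>
      l z = (\<omega>2 z)\<^sup>2 * (\<Sum>b\<in>Basis. A z b \<bullet> b) - (real DIM('a) - 2) * \<omega>2 z * (d\<omega>2 z \<bullet> g z)"
    using L unfolding lapl_def by blast
  have dQ: "(Q has_derivative Q) (at z)" for z
    using Q by (simp add: linear_imp_has_derivative orthogonal_transformation_linear)
  have dQ': "(inv Q has_derivative inv Q) (at z)" for z
    using orthogonal_transformation_inv[OF Q]
    by (simp add: linear_imp_has_derivative orthogonal_transformation_linear)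
  note adj = inner_orthogonal_transformation_inv[OF Q]
  show ?thesis
  proof (rule laplI[where A = "\<lambda>z h. inv Q (A (Q z) (Q h))"])
    fix z assume z: "z \<in> S1"
    note Az = A[OF maps[OF z]]
    show "((\<lambda>z. u (Q z)) has_derivative (\<bullet>) (inv Q (g (Q z)))) (at z)"
      using has_derivative_compose[OF dQ conjunct1[OF Az]] by (simp add: adj[symmetric])
    show "((\<lambda>z. inv Q (g (Q z))) has_derivative (\<lambda>h. inv Q (A (Q z) (Q h)))) (at z)"
      using has_derivative_compose[OF has_derivative_compose[OF dQ] dQ'] Az by blast
    have "linear (A (Q z))" using Az has_derivative_linear by blast
    then show "l (Q z) = (\<omega>1 z)\<^sup>2 * (\<Sum>b\<in>Basis. inv Q (A (Q z) (Q b)) \<bullet> b)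
      - (real DIM('a) - 2) * \<omega>1 z * (d\<omega>1 z \<bullet> inv Q (g (Q z)))"
      using Az by (simp add: adj trace_orthogonal_conjugate[OF Q] \<omega>[OF z] d\<omega>[OF z]
          inner_commute[of _ "inv Q _"] inner_commute[of _ "g _"])
  qed
qed

section \<open>Double-well potentials\<close>

locale double_well =
  fixes F f f' :: "real \<Rightarrow> real"
  assumes F_deriv: "\<And>s. (F has_real_derivative f s) (at s)"
    and f_deriv: "\<And>s. (f has_real_derivative f' s) (at s)"
    and f'_cont: "continuous_on UNIV f'"
    and F_nonneg: "\<And>s. 0 \<le> F s"
    and F_zeros: "{s. F s = 0} = {-1, 1}"
    and f'_pos: "f' (-1) > 0" "f' 1 > 0"
    and F_outer: "\<And>s. \<bar>s\<bar> \<ge> 1 \<Longrightarrow> s * f s \<ge> 0"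
    and F_crit: "{s. f s = 0} = {-1, 0, 1}"
begin

lemma f_eq_0_iff: "f s = 0 \<longleftrightarrow> s = -1 \<or> s = 0 \<or> s = 1"
proof -
  have "f s = 0 \<longleftrightarrow> s \<in> {s. f s = 0}" by simp
  then show ?thesis unfolding F_crit by simp
qed

lemma F_eq_0_iff: "F s = 0 \<longleftrightarrow> s = -1 \<or> s = 1"
proof -
  have "F s = 0 \<longleftrightarrow> s \<in> {s. F s = 0}" by simp
  then show ?thesis unfolding F_zeros by simp
qed

lemma f_zero: "f (-1) = 0" "f 0 = 0" "f 1 = 0"
  by (simp_all add: f_eq_0_iff)

lemma f_continuous: "continuous_on S f"
  using f_deriv by (meson DERIV_continuous continuous_at_imp_continuous_on)

lemma f_pos: "s > 1 \<Longrightarrow> f s > 0"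
proof -
  assume s: "s > 1"
  have "f s \<noteq> 0" using f_eq_0_iff s by auto
  then show "f s > 0" using F_outer[of s] s by (auto simp: zero_le_mult_iff less_le)
qed

text \<open>The hypotheses are invariant under s \<mapsto> - s, so whatever is proved about the well
  1 holds for the well -1 by passing to - u.\<close>

lemma reflect: "double_well (\<lambda>s. F (- s)) (\<lambda>s. - f (- s)) (\<lambda>s. f' (- s))"
proof
  fix s
  show "((\<lambda>s. F (- s)) has_real_derivative - f (- s)) (at s)"
    using DERIV_chain2[OF F_deriv, of uminus "-1" s UNIV] by (simp add: DERIV_minus[OF DERIV_ident])
  show "((\<lambda>s. - f (- s)) has_real_derivative f' (- s)) (at s)"
    using DERIV_minus[OF DERIV_chain2[OF f_deriv, of uminus "-1" s UNIV]]
    by (simp add: DERIV_minus[OF DERIV_ident])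
  show "continuous_on UNIV (\<lambda>s. f' (- s))"
    by (intro continuous_on_compose2[OF f'_cont] continuous_intros) auto
  show "0 \<le> F (- s)" by (rule F_nonneg)
  show "{s. F (- s) = 0} = {- 1, 1}"
    by (auto simp: F_eq_0_iff minus_equation_iff)
  show "0 < f' (- (- 1))" "0 < f' (- 1)" using f'_pos by auto
  show "0 \<le> s * - f (- s)" if "1 \<le> \<bar>s\<bar>" using F_outer[of "- s"] that by auto
  show "{s. - f (- s) = 0} = {- 1, 0, 1}"
    by (auto simp: f_eq_0_iff minus_equation_iff)
qed

lemma f_lipschitz_interval:
  "\<exists>C\<ge>0. \<forall>s t. \<bar>s\<bar> \<le> 1 \<longrightarrow> \<bar>t\<bar> \<le> 1 \<longrightarrow> \<bar>f s - f t\<bar> \<le> C * \<bar>s - t\<bar>"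
proof -
  have "compact (f' ` {-1..1})"
    using f'_cont by (intro compact_continuous_image) (auto intro: continuous_on_subset)
  then obtain C where C: "C > 0" "\<And>s. s \<in> {-1..1} \<Longrightarrow> \<bar>f' s\<bar> \<le> C"
    using compact_imp_bounded[of "f' ` {-1..1}"] unfolding bounded_pos by auto
  show ?thesis
  proof (intro exI[of _ C] conjI allI impI)
    fix s t :: real assume "\<bar>s\<bar> \<le> 1" "\<bar>t\<bar> \<le> 1"
    then show "\<bar>f s - f t\<bar> \<le> C * \<bar>s - t\<bar>"
      using field_differentiable_bound[of "{-1..1}" f f' C t s] C f_deriv
      by (simp add: has_field_derivative_at_within abs_le_iff abs_minus_commute)
  qed (use C in auto)
qed

text \<open>By continuity f' stays above f' 1 / 2 near 1. The linear rate \<open>c\<close>, rather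
  than mere monotonicity, yields the uniform bound asked for by the maximum principle at
  infinity.\<close>

lemma f_monotone_near_1:
  "\<exists>\<epsilon> c. 0 < \<epsilon> \<and> \<epsilon> < 1 \<and> 0 < c \<and>
    (\<forall>a b. 1 - \<epsilon> \<le> a \<longrightarrow> a \<le> b \<longrightarrow> b \<le> 1 \<longrightarrow> f a - f b \<le> c * (a - b))"
proof -
  have "isCont f' 1" using f'_cont by (simp add: continuous_on_eq_continuous_at)
  then have "\<forall>\<^sub>F s in nhds 1. f' 1 / 2 < f' s"
    using f'_pos order_tendstoD(1)[of f' "f' 1" "nhds 1" "f' 1 / 2"]
    by (simp add: isCont_def tendsto_at_iff_tendsto_nhds)
  then obtain d where d: "d > 0" "\<And>s. dist s 1 < d \<Longrightarrow> f' 1 / 2 < f' s"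
    unfolding eventually_nhds_metric by blast
  define \<epsilon> where "\<epsilon> = min d 1 / 2"
  show ?thesis
  proof (rule exI[of _ \<epsilon>], rule exI[of _ "f' 1 / 2"], intro conjI allI impI)
    fix a b assume ab: "1 - \<epsilon> \<le> a" "a \<le> b" "b \<le> 1"
    show "f a - f b \<le> f' 1 / 2 * (a - b)"
    proof (cases "a = b")
      case False
      then have "a < b" using ab by simp
      then obtain z where z: "a < z" "z < b" "f b - f a = (b - a) * f' z"
        using MVT2[of a b f f'] f_deriv by blast
      have "f' 1 / 2 < f' z" using d z ab by (auto simp: \<epsilon>_def dist_real_def)
      then have "(b - a) * (f' 1 / 2) \<le> (b - a) * f' z" using \<open>a < b\<close> by (intro mult_left_mono) auto
      moreover have "f' 1 / 2 * (a - b) = - ((b - a) * (f' 1 / 2))" by (simp add: field_simps)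
      ultimately show ?thesis using z(3) by linarith
    qed simp
  qed (use d f'_pos in \<open>auto simp: \<epsilon>_def\<close>)
qed

end

locale double_well_solution = double_well F f f' for F f f' +
  fixes u :: "'a::euclidean_space \<Rightarrow> real" and g :: "'a \<Rightarrow> 'a"
  assumes bdd: "bounded (u ` ball 0 1)"
    and sol: "blapl u g (\<lambda>z. f (u z))"
begin

lemma reflect_solution:
  "double_well_solution (\<lambda>s. F (- s)) (\<lambda>s. - f (- s)) (\<lambda>s. f' (- s)) (\<lambda>z. - u z) (\<lambda>z. - g z)"
proof -
  interpret r: double_well "\<lambda>s. F (- s)" "\<lambda>s. - f (- s)" "\<lambda>s. f' (- s)" by (rule reflect)
  show ?thesis
  proof
    have "(\<lambda>z. - u z) ` ball 0 1 = uminus ` u ` ball 0 1" by auto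
    then show "bounded ((\<lambda>z. - u z) ` ball 0 1)" using bdd bounded_uminus by metis
    show "blapl (\<lambda>z. - u z) (\<lambda>z. - g z) (\<lambda>z. - f (- (- u z)))"
      using lapl_cmult[OF sol, of "-1"] by simp
  qed
qed

text \<open>Above 1 the nonlinearity is positive, and by compactness bounded below on
  \<open>{1 + \<delta>..B}\<close>, where B bounds u; this is the uniform sign that
  \<open>maximum_principle_at_infinity\<close> asks for.\<close>

lemma le_1:
  assumes "z \<in> ball 0 1"
  shows "u z \<le> 1"
proof -
  obtain B where B: "\<And>z. z \<in> ball 0 1 \<Longrightarrow> \<bar>u z\<bar> \<le> B"
    using bdd unfolding bounded_iff by (metis imageI real_norm_def)
  have w: "blapl (\<lambda>z. 1 - u z) (\<lambda>z. 0 - g z) (\<lambda>z. 0 - f (u z))"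
    by (rule lapl_diff[OF lapl_const sol])
  have "0 \<le> 1 - u z"
  proof (rule maximum_principle_at_infinity[OF w _ _ assms, of B])
    fix z :: 'a assume "z \<in> ball 0 1"
    then show "- B \<le> 1 - u z" using B[of z] by linarith
  next
    fix \<delta> :: real assume \<delta>: "0 < \<delta>"
    obtain \<kappa> where "\<kappa> > 0" "\<And>s. s \<in> {1 + \<delta>..B} \<Longrightarrow> \<kappa> \<le> f s"
    proof (cases "{1 + \<delta>..B} = {}")
      case False
      obtain x where x: "x \<in> {1 + \<delta>..B}" "\<And>s. s \<in> {1 + \<delta>..B} \<Longrightarrow> f x \<le> f s"
        using continuous_attains_inf[OF compact_Icc False f_continuous] by blast
      show ?thesis using that[of "f x"] x f_pos[of x] \<delta> by auto
    qed (use that[of 1] in auto)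
    then show "\<exists>\<kappa>>0. \<forall>z\<in>ball 0 1. 1 - u z < - \<delta> \<longrightarrow> 0 - f (u z) \<le> - \<kappa>"
      using B by (intro exI[of _ \<kappa>]) (force simp: abs_le_iff)
  qed
  then show ?thesis by simp
qed

lemma abs_le_1: "z \<in> ball 0 1 \<Longrightarrow> \<bar>u z\<bar> \<le> 1"
  using le_1[of z] double_well_solution.le_1[OF reflect_solution, of z] by linarith

text \<open>The Lipschitz bound of f on [-1,1] and f 1 = 0 turn the equation for 1 - u into the
  linear inequality of the strong maximum principle.\<close>

lemma eq_1_if_touches_1:
  assumes "p \<in> ball 0 1" "u p = 1" "z \<in> ball 0 1"
  shows "u z = 1"
proof -
  obtain C where "0 \<le> C" and C: "\<And>s t. \<bar>s\<bar> \<le> 1 \<Longrightarrow> \<bar>t\<bar> \<le> 1 \<Longrightarrow> \<bar>f s - f t\<bar> \<le> C * \<bar>s - t\<bar>"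
    using f_lipschitz_interval by blast
  have w: "blapl (\<lambda>z. 1 - u z) (\<lambda>z. 0 - g z) (\<lambda>z. 0 - f (u z))"
    by (rule lapl_diff[OF lapl_const sol])
  have "1 - u z = 0"
  proof (rule strong_maximum_principle[OF w _ _ assms(1) _ assms(3), of C])
    fix z :: 'a assume z: "z \<in> ball 0 1"
    show "0 \<le> 1 - u z" using le_1[OF z] by simp
    show "0 - f (u z) \<le> C * (1 - u z)"
      using C[of 1 "u z"] abs_le_1[OF z] f_zero by (auto simp: abs_le_iff)
  qed (use assms in auto)
  then show ?thesis by simp
qed

end

section \<open>Solutions converging to a well at infinity\<close>

text \<open>b is the Busemann function of the boundary point \<open>- e\<close>, equal to - ln x in
  a half-space model with that point at infinity. Because its gradient has unit length and its
  Laplacian is constant, v(b) has Laplacian v'' + (n - 1) v': a one-dimensional profile sees the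
  equation with a drift term.\<close>

lemma blapl_busemann:
  fixes e :: "'a::euclidean_space"
  assumes e: "e \<bullet> e = 1"
  defines "b \<equiv> \<lambda>z. ln ((z + e) \<bullet> (z + e)) - ln (1 - z \<bullet> z)"
    and "g \<equiv> \<lambda>z. (2 / ((z + e) \<bullet> (z + e))) *\<^sub>R (z + e) + (2 / (1 - z \<bullet> z)) *\<^sub>R z"
  shows "blapl b g (\<lambda>z. real DIM('a) - 1)"
    and "z \<in> ball 0 1 \<Longrightarrow> ((1 - z \<bullet> z) / 2)\<^sup>2 * (g z \<bullet> g z) = 1"
proof -
  have pos: "0 < (z + e) \<bullet> (z + e)" if "z \<in> ball 0 1" for z
  proof -
    have "norm (- e) = 1" using e by (simp add: norm_eq_sqrt_inner)
    then have "z \<noteq> - e" using that by auto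
    then show ?thesis by (simp add: add_eq_0_iff2)
  qed
  have expand: "(z + e) \<bullet> (z + e) = z \<bullet> z + 2 * (z \<bullet> e) + 1" for z
    using e by (simp add: inner_add_left inner_add_right inner_commute)
  define P where "P z = (z + e) \<bullet> (z + e)" for z
  define N where "N = real DIM('a)"
  have p: "blapl P (\<lambda>z. 2 *\<^sub>R (z + e))
    (\<lambda>z. ((1 - z \<bullet> z) / 2)\<^sup>2 * (2 * N) + (N - 2) * (1 - z \<bullet> z) * (z \<bullet> (z + e)))"
    using blapl_dist_square[of "- e"] by (simp add: P_def[abs_def] N_def)
  have lnp: "blapl (\<lambda>z. ln (P z)) (\<lambda>z. (1 / P z) *\<^sub>R 2 *\<^sub>R (z + e))
    (\<lambda>z. 1 / P z * (((1 - z \<bullet> z) / 2)\<^sup>2 * (2 * N) + (N - 2) * (1 - z \<bullet> z) * (z \<bullet> (z + e)))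
       + - (1 / (P z)\<^sup>2) * (((1 - z \<bullet> z) / 2)\<^sup>2 * (2 *\<^sub>R (z + e) \<bullet> 2 *\<^sub>R (z + e))))"
  proof (rule lapl_compose[OF p])
    fix z :: 'a assume "z \<in> ball 0 1"
    then have "0 < P z" using pos by (simp add: P_def)
    then show "(ln has_real_derivative 1 / P z) (at (P z))"
      and "((\<lambda>s. 1 / s) has_real_derivative - (1 / (P z)\<^sup>2)) (at (P z))"
      by (auto intro!: derivative_eq_intros simp: power2_eq_square)
  qed
  have "blapl (\<lambda>z. ln (P z) + - ln (1 - z \<bullet> z))
    (\<lambda>z. (1 / P z) *\<^sub>R 2 *\<^sub>R (z + e) + (2 / (1 - z \<bullet> z)) *\<^sub>R z) (\<lambda>z. N - 1)"
  proof (rule lapl_cong[OF lapl_add[OF lnp blapl_neg_ln]])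
    fix z :: 'a assume z: "z \<in> ball 0 1"
    define R where "R = 1 - z \<bullet> z"
    define Q where "Q = P z"
    have R: "R > 0" using inner_self_lt_1[OF z] by (simp add: R_def)
    have Q: "Q > 0" using pos[OF z] by (simp add: Q_def P_def)
    have i: "z \<bullet> (z + e) = (Q - R) / 2" "z \<bullet> z = 1 - R" "(z + e) \<bullet> (z + e) = Q"
      using expand[of z] by (simp_all add: Q_def R_def P_def inner_add_right)
    have "1 / Q * ((R / 2)\<^sup>2 * (2 * N) + (N - 2) * R * ((Q - R) / 2))
       + - (1 / Q\<^sup>2) * ((R / 2)\<^sup>2 * (4 * Q)) + (N * R / 2 + (N - 1) * (1 - R)) = N - 1"
      using Q by (simp add: field_simps power2_eq_square)
    then show "1 / P z * (((1 - z \<bullet> z) / 2)\<^sup>2 * (2 * N) + (N - 2) * (1 - z \<bullet> z) * (z \<bullet> (z + e)))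
       + - (1 / (P z)\<^sup>2) * (((1 - z \<bullet> z) / 2)\<^sup>2 * (2 *\<^sub>R (z + e) \<bullet> 2 *\<^sub>R (z + e)))
       + (real DIM('a) * (1 - z \<bullet> z) / 2 + (real DIM('a) - 1) * (z \<bullet> z)) = N - 1"
      unfolding N_def[symmetric] Q_def[symmetric] inner_scaleR_left inner_scaleR_right i by simp
  qed
  then show "blapl b g (\<lambda>z. real DIM('a) - 1)" by (simp add: b_def g_def P_def N_def)
  assume z: "z \<in> ball 0 1"
  define R where "R = 1 - z \<bullet> z"
  define Q where "Q = P z"
  have R: "R > 0" using inner_self_lt_1[OF z] by (simp add: R_def)
  have Q: "Q > 0" using pos[OF z] by (simp add: Q_def P_def)
  have i: "z \<bullet> (z + e) = (Q - R) / 2" "z \<bullet> z = 1 - R" "(z + e) \<bullet> (z + e) = Q"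
    using expand[of z] by (simp_all add: Q_def R_def P_def inner_add_right)
  have "g z \<bullet> g z = (2 / Q)\<^sup>2 * Q + 2 * (2 / Q) * (2 / R) * ((Q - R) / 2) + (2 / R)\<^sup>2 * (1 - R)"
  proof -
    have "(\<alpha> *\<^sub>R x + \<beta> *\<^sub>R y) \<bullet> (\<alpha> *\<^sub>R x + \<beta> *\<^sub>R y)
      = \<alpha>\<^sup>2 * (x \<bullet> x) + 2 * \<alpha> * \<beta> * (y \<bullet> x) + \<beta>\<^sup>2 * (y \<bullet> y)" for \<alpha> \<beta> and x y :: 'a
      by (simp add: inner_add_left inner_add_right inner_commute[of x y] power2_eq_square algebra_simps)
    then show ?thesis unfolding g_def i(3) R_def[symmetric] by (simp only: i)
  qed
  also have "\<dots> = 4 / R\<^sup>2" using Q R by (simp add: field_simps power2_eq_square)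
  finally show "((1 - z \<bullet> z) / 2)\<^sup>2 * (g z \<bullet> g z) = 1"
    using R by (simp add: R_def[symmetric] power_divide)
qed

section \<open>The one-dimensional layer between the two wells\<close>

context double_well
begin

lemma F_pos: "-1 < s \<Longrightarrow> s < 1 \<Longrightarrow> 0 < F s"
  using F_nonneg[of s] F_eq_0_iff[of s] by linarith

text \<open>The first integral of the equation for the one-dimensional Euclidean layer; this is where
  the equality of the two wells enters.\<close>

lemma sqrt_F_deriv:
  assumes "-1 < s" "s < 1"
  shows "((\<lambda>s. sqrt (2 * F s)) has_real_derivative f s / sqrt (2 * F s)) (at s)"
  using F_pos[OF assms] by (auto intro!: derivative_eq_intros F_deriv simp: field_simps)

text \<open>F and f vanish at both wells and f is Lipschitz on [-1,1], so F is at most quadratic in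
  the distance to either well. The linear bound on the root makes the integral of 1/sqrt(2 F)
  diverge at both ends.\<close>

lemma sqrt_F_le:
  "\<exists>k>0. \<forall>s. -1 \<le> s \<longrightarrow> s \<le> 1 \<longrightarrow> sqrt (2 * F s) \<le> k * (1 - s) \<and> sqrt (2 * F s) \<le> k * (1 + s)"
proof -
  obtain C where C: "0 \<le> C" "\<And>s t. \<bar>s\<bar> \<le> 1 \<Longrightarrow> \<bar>t\<bar> \<le> 1 \<Longrightarrow> \<bar>f s - f t\<bar> \<le> C * \<bar>s - t\<bar>"
    using f_lipschitz_interval by blast
  have F1: "F s \<le> C * (1 - s)\<^sup>2" if s: "-1 \<le> s" "s \<le> 1" for s
  proof -
    have "F s - C * (1 - s)\<^sup>2 \<le> F 1 - C * (1 - 1)\<^sup>2"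
    proof (rule DERIV_nonneg_imp_nondecreasing[OF s(2)])
      fix t assume t: "s \<le> t" "t \<le> 1"
      have "((\<lambda>t. F t - C * (1 - t)\<^sup>2) has_real_derivative f t + 2 * C * (1 - t)) (at t)"
        by (auto intro!: derivative_eq_intros F_deriv simp: algebra_simps)
      moreover have "0 \<le> f t + 2 * C * (1 - t)"
      proof -
        have "\<bar>t - 1\<bar> = 1 - t" "\<bar>t\<bar> \<le> 1" using t s by auto
        then have "\<bar>f t\<bar> \<le> C * (1 - t)" using C(2)[of t 1] f_zero by simp
        moreover have "2 * C * (1 - t) = C * (1 - t) + C * (1 - t)" by simp
        ultimately show ?thesis by linarith
      qed
      ultimately show "\<exists>y. ((\<lambda>t. F t - C * (1 - t)\<^sup>2) has_real_derivative y) (at t) \<and> 0 \<le> y" by blast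
    qed
    then show ?thesis using F_eq_0_iff[of 1] by simp
  qed
  have F2: "F s \<le> C * (1 + s)\<^sup>2" if s: "-1 \<le> s" "s \<le> 1" for s
  proof -
    have "F s - C * (1 + s)\<^sup>2 \<le> F (-1) - C * (1 + -1)\<^sup>2"
    proof (rule DERIV_nonpos_imp_nonincreasing[OF s(1)])
      fix t assume t: "-1 \<le> t" "t \<le> s"
      have "((\<lambda>t. F t - C * (1 + t)\<^sup>2) has_real_derivative f t - 2 * C * (1 + t)) (at t)"
        by (auto intro!: derivative_eq_intros F_deriv)
      moreover have "f t - 2 * C * (1 + t) \<le> 0"
      proof -
        have "\<bar>t - -1\<bar> = 1 + t" "\<bar>t\<bar> \<le> 1" using t s by auto
        then have "\<bar>f t\<bar> \<le> C * (1 + t)" using C(2)[of t "-1"] f_zero by (simp add: add.commute)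
        moreover have "2 * C * (1 + t) = C * (1 + t) + C * (1 + t)" by simp
        ultimately show ?thesis by linarith
      qed
      ultimately show "\<exists>y. ((\<lambda>t. F t - C * (1 + t)\<^sup>2) has_real_derivative y) (at t) \<and> y \<le> 0" by blast
    qed
    then show ?thesis using F_eq_0_iff[of "-1"] by simp
  qed
  define k where "k = sqrt (2 * C) + 1"
  have *: "sqrt (2 * F s) \<le> k * t" if "F s \<le> C * t\<^sup>2" "0 \<le> t" for s t
  proof -
    have "sqrt (2 * F s) \<le> sqrt (2 * C * t\<^sup>2)" using that by simp
    also have "\<dots> = sqrt (2 * C) * t" using that by (simp add: real_sqrt_mult)
    also have "\<dots> \<le> k * t" unfolding k_def using that by (intro mult_right_mono) auto
    finally show ?thesis .
  qed
  show ?thesis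
  proof (intro exI[of _ k] conjI)
    show "0 < k" using C by (simp add: k_def add_nonneg_pos)
  qed (use * F1 F2 in auto)
qed

text \<open>G is a primitive of 1/sqrt(2 F), the inverse of the layer. It grows at least like a
  logarithm at both ends, hence is onto the line: the layer needs infinite time to reach a well and
  is defined everywhere.\<close>

lemma layer_inverse:
  "\<exists>G. (\<forall>s. -1 < s \<longrightarrow> s < 1 \<longrightarrow> (G has_real_derivative 1 / sqrt (2 * F s)) (at s)) \<and>
    (\<forall>s t. -1 < s \<longrightarrow> s < t \<longrightarrow> t < 1 \<longrightarrow> G s < G t) \<and>
    (\<forall>y. \<exists>s. -1 < s \<and> s < 1 \<and> G s = y)"
proof -
  define q where "q s = sqrt (2 * F s)" for s
  have q: "0 < q s" if "-1 < s" "s < 1" for s using F_pos[OF that] by (simp add: q_def)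
  have "\<exists>G. \<forall>x. ereal (-1) < ereal x \<longrightarrow> ereal x < ereal 1 \<longrightarrow>
    (G has_vector_derivative 1 / q x) (at x)"
  proof (rule einterval_antiderivative)
    fix x assume "ereal (-1) < ereal x" "ereal x < ereal 1"
    then have x: "-1 < x" "x < 1" by auto
    have "isCont q x" using sqrt_F_deriv[OF x] DERIV_isCont unfolding q_def by blast
    then show "isCont (\<lambda>x. 1 / q x) x" using q[OF x] by (intro continuous_intros) auto
  qed simp
  then obtain G where G: "\<And>s. -1 < s \<Longrightarrow> s < 1 \<Longrightarrow> (G has_real_derivative 1 / q s) (at s)"
    by (auto simp: has_real_derivative_iff_has_vector_derivative)
  have mono: "G s < G t" if "-1 < s" "s < t" "t < 1" for s t
  proof (rule DERIV_pos_imp_increasing[OF that(2)])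
    fix x assume "s \<le> x" "x \<le> t"
    then have "-1 < x" "x < 1" using that by auto
    then show "\<exists>y. (G has_real_derivative y) (at x) \<and> 0 < y" using G q by fastforce
  qed
  obtain k where k: "0 < k" "\<And>s. -1 \<le> s \<Longrightarrow> s \<le> 1 \<Longrightarrow> q s \<le> k * (1 - s)"
    "\<And>s. -1 \<le> s \<Longrightarrow> s \<le> 1 \<Longrightarrow> q s \<le> k * (1 + s)"
    using sqrt_F_le unfolding q_def by blast
  have up: "G 0 \<le> G s + ln (1 - s) / k" if s: "0 \<le> s" "s < 1" for s
  proof -
    have "G 0 + ln (1 - 0) / k \<le> G s + ln (1 - s) / k"
    proof (rule DERIV_nonneg_imp_nondecreasing[OF s(1)])
      fix t assume t: "0 \<le> t" "t \<le> s"
      have "((\<lambda>t. G t + ln (1 - t) / k) has_real_derivative 1 / q t - 1 / (k * (1 - t))) (at t)"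
      proof -
        have "((\<lambda>t. ln (1 - t) / k) has_real_derivative - (1 / (k * (1 - t)))) (at t)"
          using t s k(1) by (auto intro!: derivative_eq_intros simp: field_simps)
        from DERIV_add[OF G this] show ?thesis using t s by simp
      qed
      moreover have "1 / (k * (1 - t)) \<le> 1 / q t"
        using k q[of t] t s by (intro divide_left_mono) (auto simp: mult_pos_pos)
      ultimately show "\<exists>y. ((\<lambda>t. G t + ln (1 - t) / k) has_real_derivative y) (at t) \<and> 0 \<le> y"
        by (metis diff_ge_0_iff_ge)
    qed
    then show ?thesis by simp
  qed
  have lo: "G s - ln (1 + s) / k \<le> G 0" if s: "-1 < s" "s \<le> 0" for s
  proof -
    have "G s - ln (1 + s) / k \<le> G 0 - ln (1 + 0) / k"
    proof (rule DERIV_nonneg_imp_nondecreasing[OF s(2)])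
      fix t assume t: "s \<le> t" "t \<le> 0"
      have "((\<lambda>t. G t - ln (1 + t) / k) has_real_derivative 1 / q t - 1 / (k * (1 + t))) (at t)"
      proof -
        have "((\<lambda>t. ln (1 + t) / k) has_real_derivative 1 / (k * (1 + t))) (at t)"
          using t s k(1) by (auto intro!: derivative_eq_intros simp: divide_inverse mult.commute)
        from DERIV_diff[OF G this] show ?thesis using t s by simp
      qed
      moreover have "1 / (k * (1 + t)) \<le> 1 / q t"
        using k q[of t] t s by (intro divide_left_mono) (auto simp: mult_pos_pos)
      ultimately show "\<exists>y. ((\<lambda>t. G t - ln (1 + t) / k) has_real_derivative y) (at t) \<and> 0 \<le> y"
        by (metis diff_ge_0_iff_ge)
    qed
    then show ?thesis by simp
  qed
  have "\<exists>s. -1 < s \<and> s < 1 \<and> G s = y" for y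
  proof -
    \<comment> \<open>At this distance from the wells the logarithmic bounds place y between
      \<open>G (\<delta> - 1)\<close> and \<open>G (1 - \<delta>)\<close>.\<close>
    define \<delta> where "\<delta> = exp (- k * \<bar>y - G 0\<bar>)"
    have \<delta>: "0 < \<delta>" "\<delta> \<le> 1" "ln \<delta> / k = - \<bar>y - G 0\<bar>" using k(1) by (auto simp: \<delta>_def)
    have "y \<le> G (1 - \<delta>)" using up[of "1 - \<delta>"] \<delta> by simp
    moreover have "G (\<delta> - 1) \<le> y" using lo[of "\<delta> - 1"] \<delta> by simp
    moreover have "\<forall>x. \<delta> - 1 \<le> x \<and> x \<le> 1 - \<delta> \<longrightarrow> isCont G x"
      using \<delta> by (intro allI impI DERIV_isCont[OF G]) auto
    ultimately obtain s where "\<delta> - 1 \<le> s" "s \<le> 1 - \<delta>" "G s = y"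
      using IVT[of G "\<delta> - 1" y "1 - \<delta>"] \<delta> by auto
    then show ?thesis using \<delta> by (intro exI[of _ s]) auto
  qed
  then show ?thesis using G mono unfolding q_def by blast
qed

text \<open>G is exported along with its inverse v because the best shift of the layer is found by
  minimizing G (u z) - b z, for which continuity of G is enough.\<close>

lemma layer_profile:
  "\<exists>v G. (\<forall>x. -1 < v x \<and> v x < 1) \<and> (\<forall>x. (v has_real_derivative sqrt (2 * F (v x))) (at x)) \<and>
    (\<forall>x. ((\<lambda>x. sqrt (2 * F (v x))) has_real_derivative f (v x)) (at x)) \<and>
    continuous_on {-1<..<1} G \<and> (\<forall>s. -1 < s \<longrightarrow> s < 1 \<longrightarrow> v (G s) = s)"
proof -
  obtain G where G: "\<And>s. -1 < s \<Longrightarrow> s < 1 \<Longrightarrow> (G has_real_derivative 1 / sqrt (2 * F s)) (at s)"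
    and mono: "\<And>s t. -1 < s \<Longrightarrow> s < t \<Longrightarrow> t < 1 \<Longrightarrow> G s < G t"
    and surj: "\<And>y. \<exists>s. -1 < s \<and> s < 1 \<and> G s = y"
    using layer_inverse by blast
  obtain v where v: "\<And>y. -1 < v y \<and> v y < 1 \<and> G (v y) = y" using surj by metis
  have vG: "v (G s) = s" if "-1 < s" "s < 1" for s
    using v[of "G s"] mono[of s "v (G s)"] mono[of "v (G s)" s] that by force
  have cont: "isCont v x" for x
  proof -
    define d where "d = min (1 - v x) (v x + 1) / 2"
    have d: "0 < d" "\<And>z. \<bar>z - v x\<bar> \<le> d \<Longrightarrow> -1 < z \<and> z < 1"
    proof -
      show "0 < d" using v[of x] by (simp add: d_def)
      fix z assume "\<bar>z - v x\<bar> \<le> d"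
      moreover have "d \<le> (1 - v x) / 2" "d \<le> (v x + 1) / 2" by (simp_all add: d_def)
      ultimately show "-1 < z \<and> z < 1" using v[of x] by (auto simp: abs_le_iff)
    qed
    have "isCont v (G (v x))"
      by (rule isCont_inverse_function[OF d(1)]) (use d(2) vG G DERIV_isCont in blast)+
    then show ?thesis using v by simp
  qed
  have dv: "(v has_real_derivative sqrt (2 * F (v x))) (at x)" for x
  proof -
    have "(v has_real_derivative inverse (1 / sqrt (2 * F (v x)))) (at x)"
      by (rule DERIV_inverse_function[where f = G and a = "x - 1" and b = "x + 1"])
        (use G v cont F_pos[of "v x"] in auto)
    then show ?thesis by simp
  qed
  have "((\<lambda>x. sqrt (2 * F (v x))) has_real_derivative f (v x)) (at x)" for x
    using DERIV_chain2[OF sqrt_F_deriv dv] v[of x] F_pos[of "v x"] by fastforce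
  moreover have "continuous_on {-1<..<1} G"
    by (intro continuous_at_imp_continuous_on ballI DERIV_isCont[OF G]) auto
  ultimately show ?thesis using v vG dv by blast
qed

end

context double_well_solution
begin

theorem eq_1_if_tendsto_1:
  assumes dim: "DIM('a) \<ge> 2"
    and lim: "\<forall>\<epsilon>>0. \<exists>r<1. \<forall>z\<in>ball 0 1. norm z > r \<longrightarrow> \<bar>u z - 1\<bar> < \<epsilon>"
    and z0: "z0 \<in> ball 0 1"
  shows "u z0 = 1"
proof (rule ccontr)
  assume "u z0 \<noteq> 1"
  then have lt1: "u z < 1" if "z \<in> ball 0 1" for z
    using eq_1_if_touches_1[OF that _ z0] le_1[OF that] by fastforce
  obtain e :: 'a where e: "e \<in> Basis" using nonempty_Basis by blast
  have gt: "-1 < u z" if z: "z \<in> ball 0 1" for z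
  proof (rule ccontr)
    assume "\<not> -1 < u z"
    then have uz: "- u z = 1" using abs_le_1[OF z] by auto
    obtain r where r: "r < 1" "\<And>z. z \<in> ball 0 1 \<Longrightarrow> norm z > r \<Longrightarrow> \<bar>u z - 1\<bar> < 1"
      using lim[rule_format, of 1] by auto
    \<comment> \<open>A point so close to the boundary that u is positive there, whereas touching -1
      would make u identically -1; the maximum with 0 covers a negative r.\<close>
    define y where "y = (max 0 ((r + 1) / 2)) *\<^sub>R e"
    have "norm y = max 0 ((r + 1) / 2)" using e by (simp add: y_def)
    then have y: "y \<in> ball 0 1" "norm y > r" using r(1) by (auto simp: max_def)
    have "- u y = 1"
      by (rule double_well_solution.eq_1_if_touches_1[OF reflect_solution z uz y(1)])
    then show False using r(2)[OF y] by auto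
  qed
  obtain \<epsilon> c where \<epsilon>: "0 < \<epsilon>" "\<epsilon> < 1" "0 < c"
    "\<And>a b. 1 - \<epsilon> \<le> a \<Longrightarrow> a \<le> b \<Longrightarrow> b \<le> 1 \<Longrightarrow> f a - f b \<le> c * (a - b)"
    using f_monotone_near_1 by blast
  \<comment> \<open>The second argument of the minimum forces \<open>z0\<close> into the compact set
    \<open>K\<close>, so that \<open>K\<close> is not empty.\<close>
  define \<epsilon>' where "\<epsilon>' = min \<epsilon> (1 - u z0)"
  have \<epsilon>': "0 < \<epsilon>'" "\<epsilon>' \<le> \<epsilon>" using \<epsilon> lt1[OF z0] by (auto simp: \<epsilon>'_def)
  obtain r where r: "r < 1" "\<And>z. z \<in> ball 0 1 \<Longrightarrow> norm z > r \<Longrightarrow> \<bar>u z - 1\<bar> < \<epsilon>'"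
    using lim[rule_format, OF \<epsilon>'(1)] by auto
  have cont_u: "continuous_on (ball 0 1) u" by (rule lapl_continuous_on[OF sol])
  have sub: "cball 0 r \<subseteq> ball (0 :: 'a) 1" using r(1) by auto
  define K where "K = {z \<in> cball 0 r. u z \<in> {..1 - \<epsilon>'}}"
  have "closed K" unfolding K_def
    by (rule continuous_closed_preimage[unfolded vimage_def Int_def, simplified])
      (use cont_u sub continuous_on_subset in auto)
  then have K: "compact K" unfolding K_def
    by (metis (no_types, lifting) bounded_cball bounded_subset compact_eq_bounded_closed mem_Collect_eq subsetI)
  have KB: "z \<in> ball 0 1" if "z \<in> K" for z using that sub unfolding K_def by blast
  have outside: "1 - \<epsilon>' < u z" if "z \<in> ball 0 1" "z \<notin> K" for z
    using that r(2)[OF that(1)] by (cases "norm z > r") (auto simp: K_def)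
  have "\<epsilon>' \<le> 1 - u z0" by (simp add: \<epsilon>'_def)
  then have "z0 \<in> K" using outside[OF z0] by linarith
  obtain v G where v: "\<And>x. -1 < v x \<and> v x < 1" "\<And>x. (v has_real_derivative sqrt (2 * F (v x))) (at x)"
    "\<And>x. ((\<lambda>x. sqrt (2 * F (v x))) has_real_derivative f (v x)) (at x)"
    and G: "continuous_on {-1<..<1} G" "\<And>s. -1 < s \<Longrightarrow> s < 1 \<Longrightarrow> v (G s) = s"
    using layer_profile by blast
  have v'_pos: "0 < sqrt (2 * F (v x))" for x using v(1)[of x] F_pos by simp
  define b where "b z = ln ((z + e) \<bullet> (z + e)) - ln (1 - z \<bullet> z)" for z :: 'a
  define gb where "gb z = (2 / ((z + e) \<bullet> (z + e))) *\<^sub>R (z + e) + (2 / (1 - z \<bullet> z)) *\<^sub>R z" for z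
  have "e \<bullet> e = 1" using e by simp
  note busemann = blapl_busemann[OF this, folded b_def gb_def]
  have b: "blapl b gb (\<lambda>z. real DIM('a) - 1)" using busemann(1) by (simp add: b_def[abs_def] gb_def[abs_def])
  have gb: "((1 - z \<bullet> z) / 2)\<^sup>2 * (gb z \<bullet> gb z) = 1" if "z \<in> ball 0 1" for z
    using busemann(2)[OF that] .
  have "continuous_on K (\<lambda>z. G (u z) - b z)"
  proof (intro continuous_on_diff continuous_on_compose2[OF G(1)])
    show "continuous_on K u" using cont_u KB by (rule_tac continuous_on_subset) auto
    show "continuous_on K b" using lapl_continuous_on[OF b] KB by (rule_tac continuous_on_subset) auto
    show "u ` K \<subseteq> {-1<..<1}" using lt1 gt KB by auto
  qed
  then obtain p where p: "p \<in> K" "\<And>z. z \<in> K \<Longrightarrow> G (u p) - b p \<le> G (u z) - b z"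
    using continuous_attains_inf[OF K, of "\<lambda>z. G (u z) - b z"] \<open>z0 \<in> K\<close> by blast
  \<comment> \<open>The largest shift for which the layer stays below u on \<open>K\<close>;
    equality holds at \<open>p\<close>.\<close>
  define \<sigma> where "\<sigma> = G (u p) - b p"
  have vmono: "v x \<le> v y" if "x \<le> y" for x y
    by (rule DERIV_nonneg_imp_nondecreasing[OF that]) (use v(2) v'_pos less_imp_le in blast)
  have onK: "v (b z + \<sigma>) \<le> u z" if z: "z \<in> K" for z
  proof -
    have "v (b z + \<sigma>) \<le> v (G (u z))" using p(2)[OF z] by (intro vmono) (simp add: \<sigma>_def)
    then show ?thesis using G(2) lt1 gt KB[OF z] by simp
  qed
  have V: "blapl (\<lambda>z. v (b z + \<sigma>)) (\<lambda>z. sqrt (2 * F (v (b z + \<sigma>))) *\<^sub>R gb z)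
    (\<lambda>z. sqrt (2 * F (v (b z + \<sigma>))) * (real DIM('a) - 1) +
      f (v (b z + \<sigma>)) * (((1 - z \<bullet> z) / 2)\<^sup>2 * (gb z \<bullet> gb z)))"
  proof (rule lapl_compose[OF b, where P = "\<lambda>x. v (x + \<sigma>)"])
    fix z
    show "((\<lambda>x. v (x + \<sigma>)) has_real_derivative sqrt (2 * F (v (b z + \<sigma>)))) (at (b z))"
      using v(2)[of "b z + \<sigma>"] by (simp add: DERIV_shift)
    show "((\<lambda>x. sqrt (2 * F (v (x + \<sigma>)))) has_real_derivative f (v (b z + \<sigma>))) (at (b z))"
      using v(3)[of "b z + \<sigma>"] DERIV_shift[of "\<lambda>x. sqrt (2 * F (v x))" _ "b z" \<sigma>] by simp
  qed
  define l where "l z = f (u z) - (sqrt (2 * F (v (b z + \<sigma>))) * (real DIM('a) - 1) +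
      f (v (b z + \<sigma>)) * (((1 - z \<bullet> z) / 2)\<^sup>2 * (gb z \<bullet> gb z)))" for z
  \<comment> \<open>The drift term (n - 1) v' is positive because the dimension is at least 2, and
    it makes the inequality strict.\<close>
  have l: "l z < f (u z) - f (v (b z + \<sigma>))" if "z \<in> ball 0 1" for z
    unfolding l_def gb[OF that] using v'_pos[of "b z + \<sigma>"] dim by simp
  have w: "blapl (\<lambda>z. u z - v (b z + \<sigma>)) (\<lambda>z. g z - sqrt (2 * F (v (b z + \<sigma>))) *\<^sub>R gb z) l"
    unfolding l_def by (rule lapl_diff[OF sol V])
  have nn: "0 \<le> u z - v (b z + \<sigma>)" if z: "z \<in> ball 0 1" for z
  proof (rule maximum_principle_at_infinity[OF w _ _ z])
    fix z :: 'a assume "z \<in> ball 0 1"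
    then show "- 2 \<le> u z - v (b z + \<sigma>)" using gt[of z] v(1)[of "b z + \<sigma>"] by linarith
  next
    fix \<delta> :: real assume \<delta>: "0 < \<delta>"
    have "l z \<le> - (c * \<delta>)" if z: "z \<in> ball 0 1" "u z - v (b z + \<sigma>) < - \<delta>" for z
    proof -
      \<comment> \<open>Off \<open>K\<close> the value u z is within \<epsilon> of 1 and the layer
        lies above it, so both values are in the range where f increases.\<close>
      have "z \<notin> K" using onK z(2) \<delta> by fastforce
      then have "1 - \<epsilon> \<le> u z" using outside[OF z(1)] \<epsilon>' by linarith
      then have "f (u z) - f (v (b z + \<sigma>)) \<le> c * (u z - v (b z + \<sigma>))"
        using z(2) \<delta> v(1)[of "b z + \<sigma>"] by (intro \<epsilon>(4)) linarith+
      also have "\<dots> \<le> c * (- \<delta>)" using z(2) \<epsilon>(3) by (intro mult_left_mono) auto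
      finally show ?thesis using l[OF z(1)] by simp
    qed
    then show "\<exists>\<kappa>>0. \<forall>z\<in>ball 0 1. u z - v (b z + \<sigma>) < - \<delta> \<longrightarrow> l z \<le> - \<kappa>"
      using \<delta> \<epsilon>(3) by (intro exI[of _ "c * \<delta>"]) auto
  qed
  have pB: "p \<in> ball 0 1" by (rule KB[OF p(1)])
  have eq: "v (b p + \<sigma>) = u p" using G(2) lt1 gt pB by (simp add: \<sigma>_def)
  obtain d where d: "d > 0" "ball p d \<subseteq> ball 0 1" using pB open_contains_ball open_ball by metis
  have "0 \<le> l p"
    by (rule lapl_nonneg_at_local_min[OF w open_ball pB d(1)])
      (use nn d(2) eq in \<open>auto simp: subset_iff dist_commute\<close>)
  then show False using l[OF pB] eq by simp
qed

end

section \<open>Liouville theorems in the upper half-space\<close>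

abbreviation half_space :: "'k::finite pt set" where
  "half_space \<equiv> {w. 0 < fst w}"

abbreviation hlapl ::
  "('k::finite pt \<Rightarrow> real) \<Rightarrow> ('k pt \<Rightarrow> 'k pt) \<Rightarrow> ('k pt \<Rightarrow> real) \<Rightarrow> bool"
  where "hlapl \<equiv> lapl half_space fst (\<lambda>_. e1)"

lemma open_half_space: "open (half_space :: 'k::finite pt set)"
proof -
  have "half_space = fst -` {0<..}" by auto
  then show ?thesis by (metis open_vimage_fst open_greaterThan)
qed

lemma inner_e1 [simp]: "e1 \<bullet> z = fst z" "z \<bullet> e1 = fst z"
  by (auto simp: e1_def inner_prod_def)

lemma fst_e1 [simp]: "fst e1 = 1" and snd_e1 [simp]: "snd e1 = 0"
  by (auto simp: e1_def)

text \<open>\<open>CARD('k)\<close> is n - 1, so x^p solves \<Delta> \<phi> = - c \<phi> exactly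
  when p is a root of p^2 - (n - 1) p + c. This is where the exponents of the decay statements come
  from.\<close>

lemma hlapl_powr:
  "hlapl (\<lambda>z::'k::finite pt. fst z powr p) (\<lambda>z. (p * fst z powr (p - 1)) *\<^sub>R e1)
     (\<lambda>z. (p\<^sup>2 - real CARD('k) * p) * fst z powr p)"
proof -
  have x: "hlapl (fst :: 'k pt \<Rightarrow> real) (\<lambda>_. e1) (\<lambda>z. - (real CARD('k) - 1) * fst z)"
    by (rule laplI[where A = "\<lambda>z h. 0"]) (auto intro!: derivative_eq_intros simp: algebra_simps)
  show ?thesis
  proof (rule lapl_cong[OF lapl_compose[OF x, where P = "\<lambda>x. x powr p"]])
    fix z :: "'k pt" assume "z \<in> half_space"
    then have z: "0 < fst z" by simp
    show "((\<lambda>x. x powr p) has_real_derivative p * fst z powr (p - 1)) (at (fst z))"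
      using z by (auto intro!: derivative_eq_intros)
    show "((\<lambda>x. p * x powr (p - 1)) has_real_derivative
        p * (p - 1) * fst z powr (p - 2)) (at (fst z))"
      using z by (auto intro!: derivative_eq_intros)
    have e: "fst z powr (p - 2) * (fst z)\<^sup>2 = fst z powr p"
      "fst z powr (p - 1) * fst z = fst z powr p"
      using z by (simp_all add: powr_diff powr_numeral)
    have "p * fst z powr (p - 1) * (- (real CARD('k) - 1) * fst z) +
       p * (p - 1) * fst z powr (p - 2) * ((fst z)\<^sup>2 * ((e1 :: 'k pt) \<bullet> e1)) =
       - p * (real CARD('k) - 1) * (fst z powr (p - 1) * fst z)
       + p * (p - 1) * (fst z powr (p - 2) * (fst z)\<^sup>2)"
      by (simp add: algebra_simps)
    also have "\<dots> = (p\<^sup>2 - real CARD('k) * p) * fst z powr p"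
      unfolding e by (simp add: algebra_simps power2_eq_square)
    finally show "p * fst z powr (p - 1) * (- (real CARD('k) - 1) * fst z) +
       p * (p - 1) * fst z powr (p - 2) * ((fst z)\<^sup>2 * ((e1 :: 'k pt) \<bullet> e1)) =
       (p\<^sup>2 - real CARD('k) * p) * fst z powr p" .
  qed
qed

lemma hlapl_norm_snd_square:
  "hlapl (\<lambda>z::'k::finite pt. snd z \<bullet> snd z) (\<lambda>z. (0, 2 *\<^sub>R snd z))
     (\<lambda>z. 2 * real CARD('k) * (fst z)\<^sup>2)"
proof (rule laplI[where A = "\<lambda>z h. (0, 2 *\<^sub>R snd h)"])
  fix z :: "'k pt"
  have "((\<lambda>z::'k pt. snd z \<bullet> snd z) has_derivative (\<lambda>h. snd z \<bullet> snd h + snd h \<bullet> snd z)) (at z)"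
    by (intro has_derivative_inner has_derivative_snd has_derivative_ident)
  moreover have "(\<lambda>h. snd z \<bullet> snd h + snd h \<bullet> snd z) = (\<bullet>) ((0, 2 *\<^sub>R snd z) :: 'k pt)"
    by (auto simp: fun_eq_iff inner_prod_def inner_commute)
  ultimately show "((\<lambda>z. snd z \<bullet> snd z) has_derivative (\<bullet>) (0, 2 *\<^sub>R snd z)) (at z)" by (simp only:)
  show "((\<lambda>z. (0, 2 *\<^sub>R snd z)) has_derivative (\<lambda>h. (0, 2 *\<^sub>R snd h))) (at z)"
    by (auto intro!: derivative_eq_intros)
  have "(\<Sum>b\<in>(Basis :: 'k pt set). (0, 2 *\<^sub>R snd b) \<bullet> b) = 2 * real CARD('k)"
  proof -
    have "(\<Sum>b\<in>(Basis :: 'k pt set). (0, 2 *\<^sub>R snd b) \<bullet> b)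
      = (\<Sum>b\<in>(\<lambda>u. (u, 0)) ` Basis. (0, 2 *\<^sub>R snd b) \<bullet> (b :: 'k pt))
        + (\<Sum>b\<in>(\<lambda>v. (0, v)) ` Basis. (0, 2 *\<^sub>R snd b) \<bullet> (b :: 'k pt))"
      unfolding Basis_prod_def by (rule sum.union_disjoint) auto
    also have "(\<Sum>b\<in>(\<lambda>u. (u, 0)) ` Basis. (0, 2 *\<^sub>R snd b) \<bullet> (b :: 'k pt)) = 0"
      by (rule sum.neutral) auto
    also have "(\<Sum>b\<in>(\<lambda>v. (0, v)) ` Basis. (0, 2 *\<^sub>R snd b) \<bullet> (b :: 'k pt))
       = (\<Sum>v\<in>(Basis :: (real^'k) set). 2)"
      by (subst sum.reindex) (auto simp: inj_on_def inner_prod_def)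
    finally show ?thesis by simp
  qed
  then show "2 * real CARD('k) * (fst z)\<^sup>2 = (fst z)\<^sup>2 * (\<Sum>b\<in>(Basis :: 'k pt set). (0, 2 *\<^sub>R snd b) \<bullet> b)
    - (real DIM('k pt) - 2) * fst z * (e1 \<bullet> (0, 2 *\<^sub>R snd z))"
    by simp
qed

text \<open>x^\<sigma> solves \<Delta> \<phi> = - \<sigma>^2 \<phi>. The factor |y|^2 makes it large
  at Euclidean infinity at the price of the error 4 \<sigma> x^(\<sigma> + 2); the summand K (b -
  x), nonnegative for x \<le> b, contributes - K x^(\<sigma> + 1) and absorbs that error once K > 4
  \<sigma> x.\<close>

lemma hlapl_strip_barrier:
  fixes K b :: real
  defines "\<sigma> \<equiv> real CARD('k::finite) / 2"
  shows "\<exists>g. hlapl (\<lambda>z::'k pt. fst z powr \<sigma> * (snd z \<bullet> snd z + K * (b - fst z))) g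
    (\<lambda>z. - \<sigma>\<^sup>2 * (fst z powr \<sigma> * (snd z \<bullet> snd z + K * (b - fst z)))
       - fst z powr (\<sigma> + 1) * (K - 4 * \<sigma> * fst z))"
proof -
  have 1: "hlapl (\<lambda>z::'k pt. fst z powr \<sigma> * (snd z \<bullet> snd z))
    (\<lambda>z. fst z powr \<sigma> *\<^sub>R (0, 2 *\<^sub>R snd z) + (snd z \<bullet> snd z) *\<^sub>R (\<sigma> * fst z powr (\<sigma> - 1)) *\<^sub>R e1)
    (\<lambda>z. fst z powr \<sigma> * (2 * real CARD('k) * (fst z)\<^sup>2)
      + (snd z \<bullet> snd z) * ((\<sigma>\<^sup>2 - real CARD('k) * \<sigma>) * fst z powr \<sigma>)
      + 2 * ((fst z)\<^sup>2 * ((\<sigma> * fst z powr (\<sigma> - 1)) *\<^sub>R e1 \<bullet> (0, 2 *\<^sub>R snd z))))"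
    by (rule lapl_mult[OF hlapl_powr hlapl_norm_snd_square])
  note 2 = lapl_add[OF 1 lapl_cmult[OF lapl_diff[OF lapl_cmult[OF hlapl_powr[of \<sigma>], of b]
    hlapl_powr[of "\<sigma> + 1"]], of K]]
  have N: "real CARD('k) = 2 * \<sigma>" by (simp add: \<sigma>_def)
  have e: "\<exists>g. hlapl (\<lambda>z::'k pt. fst z powr \<sigma> * (snd z \<bullet> snd z) + K * (b * fst z powr \<sigma> - fst z powr (\<sigma> + 1))) g
    (\<lambda>z. - \<sigma>\<^sup>2 * (fst z powr \<sigma> * (snd z \<bullet> snd z + K * (b - fst z)))
       - fst z powr (\<sigma> + 1) * (K - 4 * \<sigma> * fst z))"
  proof (rule exI, rule lapl_cong[OF 2])
    fix z :: "'k pt" assume "z \<in> half_space"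
    then have z: "fst z powr (\<sigma> + 1) = fst z powr \<sigma> * fst z" by (simp add: powr_add)
    show "fst z powr \<sigma> * (2 * real CARD('k) * (fst z)\<^sup>2)
      + (snd z \<bullet> snd z) * ((\<sigma>\<^sup>2 - real CARD('k) * \<sigma>) * fst z powr \<sigma>)
      + 2 * ((fst z)\<^sup>2 * ((\<sigma> * fst z powr (\<sigma> - 1)) *\<^sub>R e1 \<bullet> (0, 2 *\<^sub>R snd z)))
      + K * (b * ((\<sigma>\<^sup>2 - real CARD('k) * \<sigma>) * fst z powr \<sigma>)
         - ((\<sigma> + 1)\<^sup>2 - real CARD('k) * (\<sigma> + 1)) * fst z powr (\<sigma> + 1))
      = - \<sigma>\<^sup>2 * (fst z powr \<sigma> * (snd z \<bullet> snd z + K * (b - fst z)))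
       - fst z powr (\<sigma> + 1) * (K - 4 * \<sigma> * fst z)"
      unfolding N z by (simp add: algebra_simps power2_eq_square)
  qed
  then obtain g A where *: "\<And>z::'k pt. z \<in> half_space \<Longrightarrow>
     ((\<lambda>z. fst z powr \<sigma> * (snd z \<bullet> snd z) + K * (b * fst z powr \<sigma> - fst z powr (\<sigma> + 1)))
        has_derivative (\<bullet>) (g z)) (at z) \<and> (g has_derivative A z) (at z) \<and>
     - \<sigma>\<^sup>2 * (fst z powr \<sigma> * (snd z \<bullet> snd z + K * (b - fst z)))
       - fst z powr (\<sigma> + 1) * (K - 4 * \<sigma> * fst z) =
     (fst z)\<^sup>2 * (\<Sum>b\<in>Basis. A z b \<bullet> b) - (real DIM('k pt) - 2) * fst z * (e1 \<bullet> g z)"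
    unfolding lapl_def by blast
  show ?thesis
  proof (rule exI[of _ g], rule laplI[where A = A])
    fix z :: "'k pt" assume z: "z \<in> half_space"
    show "((\<lambda>z. fst z powr \<sigma> * (snd z \<bullet> snd z + K * (b - fst z))) has_derivative (\<bullet>) (g z)) (at z)"
      by (rule has_derivative_transform_within_open[OF conjunct1[OF *[OF z]] open_half_space z])
        (simp add: powr_add algebra_simps)
  qed (use * in blast)+
qed

text \<open>A Phragmen-Lindelof argument on the strip, which is unbounded in the Euclidean directions:
  a multiple of the barrier controls infinity, and the maximum of a quotient is examined because
  the zeroth-order term has the unfavourable sign.\<close>

lemma strip_comparison:
  fixes U \<phi> :: "'k::finite pt \<Rightarrow> real" and a b c :: real
  defines "\<sigma> \<equiv> real CARD('k) / 2"
  assumes U: "hlapl U gU lU" and \<phi>: "hlapl \<phi> g\<phi> l\<phi>"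
    and ab: "0 < a" "a < b" and c: "c \<le> \<sigma>\<^sup>2"
    and \<phi>_pos: "\<And>z. a \<le> fst z \<Longrightarrow> fst z \<le> b \<Longrightarrow> 0 < \<phi> z"
    and l\<phi>: "\<And>z. a < fst z \<Longrightarrow> fst z < b \<Longrightarrow> l\<phi> z \<le> - c * \<phi> z"
    and U_bdd: "\<And>z. 0 < fst z \<Longrightarrow> U z \<le> B"
    and lU: "\<And>z. a < fst z \<Longrightarrow> fst z < b \<Longrightarrow> 0 < U z \<Longrightarrow> - c * U z \<le> lU z"
    and at_a: "\<And>z. fst z = a \<Longrightarrow> U z \<le> \<phi> z" and at_b: "\<And>z. fst z = b \<Longrightarrow> U z \<le> \<phi> z"
    and z0: "a \<le> fst z0" "fst z0 \<le> b"
  shows "U z0 \<le> \<phi> z0"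
proof (rule ccontr)
  assume "\<not> U z0 \<le> \<phi> z0"
  then have z0': "\<phi> z0 < U z0" by simp
  have \<sigma>: "\<sigma> > 0" by (simp add: \<sigma>_def)
  \<comment> \<open>One more than 4 \<sigma> b, so that the barrier is a strict supersolution on the
    whole strip.\<close>
  define K where "K = 4 * \<sigma> * b + 1"
  have K: "K > 0" using \<sigma> ab by (simp add: K_def add_pos_pos)
  define \<psi> where "\<psi> z = fst z powr \<sigma> * (snd z \<bullet> snd z + K * (b - fst z))" for z :: "'k pt"
  define l\<psi> where "l\<psi> z = - \<sigma>\<^sup>2 * \<psi> z - fst z powr (\<sigma> + 1) * (K - 4 * \<sigma> * fst z)" for z :: "'k pt"
  obtain g\<psi> where \<psi>: "hlapl \<psi> g\<psi> l\<psi>"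
    using hlapl_strip_barrier[where 'k = 'k, of K b] unfolding \<psi>_def[abs_def] l\<psi>_def[abs_def] \<sigma>_def
    by blast
  have \<psi>_ge: "a powr \<sigma> * (snd z \<bullet> snd z) \<le> \<psi> z" if "a \<le> fst z" "fst z \<le> b" for z
  proof -
    have "0 \<le> K * (b - fst z)" using K that by simp
    then show ?thesis unfolding \<psi>_def using that \<sigma> ab by (intro mult_mono powr_mono2) auto
  qed
  have \<psi>_nn: "0 \<le> \<psi> z" if "a \<le> fst z" "fst z \<le> b" for z
    by (rule order_trans[OF mult_nonneg_nonneg \<psi>_ge[OF that]]) simp_all
  have l\<psi>_less: "l\<psi> z < - c * \<psi> z" if "a < fst z" "fst z < b" for z
  proof -
    have "4 * \<sigma> * fst z \<le> 4 * \<sigma> * b" using that \<sigma> by simp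
    then have "0 < fst z powr (\<sigma> + 1) * (K - 4 * \<sigma> * fst z)"
      using that ab by (intro mult_pos_pos) (auto simp: K_def)
    moreover have "c * \<psi> z \<le> \<sigma>\<^sup>2 * \<psi> z" using c \<psi>_nn[of z] that by (intro mult_right_mono) auto
    ultimately show ?thesis by (simp add: l\<psi>_def)
  qed
  \<comment> \<open>Small enough that U still exceeds the perturbed comparison function at
    \<open>z0\<close>.\<close>
  define \<eta> where "\<eta> = (U z0 - \<phi> z0) / (2 * (\<psi> z0 + 1))"
  have "0 < \<psi> z0 + 1" using \<psi>_nn[OF z0] by simp
  then have \<eta>: "0 < \<eta>" "\<eta> * \<psi> z0 < U z0 - \<phi> z0"
  proof -
    show "0 < \<eta>" using \<open>0 < \<psi> z0 + 1\<close> z0' by (simp add: \<eta>_def)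
    have "\<eta> * \<psi> z0 \<le> \<eta> * (\<psi> z0 + 1)" using \<open>0 < \<eta>\<close> by simp
    also have "D / (2 * t) * t = D / 2" if "0 < t" for D t :: real using that by simp
    then have "\<eta> * (\<psi> z0 + 1) = (U z0 - \<phi> z0) / 2" using \<open>0 < \<psi> z0 + 1\<close> unfolding \<eta>_def by blast
    finally show "\<eta> * \<psi> z0 < U z0 - \<phi> z0" using z0' by simp
  qed
  define \<Phi> where "\<Phi> z = \<phi> z + \<eta> * \<psi> z" for z
  have \<Phi>: "hlapl \<Phi> (\<lambda>z. g\<phi> z + \<eta> *\<^sub>R g\<psi> z) (\<lambda>z. l\<phi> z + \<eta> * l\<psi> z)"
    unfolding \<Phi>_def by (rule lapl_add[OF \<phi> lapl_cmult[OF \<psi>]])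
  have \<Phi>_ge: "\<phi> z \<le> \<Phi> z" "\<eta> * \<psi> z < \<Phi> z" "0 < \<Phi> z" if "a \<le> fst z" "fst z \<le> b" for z
    using \<phi>_pos[OF that] mult_nonneg_nonneg[OF less_imp_le[OF \<eta>(1)] \<psi>_nn[OF that]]
    unfolding \<Phi>_def by linarith+
  \<comment> \<open>Beyond this Euclidean radius \<eta> \<psi> is at least
    \<open>\<bar>B\<bar>\<close>, so the quotient has to be maximized over a compact box
    only.\<close>
  define R where "R = max (norm (snd z0)) (sqrt (\<bar>B\<bar> / (\<eta> * a powr \<sigma>)))"
  have far: "U z < \<Phi> z" if z: "a \<le> fst z" "fst z \<le> b" "R < norm (snd z)" for z
  proof -
    have p: "0 < \<eta> * a powr \<sigma>" using \<eta> ab by simp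
    have "sqrt (\<bar>B\<bar> / (\<eta> * a powr \<sigma>)) \<le> norm (snd z)" using z by (simp add: R_def)
    then have "\<bar>B\<bar> / (\<eta> * a powr \<sigma>) \<le> snd z \<bullet> snd z" by (simp add: norm_eq_sqrt_inner)
    then have "\<bar>B\<bar> \<le> \<eta> * (a powr \<sigma> * (snd z \<bullet> snd z))" using p by (simp add: field_simps)
    also have "\<dots> \<le> \<eta> * \<psi> z" using \<psi>_ge[OF z(1,2)] \<eta> by simp
    also have "\<dots> < \<Phi> z" by (rule \<Phi>_ge[OF z(1,2)])
    finally show ?thesis using U_bdd[of z] z ab by linarith
  qed
  define X where "X = {a..b} \<times> cball (0 :: real^'k) R"
  have X: "z \<in> X \<longleftrightarrow> a \<le> fst z \<and> fst z \<le> b \<and> norm (snd z) \<le> R" for z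
    by (cases z) (auto simp: X_def)
  have "compact X" unfolding X_def by (intro compact_Times) auto
  have sub: "X \<subseteq> half_space" using X ab by force
  have "continuous_on X (\<lambda>z. U z / \<Phi> z)"
  proof (rule continuous_on_divide)
    show "continuous_on X U" "continuous_on X \<Phi>"
      using lapl_continuous_on[OF U] lapl_continuous_on[OF \<Phi>] sub continuous_on_subset by blast+
    show "\<forall>z\<in>X. \<Phi> z \<noteq> 0" using \<Phi>_ge(3) X by (metis less_irrefl)
  qed
  moreover have z0X: "z0 \<in> X" using z0 X by (simp add: R_def)
  ultimately obtain p where p: "p \<in> X" "\<And>z. z \<in> X \<Longrightarrow> U z / \<Phi> z \<le> U p / \<Phi> p"
    using continuous_attains_sup[OF \<open>compact X\<close>, of "\<lambda>z. U z / \<Phi> z"] by blast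
  define M where "M = U p / \<Phi> p"
  have pX: "a \<le> fst p" "fst p \<le> b" using p(1) X by auto
  have "1 < U z0 / \<Phi> z0" using \<Phi>_ge(3)[OF z0] \<eta>(2) by (simp add: \<Phi>_def)
  then have M: "1 < M" using p(2)[OF z0X] by (simp add: M_def)
  have eq: "U p = M * \<Phi> p" using \<Phi>_ge(3)[OF pX] by (simp add: M_def)
  have le: "U z \<le> M * \<Phi> z" if z: "a \<le> fst z" "fst z \<le> b" for z
  proof (cases "norm (snd z) \<le> R")
    case True
    then have "U z / \<Phi> z \<le> M" using p(2)[of z] X z by (simp add: M_def)
    then show ?thesis using \<Phi>_ge(3)[OF z] by (simp add: pos_divide_le_eq)
  next
    case False
    then have "U z < \<Phi> z" using far[OF z] by simp
    also have "\<Phi> z \<le> M * \<Phi> z" using M \<Phi>_ge(3)[OF z] by simp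
    finally show ?thesis by simp
  qed
  have "\<Phi> p < U p" using M \<Phi>_ge(3)[OF pX] eq by simp
  then have "fst p \<noteq> a" "fst p \<noteq> b" using at_a[of p] at_b[of p] \<Phi>_ge(1)[OF pX] by auto
  then have p_in: "a < fst p" "fst p < b" using pX by auto
  have Up: "0 < U p" using \<open>\<Phi> p < U p\<close> \<Phi>_ge(3)[OF pX] by simp
  define e where "e = min (fst p - a) (b - fst p)"
  have e: "e > 0" using p_in by (simp add: e_def)
  \<comment> \<open>At p the function M \<Phi> - U has a local minimum with value 0. Since U p = M
    \<Phi> p exactly, the zeroth-order terms cancel whatever the sign of c, and the strictness of
    the barrier gives the contradiction.\<close>
  have "0 \<le> M * (l\<phi> p + \<eta> * l\<psi> p) - lU p"
  proof (rule lapl_nonneg_at_local_min[OF lapl_diff[OF lapl_cmult[OF \<Phi>, of M] U] open_half_space _ e])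
    show "p \<in> half_space" using p_in ab by simp
    fix w assume "dist w p < e"
    then have "\<bar>fst w - fst p\<bar> < e" using dist_fst_le[of w p] by (simp add: dist_real_def)
    then have "a \<le> fst w" "fst w \<le> b" by (auto simp: e_def abs_less_iff)
    then show "M * \<Phi> p - U p \<le> M * \<Phi> w - U w" using le[of w] eq by simp
  qed
  moreover have "l\<phi> p + \<eta> * l\<psi> p < - c * \<Phi> p"
    using l\<phi>[OF p_in] mult_strict_left_mono[OF l\<psi>_less[OF p_in] \<eta>(1)]
    by (simp add: \<Phi>_def algebra_simps)
  then have "M * (l\<phi> p + \<eta> * l\<psi> p) < M * (- c * \<Phi> p)" using M by (intro mult_strict_left_mono) auto
  moreover have "- c * U p \<le> lU p" by (rule lU[OF p_in Up])
  moreover have "- c * U p = M * (- c * \<Phi> p)" by (simp add: eq)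
  ultimately show False by linarith
qed

text \<open>Provides the lower edge of a strip: close enough to x = 0 the faster decay beats the
  slower one whatever the constants.\<close>

lemma ex_small_powr:
  fixes C \<eta> \<gamma> \<gamma>' x :: real
  assumes "\<gamma>' < \<gamma>" "0 < \<eta>" "0 < x"
  shows "\<exists>a>0. a < x \<and> C * a powr \<gamma> \<le> \<eta> * a powr \<gamma>'"
proof -
  have "((\<lambda>a. C * a powr (\<gamma> - \<gamma>')) \<longlongrightarrow> C * 0) (at_right 0)"
    using assms
    by (intro tendsto_mult tendsto_const tendsto_zero_powrI[where b = "\<gamma> - \<gamma>'"])
      (auto intro: eventually_mono[OF eventually_at_right_less])
  then have "\<forall>\<^sub>F a in at_right 0. C * a powr (\<gamma> - \<gamma>') < \<eta>"
    using order_tendstoD(2) assms by fastforce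
  moreover have "\<forall>\<^sub>F a in at_right 0. a < x" using assms(3) by (auto simp: eventually_at_right)
  moreover have "\<forall>\<^sub>F a in at_right (0::real). 0 < a" by (rule eventually_at_right_less)
  ultimately have "\<forall>\<^sub>F a in at_right 0. 0 < a \<and> a < x \<and> C * a powr (\<gamma> - \<gamma>') < \<eta>"
    by eventually_elim auto
  then obtain a where a: "0 < a" "a < x" "C * a powr (\<gamma> - \<gamma>') < \<eta>"
    using eventually_happens'[OF trivial_limit_at_right_real] by blast
  then have "C * a powr (\<gamma> - \<gamma>') * a powr \<gamma>' \<le> \<eta> * a powr \<gamma>'" by (intro mult_right_mono) auto
  then have "C * a powr \<gamma> \<le> \<eta> * a powr \<gamma>'" using a(1) by (simp add: powr_diff)
  then show ?thesis using a by blast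
qed

text \<open>The function \<eta> x^\<sigma> is the borderline case of the strip comparison. It
  dominates U at a low edge because \<alpha> > \<sigma> and at a high edge because U \<le> 1, for
  every \<eta> > 0, so \<eta> can be chosen small enough to contradict U z0 > 0.\<close>

lemma half_space_liouville_fast_decay:
  fixes U :: "'k::finite pt \<Rightarrow> real" and \<alpha> C :: real
  defines "\<sigma> \<equiv> real CARD('k) / 2"
  assumes U: "hlapl U gU (\<lambda>z. f (U z))"
    and le1: "\<And>z. 0 < fst z \<Longrightarrow> U z \<le> 1"
    and f: "\<And>s. 0 < s \<Longrightarrow> s \<le> 1 \<Longrightarrow> - \<sigma>\<^sup>2 * s \<le> f s"
    and decay: "\<And>z. 0 < fst z \<Longrightarrow> U z \<le> C * fst z powr \<alpha>" and \<alpha>: "\<sigma> < \<alpha>"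
    and z0: "0 < fst z0"
  shows "U z0 \<le> 0"
proof (rule ccontr)
  assume "\<not> U z0 \<le> 0"
  then have pos: "0 < U z0" by simp
  have \<sigma>: "0 < \<sigma>" by (simp add: \<sigma>_def)
  define \<eta> where "\<eta> = U z0 / (2 * fst z0 powr \<sigma>)"
  have \<eta>: "0 < \<eta>" "\<eta> * fst z0 powr \<sigma> < U z0" using pos z0 by (auto simp: \<eta>_def)
  obtain a where a: "0 < a" "a < fst z0" "C * a powr \<alpha> \<le> \<eta> * a powr \<sigma>"
    using ex_small_powr[OF \<alpha> \<eta>(1) z0] by blast
  \<comment> \<open>At height (1/\<eta>)^(1/\<sigma>) the comparison function reaches 1, the bound
    for U.\<close>
  define b where "b = max (fst z0 + 1) ((1 / \<eta>) powr (1 / \<sigma>))"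
  have b: "fst z0 < b" by (simp add: b_def)
  have "1 / \<eta> = ((1 / \<eta>) powr (1 / \<sigma>)) powr \<sigma>" using \<eta> \<sigma> by (simp add: powr_powr)
  also have "\<dots> \<le> b powr \<sigma>" using \<sigma> by (intro powr_mono2) (auto simp: b_def)
  finally have b1: "1 \<le> \<eta> * b powr \<sigma>" using \<eta>(1) by (simp add: field_simps)
  have \<phi>: "hlapl (\<lambda>z::'k pt. \<eta> * fst z powr \<sigma>) (\<lambda>z. \<eta> *\<^sub>R (\<sigma> * fst z powr (\<sigma> - 1)) *\<^sub>R e1)
     (\<lambda>z. \<eta> * ((\<sigma>\<^sup>2 - real CARD('k) * \<sigma>) * fst z powr \<sigma>))"
    by (rule lapl_cmult[OF hlapl_powr])
  have N: "real CARD('k) = 2 * \<sigma>" by (simp add: \<sigma>_def)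
  have "U z0 \<le> \<eta> * fst z0 powr \<sigma>"
  proof (rule strip_comparison[OF U \<phi> a(1), of b "\<sigma>\<^sup>2" 1])
    show "a < b" using a b by simp
    show "0 < \<eta> * fst z powr \<sigma>" if "a \<le> fst z" for z :: "'k pt" using that a \<eta> by simp
    show "\<eta> * ((\<sigma>\<^sup>2 - real CARD('k) * \<sigma>) * fst z powr \<sigma>) \<le> - \<sigma>\<^sup>2 * (\<eta> * fst z powr \<sigma>)" for z :: "'k pt"
      unfolding N by (simp add: power2_eq_square algebra_simps)
    show "- \<sigma>\<^sup>2 * U z \<le> f (U z)" if "a < fst z" "0 < U z" for z
      using f[of "U z"] le1[of z] that a by simp
    show "U z \<le> \<eta> * fst z powr \<sigma>" if "fst z = a" for z
      using decay[of z] that a by simp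
    show "U z \<le> \<eta> * fst z powr \<sigma>" if "fst z = b" for z
      using le1[of z] that b b1 z0 by simp
  qed (use le1 a b in \<open>auto simp: \<sigma>_def\<close>)
  then show False using \<eta> by simp
qed

text \<open>The exponents \<sigma> + d and \<sigma> - d are the roots of p^2 - 2 \<sigma> p +
  \<sigma>^2 - d^2. A fixed multiple of the larger power controls the top edge, an arbitrarily small
  multiple \<eta> of the smaller one the bottom edge, because \<sigma> - d < \<alpha>; letting
  \<eta> tend to 0 leaves the faster decay.\<close>

lemma half_space_decay_improvement:
  fixes U :: "'k::finite pt \<Rightarrow> real" and \<alpha> C d \<delta> :: real
  defines "\<sigma> \<equiv> real CARD('k) / 2"
  assumes U: "hlapl U gU (\<lambda>z. f (U z))"
    and le1: "\<And>z. 0 < fst z \<Longrightarrow> U z \<le> 1"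
    and \<delta>: "0 < \<delta>" and f: "\<And>s. 0 < s \<Longrightarrow> s < \<delta> \<Longrightarrow> - (\<sigma>\<^sup>2 - d\<^sup>2) * s \<le> f s"
    and decay: "\<And>z. 0 < fst z \<Longrightarrow> U z \<le> C * fst z powr \<alpha>"
    and \<alpha>: "0 < \<alpha>" "\<sigma> - d < \<alpha>" and d: "0 < d"
  shows "\<exists>M. \<forall>z. 0 < fst z \<longrightarrow> U z \<le> M * fst z powr (\<sigma> + d)"
proof -
  have \<sigma>: "0 < \<sigma>" by (simp add: \<sigma>_def)
  have N: "real CARD('k) = 2 * \<sigma>" by (simp add: \<sigma>_def)
  \<comment> \<open>Up to this height the decay hypothesis forces U < \<delta>, where the linear
    lower bound on f is available.\<close>
  define x0 where "x0 = (\<delta> / (\<bar>C\<bar> + 1)) powr (1 / \<alpha>) / 2"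
  have x0: "0 < x0" using \<delta> by (simp add: x0_def)
  have small: "U z < \<delta>" if z: "0 < fst z" "fst z \<le> x0" for z
  proof -
    have "fst z powr \<alpha> \<le> ((\<delta> / (\<bar>C\<bar> + 1)) powr (1 / \<alpha>)) powr \<alpha>"
      using z \<alpha> x0 by (intro powr_mono2) (auto simp: x0_def)
    also have "\<dots> = \<delta> / (\<bar>C\<bar> + 1)" using \<alpha> \<delta> by (simp add: powr_powr)
    finally have "fst z powr \<alpha> * (\<bar>C\<bar> + 1) \<le> \<delta>" by (simp add: pos_le_divide_eq)
    moreover have "0 < fst z powr \<alpha>" using z by simp
    moreover have "fst z powr \<alpha> * (\<bar>C\<bar> + 1) = \<bar>C\<bar> * fst z powr \<alpha> + fst z powr \<alpha>"
      by (simp add: algebra_simps)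
    ultimately have "\<bar>C\<bar> * fst z powr \<alpha> < \<delta>" by linarith
    moreover have "C * fst z powr \<alpha> \<le> \<bar>C\<bar> * fst z powr \<alpha>" by (intro mult_right_mono) auto
    ultimately show ?thesis using decay[OF z(1)] by linarith
  qed
  \<comment> \<open>Normalized so that M x^(\<sigma> + d) is 1, an upper bound for U, at the top
    edge \<open>x0\<close>.\<close>
  define M where "M = 1 / x0 powr (\<sigma> + d)"
  have M: "0 < M" "M * x0 powr (\<sigma> + d) = 1" using x0 by (auto simp: M_def)
  have "U z0 \<le> M * fst z0 powr (\<sigma> + d)" if z0: "0 < fst z0" for z0
  proof (cases "fst z0 < x0")
    case False
    then have "x0 powr (\<sigma> + d) \<le> fst z0 powr (\<sigma> + d)" using x0 \<sigma> d by (intro powr_mono2) auto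
    then have "1 \<le> M * fst z0 powr (\<sigma> + d)" using M mult_left_mono[of _ _ M] by fastforce
    then show ?thesis using le1[OF z0] by simp
  next
    case True
    have "U z0 \<le> M * fst z0 powr (\<sigma> + d) + \<eta> * fst z0 powr (\<sigma> - d)" if \<eta>: "0 < \<eta>" for \<eta>
    proof -
      obtain a where a: "0 < a" "a < fst z0" "C * a powr \<alpha> \<le> \<eta> * a powr (\<sigma> - d)"
        using ex_small_powr[OF \<alpha>(2) \<eta> z0] by blast
      have \<phi>: "hlapl (\<lambda>z::'k pt. M * fst z powr (\<sigma> + d) + \<eta> * fst z powr (\<sigma> - d))
        (\<lambda>z. M *\<^sub>R ((\<sigma> + d) * fst z powr (\<sigma> + d - 1)) *\<^sub>R e1
          + \<eta> *\<^sub>R ((\<sigma> - d) * fst z powr (\<sigma> - d - 1)) *\<^sub>R e1)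
        (\<lambda>z. M * (((\<sigma> + d)\<^sup>2 - real CARD('k) * (\<sigma> + d)) * fst z powr (\<sigma> + d))
          + \<eta> * (((\<sigma> - d)\<^sup>2 - real CARD('k) * (\<sigma> - d)) * fst z powr (\<sigma> - d)))"
        by (rule lapl_add[OF lapl_cmult[OF hlapl_powr] lapl_cmult[OF hlapl_powr]])
      show ?thesis
      proof (rule strip_comparison[OF U \<phi> a(1), of x0 "\<sigma>\<^sup>2 - d\<^sup>2" 1])
        show "a < x0" using a True by simp
        show "0 < M * fst z powr (\<sigma> + d) + \<eta> * fst z powr (\<sigma> - d)" if "a \<le> fst z" for z :: "'k pt"
          using that a \<eta> M by (intro add_pos_pos) auto
        show "M * (((\<sigma> + d)\<^sup>2 - real CARD('k) * (\<sigma> + d)) * fst z powr (\<sigma> + d))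
          + \<eta> * (((\<sigma> - d)\<^sup>2 - real CARD('k) * (\<sigma> - d)) * fst z powr (\<sigma> - d))
          \<le> - (\<sigma>\<^sup>2 - d\<^sup>2) * (M * fst z powr (\<sigma> + d) + \<eta> * fst z powr (\<sigma> - d))" for z :: "'k pt"
          unfolding N by (simp add: power2_eq_square algebra_simps)
        show "- (\<sigma>\<^sup>2 - d\<^sup>2) * U z \<le> f (U z)" if "a < fst z" "fst z < x0" "0 < U z" for z
          using f[of "U z"] small[of z] that a by simp
        show "U z \<le> M * fst z powr (\<sigma> + d) + \<eta> * fst z powr (\<sigma> - d)" if "fst z = a" for z
        proof -
          have "0 \<le> M * a powr (\<sigma> + d)" using M(1) by simp
          then show ?thesis using decay[of z] that a by simp
        qed
        show "U z \<le> M * fst z powr (\<sigma> + d) + \<eta> * fst z powr (\<sigma> - d)" if "fst z = x0" for z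
        proof -
          have "0 \<le> \<eta> * x0 powr (\<sigma> - d)" using \<eta> by simp
          then show ?thesis using le1[of z] that x0 M(2) by simp
        qed
      qed (use le1 a True in \<open>auto simp: \<sigma>_def\<close>)
    qed
    note eps = this
    show ?thesis
    proof (rule field_le_epsilon)
      fix e :: real assume "0 < e"
      moreover have "0 < fst z0 powr (\<sigma> - d)" using z0 by simp
      ultimately show "U z0 \<le> M * fst z0 powr (\<sigma> + d) + e"
        using eps[of "e / fst z0 powr (\<sigma> - d)"] by simp
    qed
  qed
  then show ?thesis by blast
qed

section \<open>The Cayley transform between the half-space and the ball\<close>

lemma cayley_altdef: "cayley z = - e1 + (2 / ((z - - e1) \<bullet> (z - - e1))) *\<^sub>R (z - - e1)"
  by (simp add: cayley_def power2_norm_eq_inner)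

lemma cayley_facts:
  fixes z :: "'k::finite pt"
  assumes z: "0 < fst z"
  shows "0 < (z + e1) \<bullet> (z + e1)"
    and "(1 - cayley z \<bullet> cayley z) / 2 = 2 / ((z + e1) \<bullet> (z + e1)) * fst z"
    and "cayley z \<in> ball 0 1"
proof -
  define s where "s = (z + e1) \<bullet> (z + e1)"
  have "z + e1 \<noteq> 0"
    using z by (metis add_pos_pos fst_add fst_e1 fst_zero less_irrefl zero_less_one)
  then show s: "0 < s" by (simp add: s_def)
  have "cayley z = (2 / s) *\<^sub>R (z + e1) - e1" by (simp add: cayley_def s_def power2_norm_eq_inner)
  then have "cayley z \<bullet> cayley z = (2 / s)\<^sup>2 * s - 2 * ((2 / s) * (fst z + 1)) + 1"
  proof -
    have "(a *\<^sub>R v - e1) \<bullet> (a *\<^sub>R v - e1) = a\<^sup>2 * (v \<bullet> v) - 2 * (a * fst v) + 1" for a and v :: "'k pt"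
      by (simp add: inner_diff_left inner_diff_right power2_eq_square algebra_simps)
    from this[of "2 / s" "z + e1"] show ?thesis unfolding \<open>cayley z = _\<close> by (simp add: s_def)
  qed
  also have "\<dots> = 1 - 4 * fst z / s" using s by (simp add: field_simps power2_eq_square)
  finally have e: "cayley z \<bullet> cayley z = 1 - 4 * fst z / s" .
  then show "(1 - cayley z \<bullet> cayley z) / 2 = 2 / s * fst z" by simp
  have "cayley z \<bullet> cayley z < 1" using e s z by simp
  then show "cayley z \<in> ball 0 1" by (simp add: norm_eq_sqrt_inner)
qed

lemma hlapl_cayley:
  fixes u :: "'k::finite pt \<Rightarrow> real"
  assumes "blapl u g l"
  shows "\<exists>k. hlapl (\<lambda>w. u (cayley w)) k (\<lambda>w. l (cayley w))"
proof -
  have "lapl half_space fst (\<lambda>_. e1)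
    (\<lambda>z. u (- e1 + (2 / ((z - - e1) \<bullet> (z - - e1))) *\<^sub>R (z - - e1)))
    (\<lambda>z. (2 / ((z - - e1) \<bullet> (z - - e1))) *\<^sub>R
      (g (- e1 + (2 / ((z - - e1) \<bullet> (z - - e1))) *\<^sub>R (z - - e1))
        - (2 * ((z - - e1) \<bullet> g (- e1 + (2 / ((z - - e1) \<bullet> (z - - e1))) *\<^sub>R (z - - e1)))
           / ((z - - e1) \<bullet> (z - - e1))) *\<^sub>R (z - - e1)))
    (\<lambda>z. l (- e1 + (2 / ((z - - e1) \<bullet> (z - - e1))) *\<^sub>R (z - - e1)))"
  proof (rule lapl_inversion[OF assms], unfold cayley_altdef[symmetric])
    show "- e1 \<notin> (half_space :: 'k pt set)" by simp
    fix z :: "'k pt" assume "z \<in> half_space"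
    then have z: "0 < fst z" by simp
    show "cayley z \<in> ball 0 1" by (rule cayley_facts(3)[OF z])
    show "(1 - cayley z \<bullet> cayley z) / 2 = 2 / ((z - - e1) \<bullet> (z - - e1)) * fst z"
      using cayley_facts(2)[OF z] by simp
    show "- cayley z = e1 + ((2 * fst z - 2 * ((z - - e1) \<bullet> e1)) / ((z - - e1) \<bullet> (z - - e1))) *\<^sub>R (z - - e1)"
      by (simp add: cayley_def power2_norm_eq_inner)
  qed
  then show ?thesis unfolding cayley_altdef by blast
qed

context double_well
begin

lemma f_gt_near_0:
  assumes "- f' 0 < c"
  shows "\<exists>\<delta>>0. \<forall>s. 0 < s \<longrightarrow> s < \<delta> \<longrightarrow> - c * s \<le> f s"
proof -
  have "((\<lambda>s. f s + c * s) has_real_derivative f' 0 + c) (at 0)"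
    by (auto intro!: derivative_eq_intros f_deriv)
  then obtain \<delta> where "\<delta> > 0" "\<forall>h>0. h < \<delta> \<longrightarrow> f 0 + c * 0 < f (0 + h) + c * (0 + h)"
    using DERIV_pos_inc_right[of "\<lambda>s. f s + c * s" "f' 0 + c" 0] assms by auto
  then show ?thesis using f_zero by (intro exI[of _ \<delta>]) force
qed

end

text \<open>When \<alpha> \<le> \<sigma>, one improvement step suffices. As f has slope - lam at 0,
  the bound f s \<ge> - (\<sigma>^2 - d^2) s holds for small s > 0 whenever lam < \<sigma>^2 - d^2,
  and d can be chosen with \<sigma> - d < \<alpha> as well. The new exponent \<sigma> + d exceeds
  \<sigma>.\<close>

lemma half_space_liouville:
  fixes F f f' :: "real \<Rightarrow> real" and u :: "'k::finite pt \<Rightarrow> real" and \<alpha> C :: real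
  defines "\<sigma> \<equiv> real CARD('k) / 2"
  assumes dws: "double_well_solution F f f' u g" and neg: "f' 0 < 0"
    and lip: "\<And>s. 0 < s \<Longrightarrow> s \<le> 1 \<Longrightarrow> - \<sigma>\<^sup>2 * s \<le> f s"
    and \<alpha>: "root_minus (real CARD('k) + 1) (- f' 0) < \<alpha>"
    and decay: "\<And>w. 0 < fst w \<Longrightarrow> u (cayley w) \<le> C * fst w powr \<alpha>"
    and w: "0 < fst w"
  shows "u (cayley w) \<le> 0"
proof -
  interpret double_well_solution F f f' u g by (rule dws)
  obtain k where U: "hlapl (\<lambda>w. u (cayley w)) k (\<lambda>w. f (u (cayley w)))"
    using hlapl_cayley[OF sol] by blast
  have U1: "u (cayley w) \<le> 1" if "0 < fst w" for w by (rule le_1[OF cayley_facts(3)[OF that]])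
  have \<sigma>: "0 < \<sigma>" by (simp add: \<sigma>_def)
  define lam where "lam = - f' 0"
  have e: "(2 * \<sigma>)\<^sup>2 - 4 * lam = 4 * (\<sigma>\<^sup>2 - lam)" by (simp add: power2_eq_square algebra_simps)
  have "sqrt ((2 * \<sigma>)\<^sup>2 - 4 * lam) = 2 * sqrt (\<sigma>\<^sup>2 - lam)" unfolding e real_sqrt_mult by simp
  then have \<alpha>': "\<sigma> - sqrt (\<sigma>\<^sup>2 - lam) < \<alpha>"
    using \<alpha> unfolding root_minus_def lam_def[symmetric] by (simp add: \<sigma>_def)
  show ?thesis
  proof (cases "\<sigma> < \<alpha>")
    case True
    show ?thesis
      by (rule half_space_liouville_fast_decay[OF U U1 lip[unfolded \<sigma>_def] decay True[unfolded \<sigma>_def] w])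
  next
    case False
    \<comment> \<open>Midpoint of \<sigma> - \<alpha> and sqrt(\<sigma>^2 - lam), which are in this
      order because \<alpha> exceeds the smaller root.\<close>
    define d where "d = (\<sigma> - \<alpha> + sqrt (\<sigma>\<^sup>2 - lam)) / 2"
    have s: "0 < sqrt (\<sigma>\<^sup>2 - lam)" using \<alpha>' False by linarith
    have d: "\<sigma> - \<alpha> < d" "0 < d" "d < sqrt (\<sigma>\<^sup>2 - lam)" using \<alpha>' False s by (auto simp: d_def)
    have "d\<^sup>2 < (sqrt (\<sigma>\<^sup>2 - lam))\<^sup>2" using d by (intro power_strict_mono) auto
    then have "lam < \<sigma>\<^sup>2 - d\<^sup>2" using s by simp
    then obtain \<delta> where \<delta>: "\<delta> > 0" "\<And>s. 0 < s \<Longrightarrow> s < \<delta> \<Longrightarrow> - (\<sigma>\<^sup>2 - d\<^sup>2) * s \<le> f s"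
      using f_gt_near_0[of "\<sigma>\<^sup>2 - d\<^sup>2"] unfolding lam_def by blast
    have "sqrt (\<sigma>\<^sup>2 - lam) < sqrt (\<sigma>\<^sup>2)" using neg by (intro real_sqrt_less_mono) (simp add: lam_def)
    then have "0 < \<alpha>" using \<alpha>' \<sigma> by simp
    moreover have "\<sigma> - d < \<alpha>" using d by simp
    ultimately obtain M where "\<And>w. 0 < fst w \<Longrightarrow> u (cayley w) \<le> M * fst w powr (\<sigma> + d)"
      using half_space_decay_improvement[OF U U1 \<delta>(1), of d C \<alpha>] \<delta>(2) decay d(2)
      unfolding \<sigma>_def by blast
    then show ?thesis
      using half_space_liouville_fast_decay[OF U U1, of M "\<sigma> + d"] lip w d unfolding \<sigma>_def by simp
  qed
qed

lemma cayley_involution: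
  fixes z :: "'k::finite pt"
  assumes z: "z \<noteq> - e1"
  shows "cayley (cayley z) = z"
proof -
  define v where "v = z + e1"
  have v: "v \<bullet> v \<noteq> 0" using z by (simp add: v_def eq_neg_iff_add_eq_0)
  have e: "cayley z + e1 = (2 / (v \<bullet> v)) *\<^sub>R v"
    by (simp add: cayley_def v_def power2_norm_eq_inner)
  have "(2 / (v \<bullet> v)) *\<^sub>R v \<bullet> (2 / (v \<bullet> v)) *\<^sub>R v = 4 / (v \<bullet> v)"
    using v by (simp add: power2_eq_square)
  then have "cayley (cayley z) = (2 / (4 / (v \<bullet> v))) *\<^sub>R (2 / (v \<bullet> v)) *\<^sub>R v - e1"
    unfolding cayley_def[of "cayley z"] e power2_norm_eq_inner by simp
  also have "\<dots> = v - e1" using v by simp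
  finally show ?thesis by (simp add: v_def)
qed

lemma fst_cayley_pos:
  fixes z :: "'k::finite pt"
  assumes z: "z \<in> ball 0 1"
  shows "0 < fst (cayley z)" and "cayley (cayley z) = z"
proof -
  have "norm (- e1 :: 'k pt) = 1" by (simp add: e1_def norm_Pair)
  then have ne: "z \<noteq> - e1" using z by auto
  define s where "s = (z + e1) \<bullet> (z + e1)"
  have s: "0 < s" using ne by (simp add: s_def eq_neg_iff_add_eq_0)
  have s': "s = z \<bullet> z + 2 * fst z + 1"
    by (simp add: s_def inner_add_left inner_add_right)
  have "fst (cayley z) = 2 / s * (fst z + 1) - 1"
    by (simp add: cayley_def power2_norm_eq_inner s_def)
  also have "\<dots> = (2 * fst z + 2 - s) / s" using s by (simp add: diff_divide_distrib)
  also have "2 * fst z + 2 - s = 1 - z \<bullet> z" using s' by simp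
  finally show "0 < fst (cayley z)" using s inner_self_lt_1[OF z] by simp
  show "cayley (cayley z) = z" by (rule cayley_involution[OF ne])
qed

lemma abs_half_space_liouville:
  fixes F f f' :: "real \<Rightarrow> real" and u :: "'k::finite pt \<Rightarrow> real" and \<alpha> C L :: real
  assumes dws: "double_well_solution F f f' u g" and neg: "f' 0 < 0"
    and lip: "\<And>s. \<bar>s\<bar> \<le> 1 \<Longrightarrow> \<bar>f s\<bar> \<le> L * \<bar>s\<bar>" and L: "L \<le> (real CARD('k))\<^sup>2 / 4"
    and \<alpha>: "root_minus (real CARD('k) + 1) (- f' 0) < \<alpha>"
    and decay: "\<And>w. 0 < fst w \<Longrightarrow> \<bar>u (cayley w)\<bar> \<le> C * fst w powr \<alpha>"
    and z: "z \<in> ball 0 1"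
  shows "u z = 0"
proof -
  interpret double_well_solution F f f' u g by (rule dws)
  have Ls: "L * s \<le> (real CARD('k) / 2)\<^sup>2 * s" if "0 < s" for s
    using that L by (intro mult_right_mono) (auto simp: power_divide)
  have w: "0 < fst (cayley z)" "cayley (cayley z) = z" by (rule fst_cayley_pos[OF z])+
  have "u (cayley (cayley z)) \<le> 0"
  proof (rule half_space_liouville[OF dws neg _ \<alpha> _ w(1)])
    show "- (real CARD('k) / 2)\<^sup>2 * s \<le> f s" if "0 < s" "s \<le> 1" for s
    proof -
      have "\<bar>f s\<bar> \<le> L * s" using lip[of s] that by simp
      then show ?thesis using Ls[OF that(1)] by linarith
    qed
    show "u (cayley w) \<le> C * fst w powr \<alpha>" if "0 < fst w" for w
      using decay[OF that] by simp
  qed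
  moreover have "- u (cayley (cayley z)) \<le> 0"
  proof (rule half_space_liouville[OF reflect_solution _ _ _ _ w(1)])
    show "- (real CARD('k) / 2)\<^sup>2 * s \<le> - f (- s)" if "0 < s" "s \<le> 1" for s
    proof -
      have "\<bar>f (- s)\<bar> \<le> L * s" using lip[of "- s"] that by simp
      then show ?thesis using Ls[OF that(1)] by linarith
    qed
    show "- u (cayley w) \<le> C * fst w powr \<alpha>" if "0 < fst w" for w
      using decay[OF that] by simp
  qed (use neg \<alpha> in auto)
  ultimately show ?thesis using w by simp
qed

section \<open>Inversions and translations of the ball\<close>

lemma lapl_transform:
  fixes u v :: "'a::euclidean_space \<Rightarrow> real"
  assumes "lapl S \<omega> d\<omega> u g l" "open S" "\<And>z. z \<in> S \<Longrightarrow> u z = v z"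
  shows "lapl S \<omega> d\<omega> v g l"
proof -
  obtain A where A: "\<And>z. z \<in> S \<Longrightarrow> (u has_derivative (\<lambda>h. g z \<bullet> h)) (at z) \<and>
      (g has_derivative A z) (at z) \<and>
      l z = (\<omega> z)\<^sup>2 * (\<Sum>b\<in>Basis. A z b \<bullet> b) - (real DIM('a) - 2) * \<omega> z * (d\<omega> z \<bullet> g z)"
    using assms(1) unfolding lapl_def by blast
  show ?thesis
  proof (rule laplI[where A = A])
    fix z assume z: "z \<in> S"
    show "(v has_derivative (\<bullet>) (g z)) (at z)"
      by (rule has_derivative_transform_within_open[OF conjunct1[OF A[OF z]] assms(2) z assms(3)])
  qed (use A in blast)+
qed

text \<open>For |c| > 1 this is the inversion in the sphere about c of squared radius |c|^2 - 1,
  which meets the unit sphere orthogonally: the hyperbolic reflection in the hyperplane cut out by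
  that sphere. If \<open>fst c = 0\<close>, it preserves \<open>P0\<close>.\<close>

definition ball_inversion :: "'a::euclidean_space \<Rightarrow> 'a \<Rightarrow> 'a" where
  "ball_inversion c z = c + ((c \<bullet> c - 1) / ((z - c) \<bullet> (z - c))) *\<^sub>R (z - c)"

lemma ball_inversion_center_dist:
  assumes "1 < c \<bullet> c" "z \<bullet> z \<le> 1"
  shows "0 < (z - c) \<bullet> (z - c)"
  using assms by (metis inner_gt_zero_iff leD right_minus_eq)

lemma ball_inversion_norm:
  assumes c: "1 < c \<bullet> c" and z: "z \<bullet> z \<le> 1"
  shows "1 - ball_inversion c z \<bullet> ball_inversion c z
    = (c \<bullet> c - 1) / ((z - c) \<bullet> (z - c)) * (1 - z \<bullet> z)"
proof -
  define v where "v = z - c"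
  define s where "s = v \<bullet> v"
  define \<rho> where "\<rho> = (c \<bullet> c - 1) / s"
  have s: "s \<noteq> 0" using ball_inversion_center_dist[OF assms] by (simp add: s_def v_def)
  have \<rho>: "\<rho> * s = c \<bullet> c - 1" using s by (simp add: \<rho>_def)
  have "(c + \<rho> *\<^sub>R v) \<bullet> (c + \<rho> *\<^sub>R v) = c \<bullet> c + 2 * \<rho> * (c \<bullet> v) + \<rho> * (\<rho> * s)"
    by (simp add: inner_add_left inner_add_right inner_commute[of v c] s_def algebra_simps)
  then have "1 - (c + \<rho> *\<^sub>R v) \<bullet> (c + \<rho> *\<^sub>R v) = - (\<rho> * s) - 2 * \<rho> * (c \<bullet> v) - \<rho> * (c \<bullet> c - 1)"
    unfolding \<rho> by simp
  also have "\<dots> = \<rho> * (1 - (v + c) \<bullet> (v + c))"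
    by (simp add: inner_add_left inner_add_right inner_commute[of v c] s_def algebra_simps)
  also have "v + c = z" by (simp add: v_def)
  finally show ?thesis by (simp add: ball_inversion_def \<rho>_def s_def v_def)
qed

lemma ball_inversion_in:
  assumes c: "1 < c \<bullet> c"
  shows "z \<in> ball 0 1 \<Longrightarrow> ball_inversion c z \<in> ball 0 1"
    and "z \<in> cball 0 1 \<Longrightarrow> ball_inversion c z \<in> cball 0 1"
proof -
  have *: "ball_inversion c z \<bullet> ball_inversion c z \<le> 1"
    "z \<bullet> z < 1 \<Longrightarrow> ball_inversion c z \<bullet> ball_inversion c z < 1" if z: "z \<bullet> z \<le> 1"
  proof -
    have p: "0 < (c \<bullet> c - 1) / ((z - c) \<bullet> (z - c))"
      using ball_inversion_center_dist[OF c z] c by simp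
    have "0 \<le> 1 - ball_inversion c z \<bullet> ball_inversion c z"
      unfolding ball_inversion_norm[OF c z] using p z by (intro mult_nonneg_nonneg) auto
    then show "ball_inversion c z \<bullet> ball_inversion c z \<le> 1" by simp
    assume "z \<bullet> z < 1"
    then have "0 < 1 - ball_inversion c z \<bullet> ball_inversion c z"
      unfolding ball_inversion_norm[OF c z] using p by (intro mult_pos_pos) auto
    then show "ball_inversion c z \<bullet> ball_inversion c z < 1" by simp
  qed
  show "z \<in> ball 0 1 \<Longrightarrow> ball_inversion c z \<in> ball 0 1"
    using * by (simp add: norm_eq_sqrt_inner)
  show "z \<in> cball 0 1 \<Longrightarrow> ball_inversion c z \<in> cball 0 1"
    using * by (simp add: norm_eq_sqrt_inner)
qed

lemma ball_inversion_involution: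
  assumes c: "1 < c \<bullet> c" and z: "z \<bullet> z \<le> 1"
  shows "ball_inversion c (ball_inversion c z) = z"
proof -
  define v where "v = z - c"
  define s where "s = v \<bullet> v"
  define k where "k = c \<bullet> c - 1"
  have s: "s \<noteq> 0" using ball_inversion_center_dist[OF assms] by (simp add: s_def v_def)
  have k: "k \<noteq> 0" using c by (simp add: k_def)
  have e: "ball_inversion c z - c = (k / s) *\<^sub>R v" by (simp add: ball_inversion_def k_def s_def v_def)
  have "(k / s) *\<^sub>R v \<bullet> (k / s) *\<^sub>R v = k\<^sup>2 / s"
    using s by (simp add: s_def[symmetric] power2_eq_square)
  then have "ball_inversion c (ball_inversion c z) = c + (k / (k\<^sup>2 / s)) *\<^sub>R (k / s) *\<^sub>R v"
    unfolding ball_inversion_def[of c "ball_inversion c z"] e by (simp add: k_def)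
  also have "\<dots> = c + v" using s k by (simp add: power2_eq_square)
  finally show ?thesis by (simp add: v_def)
qed

lemma ball_inversion_continuous:
  assumes c: "1 < c \<bullet> c"
  shows "continuous_on (cball 0 1) (ball_inversion c)"
proof -
  have "(z - c) \<bullet> (z - c) \<noteq> 0" if "z \<in> cball 0 1" for z
    using ball_inversion_center_dist[OF c, of z] that by (simp add: norm_eq_sqrt_inner)
  then show ?thesis unfolding ball_inversion_def[abs_def] by (intro continuous_intros) auto
qed

text \<open>For a = z - c and b = w - c one has |a/|a|^2 - b/|b|^2|^2 = |a - b|^2 / (|a|^2 |b|^2).
  Numerator and denominator in \<open>ball_hdist\<close> therefore pick up the same factor.\<close>

lemma ball_inversion_hdist:
  assumes c: "1 < c \<bullet> c" and z: "z \<in> ball 0 1" and w: "w \<in> ball 0 1"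
  shows "ball_hdist (ball_inversion c z) (ball_inversion c w) = ball_hdist z w"
proof -
  define k where "k = c \<bullet> c - 1"
  define a where "a = z - c"
  define b where "b = w - c"
  define s where "s = a \<bullet> a"
  define t where "t = b \<bullet> b"
  have le: "z \<bullet> z \<le> 1" "w \<bullet> w \<le> 1" using inner_self_lt_1 z w by (auto intro: less_imp_le)
  have s: "0 < s" and t: "0 < t"
    using ball_inversion_center_dist[OF c] le by (simp_all add: s_def t_def a_def b_def)
  have k: "0 < k" using c by (simp add: k_def)
  have "ball_inversion c z - ball_inversion c w = k *\<^sub>R ((1 / s) *\<^sub>R a - (1 / t) *\<^sub>R b)"
    by (simp add: ball_inversion_def k_def s_def t_def a_def b_def scaleR_diff_right)
  then have "(norm (ball_inversion c z - ball_inversion c w))\<^sup>2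
    = k\<^sup>2 * (((1 / s) *\<^sub>R a - (1 / t) *\<^sub>R b) \<bullet> ((1 / s) *\<^sub>R a - (1 / t) *\<^sub>R b))"
    by (simp add: power_mult_distrib power2_norm_eq_inner)
  also have "((1 / s) *\<^sub>R a - (1 / t) *\<^sub>R b) \<bullet> ((1 / s) *\<^sub>R a - (1 / t) *\<^sub>R b)
    = 1 / s - 2 * (a \<bullet> b) / (s * t) + 1 / t"
    using s t by (simp add: inner_diff_left inner_diff_right inner_commute[of b a]
        s_def[symmetric] t_def[symmetric] field_simps)
  also have "\<dots> = ((a - b) \<bullet> (a - b)) / (s * t)"
    using s t by (simp add: inner_diff_left inner_diff_right inner_commute[of b a]
        s_def[symmetric] t_def[symmetric] field_simps)
  also have "(a - b) \<bullet> (a - b) = (norm (z - w))\<^sup>2" by (simp add: a_def b_def power2_norm_eq_inner)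
  finally have d: "(norm (ball_inversion c z - ball_inversion c w))\<^sup>2
    = k\<^sup>2 * (norm (z - w))\<^sup>2 / (s * t)" by simp
  have "(1 - (norm (ball_inversion c z))\<^sup>2) * (1 - (norm (ball_inversion c w))\<^sup>2)
    = (k / s * (1 - (norm z)\<^sup>2)) * (k / t * (1 - (norm w)\<^sup>2))"
    using ball_inversion_norm[OF c le(1)] ball_inversion_norm[OF c le(2)]
    by (simp add: power2_norm_eq_inner k_def s_def t_def a_def b_def)
  also have "\<dots> = k\<^sup>2 / (s * t) * ((1 - (norm z)\<^sup>2) * (1 - (norm w)\<^sup>2))"
    by (simp add: power2_eq_square)
  finally have p: "(1 - (norm (ball_inversion c z))\<^sup>2) * (1 - (norm (ball_inversion c w))\<^sup>2)
    = k\<^sup>2 / (s * t) * ((1 - (norm z)\<^sup>2) * (1 - (norm w)\<^sup>2))" .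
  have x: "2 * (k\<^sup>2 * X / (s * t)) / (k\<^sup>2 / (s * t) * Y) = 2 * X / Y" for X Y
    using s t k by simp
  show ?thesis unfolding ball_hdist_def d p x ..
qed

lemma blapl_ball_inversion:
  assumes c: "1 < c \<bullet> c" and u: "blapl u g l"
  shows "\<exists>k. blapl (\<lambda>z. u (ball_inversion c z)) k (\<lambda>z. l (ball_inversion c z))"
proof -
  have "lapl (ball 0 1) (\<lambda>z. (1 - z \<bullet> z) / 2) uminus
    (\<lambda>z. u (c + ((c \<bullet> c - 1) / ((z - c) \<bullet> (z - c))) *\<^sub>R (z - c)))
    (\<lambda>z. ((c \<bullet> c - 1) / ((z - c) \<bullet> (z - c))) *\<^sub>R
      (g (c + ((c \<bullet> c - 1) / ((z - c) \<bullet> (z - c))) *\<^sub>R (z - c))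
        - (2 * ((z - c) \<bullet> g (c + ((c \<bullet> c - 1) / ((z - c) \<bullet> (z - c))) *\<^sub>R (z - c)))
           / ((z - c) \<bullet> (z - c))) *\<^sub>R (z - c)))
    (\<lambda>z. l (c + ((c \<bullet> c - 1) / ((z - c) \<bullet> (z - c))) *\<^sub>R (z - c)))"
  proof (rule lapl_inversion[OF u], unfold ball_inversion_def[symmetric])
    show "c \<notin> ball 0 1" using c inner_self_lt_1 by force
    fix z :: 'a assume z: "z \<in> ball 0 1"
    then have z1: "z \<bullet> z \<le> 1" using inner_self_lt_1 by (auto intro: less_imp_le)
    have s: "0 < (z - c) \<bullet> (z - c)" by (rule ball_inversion_center_dist[OF c z1])
    show "ball_inversion c z \<in> ball 0 1" by (rule ball_inversion_in(1)[OF c z])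
    show "(1 - ball_inversion c z \<bullet> ball_inversion c z) / 2
      = (c \<bullet> c - 1) / ((z - c) \<bullet> (z - c)) * ((1 - z \<bullet> z) / 2)"
      using ball_inversion_norm[OF c z1] by simp
    have "2 * ((1 - z \<bullet> z) / 2) - 2 * ((z - c) \<bullet> - z) = (z - c) \<bullet> (z - c) - (c \<bullet> c - 1)"
      by (simp add: inner_diff_left inner_diff_right inner_commute[of c z] diff_divide_distrib)
    note e = this
    have "- z + ((2 * ((1 - z \<bullet> z) / 2) - 2 * ((z - c) \<bullet> - z)) / ((z - c) \<bullet> (z - c))) *\<^sub>R (z - c)
      = - z + (1 - (c \<bullet> c - 1) / ((z - c) \<bullet> (z - c))) *\<^sub>R (z - c)"
      unfolding e using s by (simp add: diff_divide_distrib)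
    then show "- ball_inversion c z
      = - z + ((2 * ((1 - z \<bullet> z) / 2) - 2 * ((z - c) \<bullet> - z)) / ((z - c) \<bullet> (z - c))) *\<^sub>R (z - c)"
      by (simp add: ball_inversion_def scaleR_diff_left)
  qed
  then show ?thesis unfolding ball_inversion_def by blast
qed

lemma blapl_orthogonal:
  fixes Q :: "'a::euclidean_space \<Rightarrow> 'a"
  assumes "orthogonal_transformation Q" "blapl u g l"
  shows "blapl (\<lambda>z. u (Q z)) (\<lambda>z. inv Q (g (Q z))) (\<lambda>z. l (Q z))"
  by (rule lapl_orthogonal[OF assms(2,1)])
    (use assms(1) in \<open>auto simp: orthogonal_transformation_norm orthogonal_transformation_def linear_neg\<close>)

text \<open>The time coordinate and the coordinate along \<^term>\<open>e1\<close> in the hyperboloid model.\<close>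

definition hyp_T :: "'a::real_inner \<Rightarrow> real" where
  "hyp_T z = (1 + z \<bullet> z) / (1 - z \<bullet> z)"

definition hyp_q :: "'k::finite pt \<Rightarrow> real" where
  "hyp_q z = 2 * fst z / (1 - z \<bullet> z)"

lemma inner_pt: "z \<bullet> z = (fst z)\<^sup>2 + snd z \<bullet> snd z" for z :: "'k::finite pt"
  by (simp add: inner_prod_def power2_eq_square)

lemma hyp_T_plus_1: "z \<in> ball 0 1 \<Longrightarrow> hyp_T z + 1 = 2 / (1 - z \<bullet> z)"
  using inner_self_lt_1[of z] by (simp add: hyp_T_def field_simps)

lemma hyp_T_ge_1: "z \<in> ball 0 1 \<Longrightarrow> 1 \<le> hyp_T z"
  using inner_self_lt_1[of z] by (simp add: hyp_T_def field_simps)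

text \<open>On the hyperboloid the squared time coordinate is 1 plus the sum of the squared space
  coordinates, of which \<open>hyp_q\<close> is one.\<close>

lemma hyp_q_square_le:
  fixes z :: "'k::finite pt"
  assumes z: "z \<in> ball 0 1"
  shows "(hyp_q z)\<^sup>2 + 1 \<le> (hyp_T z)\<^sup>2"
proof -
  have r: "0 < 1 - z \<bullet> z" using inner_self_lt_1[OF z] by simp
  have "(2 * fst z)\<^sup>2 + (1 - z \<bullet> z)\<^sup>2 \<le> (1 + z \<bullet> z)\<^sup>2"
    using inner_ge_zero[of "snd z"] inner_pt[of z] by (simp add: power2_eq_square algebra_simps)
  then have "((2 * fst z)\<^sup>2 + (1 - z \<bullet> z)\<^sup>2) / (1 - z \<bullet> z)\<^sup>2 \<le> (1 + z \<bullet> z)\<^sup>2 / (1 - z \<bullet> z)\<^sup>2"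
    by (rule divide_right_mono) simp
  moreover have "(hyp_q z)\<^sup>2 + 1 = ((2 * fst z)\<^sup>2 + (1 - z \<bullet> z)\<^sup>2) / (1 - z \<bullet> z)\<^sup>2"
    using r by (simp add: hyp_q_def power_divide add_divide_distrib)
  moreover have "(hyp_T z)\<^sup>2 = (1 + z \<bullet> z)\<^sup>2 / (1 - z \<bullet> z)\<^sup>2"
    by (simp add: hyp_T_def power_divide)
  ultimately show ?thesis by simp
qed

lemma abs_hyp_q_le: "z \<in> ball 0 1 \<Longrightarrow> \<bar>hyp_q z\<bar> \<le> hyp_T z" for z :: "'k::finite pt"
  using hyp_q_square_le[of z] hyp_T_ge_1[of z] abs_le_square_iff[of "hyp_q z" "hyp_T z"] by simp

text \<open>\<open>fst z\<close> and 1 - |z|^2 are scaled by the same factor. Geometrically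
  \<open>hyp_q\<close> is sinh of the signed distance to \<open>P0\<close>, which reflections in
  hyperplanes orthogonal to \<open>P0\<close> preserve.\<close>

lemma hyp_q_ball_inversion:
  fixes c z :: "'k::finite pt"
  assumes c: "1 < c \<bullet> c" "fst c = 0" and z: "z \<in> ball 0 1"
  shows "hyp_q (ball_inversion c z) = hyp_q z"
proof -
  have z1: "z \<bullet> z \<le> 1" using inner_self_lt_1[OF z] by simp
  define \<rho> where "\<rho> = (c \<bullet> c - 1) / ((z - c) \<bullet> (z - c))"
  have "0 < \<rho>" unfolding \<rho>_def using ball_inversion_center_dist[OF c(1) z1] c by simp
  moreover have "fst (ball_inversion c z) = \<rho> * fst z"
    by (simp add: ball_inversion_def c(2) \<rho>_def)
  ultimately show ?thesis unfolding hyp_q_def ball_inversion_norm[OF c(1) z1] \<rho>_def[symmetric]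
    by simp
qed

text \<open>\<open>hyp_T\<close> is cosh of the distance to the origin, which an isometry changes by
  a bounded amount, hence \<open>hyp_T\<close> by a bounded factor. The reverse inequality is the
  first one at the reflected point.\<close>

lemma hyp_T_ball_inversion_le:
  assumes c: "1 < c \<bullet> c"
  shows "\<exists>M\<ge>1. \<forall>z\<in>ball 0 1. hyp_T (ball_inversion c z) \<le> M * hyp_T z \<and> hyp_T z \<le> M * hyp_T (ball_inversion c z)"
proof -
  define m where "m = (1 + norm c)\<^sup>2 / (c \<bullet> c - 1)"
  have m: "0 < m" using c by (auto simp: m_def intro!: divide_pos_pos zero_less_power add_pos_nonneg)
  define M where "M = max 1 (2 * m)"
  have le: "hyp_T (ball_inversion c z) \<le> M * hyp_T z" if z: "z \<in> ball 0 1" for z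
  proof -
    have z1: "z \<bullet> z \<le> 1" using inner_self_lt_1[OF z] by simp
    define s where "s = (z - c) \<bullet> (z - c)"
    have s0: "0 < s" using ball_inversion_center_dist[OF c z1] by (simp add: s_def)
    have "norm (z - c) \<le> 1 + norm c" using norm_triangle_ineq4[of z c] z by simp
    then have "(norm (z - c))\<^sup>2 \<le> (1 + norm c)\<^sup>2" by (intro power_mono) auto
    then have "s \<le> (1 + norm c)\<^sup>2" by (simp add: s_def power2_norm_eq_inner)
    then have sm: "s / (c \<bullet> c - 1) \<le> m" unfolding m_def using c by (intro divide_right_mono) simp_all
    have "hyp_T (ball_inversion c z) + 1 = s / (c \<bullet> c - 1) * (2 / (1 - z \<bullet> z))"
      unfolding hyp_T_plus_1[OF ball_inversion_in(1)[OF c z]] ball_inversion_norm[OF c z1]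
      using s0 by (simp add: s_def)
    also have "\<dots> = s / (c \<bullet> c - 1) * (hyp_T z + 1)" unfolding hyp_T_plus_1[OF z] ..
    also have "\<dots> \<le> m * (2 * hyp_T z)"
      using sm m hyp_T_ge_1[OF z] by (intro mult_mono) auto
    also have "\<dots> \<le> M * hyp_T z"
      using hyp_T_ge_1[OF z] mult_right_mono[of "2 * m" M "hyp_T z"] by (simp add: M_def mult_ac)
    finally show ?thesis by simp
  qed
  have "hyp_T z \<le> M * hyp_T (ball_inversion c z)" if z: "z \<in> ball 0 1" for z
    using le[OF ball_inversion_in(1)[OF c z]] ball_inversion_involution[OF c, of z]
      inner_self_lt_1[OF z] by simp
  then show ?thesis using le by (intro exI[of _ M]) (auto simp: M_def)
qed

text \<open>Hyperbolic translation along the geodesic with endpoints \<open>- e1\<close> and \<^term>\<open>e1\<close>, which moves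
  the origin to \<open>\<mu> e1\<close>.\<close>

definition translate_e1 :: "real \<Rightarrow> 'k::finite pt \<Rightarrow> 'k pt" where
  "translate_e1 \<mu> z = (1 / (1 + 2 * \<mu> * fst z + \<mu>\<^sup>2 * (z \<bullet> z))) *\<^sub>R
     ((1 - \<mu>\<^sup>2) *\<^sub>R z + (2 * \<mu>\<^sup>2 * fst z + \<mu> * (1 + z \<bullet> z)) *\<^sub>R e1)"

definition reflect_fst :: "'k::finite pt \<Rightarrow> 'k pt" where
  "reflect_fst z = (- fst z, snd z)"

lemma reflect_fst_orthogonal: "orthogonal_transformation (reflect_fst :: 'k::finite pt \<Rightarrow> 'k pt)"
  unfolding orthogonal_transformation_def
  by (auto simp: reflect_fst_def inner_prod_def intro!: linearI)

lemma translate_e1_denom_pos: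
  fixes z :: "'k::finite pt"
  assumes \<mu>: "0 \<le> \<mu>" "\<mu> < 1" and z: "z \<in> ball 0 1"
  shows "0 < 1 + 2 * \<mu> * fst z + \<mu>\<^sup>2 * (z \<bullet> z)"
proof -
  have e: "1 + 2 * \<mu> * fst z + \<mu>\<^sup>2 * (z \<bullet> z) = (\<mu> *\<^sub>R z + e1) \<bullet> (\<mu> *\<^sub>R z + e1)"
    by (simp add: inner_add_left inner_add_right power2_eq_square algebra_simps)
  have "norm (\<mu> *\<^sub>R z) < norm (- e1 :: 'k pt)"
    using \<mu> z mult_left_le_one_le[of "norm z" \<mu>] by (simp add: e1_def norm_Pair)
  moreover have "norm a < norm b \<Longrightarrow> a \<noteq> b" for a b :: "'k pt" by auto
  ultimately have "\<mu> *\<^sub>R z \<noteq> - e1" by blast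
  then show ?thesis unfolding e by (simp add: eq_neg_iff_add_eq_0)
qed

text \<open>A translation is a product of two reflections, here in \<open>P0\<close> and in the
  sphere about \<open>(1 / \<mu>) *\<^sub>R e1\<close>, so the invariance of the Laplacian is
  inherited. The explicit formula is kept as the definition because it still makes sense at \<mu> =
  0, where that centre escapes to infinity.\<close>

lemma translate_e1_eq_inversion:
  fixes z :: "'k::finite pt"
  assumes \<mu>: "0 < \<mu>" "\<mu> < 1" and z: "z \<in> ball 0 1"
  shows "ball_inversion ((1 / \<mu>) *\<^sub>R e1) (reflect_fst z) = translate_e1 \<mu> z"
proof -
  define D where "D = 1 + 2 * \<mu> * fst z + \<mu>\<^sup>2 * (z \<bullet> z)"
  have D: "0 < D" unfolding D_def by (rule translate_e1_denom_pos) (use \<mu> z in auto)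
  define c :: "'k pt" where "c = (1 / \<mu>) *\<^sub>R e1"
  have cc: "c \<bullet> c - 1 = (1 - \<mu>\<^sup>2) / \<mu>\<^sup>2"
    using \<mu> by (simp add: c_def field_simps power2_eq_square)
  have "(reflect_fst z - c) \<bullet> (reflect_fst z - c) = z \<bullet> z + 2 * fst z / \<mu> + 1 / \<mu>\<^sup>2"
    by (simp add: inner_prod_def reflect_fst_def c_def algebra_simps power2_eq_square)
  also have "\<dots> = D / \<mu>\<^sup>2" using \<mu> by (simp add: D_def field_simps power2_eq_square)
  finally have s: "(reflect_fst z - c) \<bullet> (reflect_fst z - c) = D / \<mu>\<^sup>2" .
  have r: "(c \<bullet> c - 1) / ((reflect_fst z - c) \<bullet> (reflect_fst z - c)) = (1 - \<mu>\<^sup>2) / D"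
    unfolding s cc using \<mu> by simp
  have f: "1 / \<mu> + (1 - \<mu>\<^sup>2) / D * (- x - 1 / \<mu>) = 1 / D * ((1 - \<mu>\<^sup>2) * x + (2 * \<mu>\<^sup>2 * x + \<mu> * (1 + z \<bullet> z)))"
    if "x = fst z" for x
  proof -
    have "\<mu> * (1 / \<mu> + (1 - \<mu>\<^sup>2) / D * (- x - 1 / \<mu>)) * D = D - (1 - \<mu>\<^sup>2) * (\<mu> * x + 1)"
      using \<mu> D by (simp add: field_simps)
    also have "\<dots> = \<mu> * ((1 - \<mu>\<^sup>2) * x + (2 * \<mu>\<^sup>2 * x + \<mu> * (1 + z \<bullet> z)))"
      unfolding that by (simp add: D_def algebra_simps power2_eq_square)
    finally have "(1 / \<mu> + (1 - \<mu>\<^sup>2) / D * (- x - 1 / \<mu>)) * D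
      = (1 - \<mu>\<^sup>2) * x + (2 * \<mu>\<^sup>2 * x + \<mu> * (1 + z \<bullet> z))"
      using \<mu> by (simp only: mult.assoc mult_cancel_left) simp
    then show ?thesis using D by (simp add: eq_divide_eq)
  qed
  have "fst (ball_inversion c (reflect_fst z)) = fst (translate_e1 \<mu> z)"
    using f[OF refl] unfolding ball_inversion_def r translate_e1_def D_def[symmetric]
    by (simp add: c_def reflect_fst_def)
  moreover have "snd (ball_inversion c (reflect_fst z)) = snd (translate_e1 \<mu> z)"
    unfolding ball_inversion_def r translate_e1_def D_def[symmetric]
    by (simp add: c_def reflect_fst_def)
  ultimately show ?thesis unfolding c_def by (rule prod_eqI)
qed

text \<open>A Lorentz boost in the hyperboloid coordinates: the coefficients are cosh t and sinh t
  with \<mu> = tanh(t/2).\<close>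

lemma translate_e1_facts:
  fixes z :: "'k::finite pt"
  assumes \<mu>: "0 < \<mu>" "\<mu> < 1" and z: "z \<in> ball 0 1"
  shows "translate_e1 \<mu> z \<in> ball 0 1"
    and "hyp_T (translate_e1 \<mu> z) = (1 + \<mu>\<^sup>2) / (1 - \<mu>\<^sup>2) * hyp_T z + 2 * \<mu> / (1 - \<mu>\<^sup>2) * hyp_q z"
    and "hyp_q (translate_e1 \<mu> z) = (1 + \<mu>\<^sup>2) / (1 - \<mu>\<^sup>2) * hyp_q z + 2 * \<mu> / (1 - \<mu>\<^sup>2) * hyp_T z"
proof -
  define D where "D = 1 + 2 * \<mu> * fst z + \<mu>\<^sup>2 * (z \<bullet> z)"
  have D: "0 < D" unfolding D_def by (rule translate_e1_denom_pos) (use \<mu> z in auto)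
  define c :: "'k pt" where "c = (1 / \<mu>) *\<^sub>R e1"
  have \<mu>2: "\<mu>\<^sup>2 < 1" using \<mu> by (simp add: abs_square_less_1)
  have c: "1 < c \<bullet> c" using \<mu> \<mu>2 by (simp add: c_def field_simps power2_eq_square)
  have Rz: "reflect_fst z \<bullet> reflect_fst z = z \<bullet> z"
    by (simp add: reflect_fst_def inner_prod_def)
  have Rb: "reflect_fst z \<in> ball 0 1" using z Rz by (simp add: norm_eq_sqrt_inner)
  note eq = translate_e1_eq_inversion[OF assms, folded c_def, symmetric]
  show "translate_e1 \<mu> z \<in> ball 0 1" unfolding eq by (rule ball_inversion_in(1)[OF c Rb])
  have r: "0 < 1 - z \<bullet> z" using inner_self_lt_1[OF z] by simp
  have cc: "c \<bullet> c - 1 = (1 - \<mu>\<^sup>2) / \<mu>\<^sup>2"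
    using \<mu> by (simp add: c_def field_simps power2_eq_square)
  have "(reflect_fst z - c) \<bullet> (reflect_fst z - c) = z \<bullet> z + 2 * fst z / \<mu> + 1 / \<mu>\<^sup>2"
    by (simp add: inner_prod_def reflect_fst_def c_def algebra_simps power2_eq_square)
  also have "\<dots> = D / \<mu>\<^sup>2" using \<mu> by (simp add: D_def field_simps power2_eq_square)
  finally have s: "(c \<bullet> c - 1) / ((reflect_fst z - c) \<bullet> (reflect_fst z - c)) = (1 - \<mu>\<^sup>2) / D"
    unfolding cc using \<mu> by simp
  have n: "1 - translate_e1 \<mu> z \<bullet> translate_e1 \<mu> z = (1 - \<mu>\<^sup>2) / D * (1 - z \<bullet> z)"
    unfolding eq using ball_inversion_norm[OF c, of "reflect_fst z"] Rz r s by simp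
  have "hyp_T (translate_e1 \<mu> z) = 2 / ((1 - \<mu>\<^sup>2) / D * (1 - z \<bullet> z)) - 1"
    using hyp_T_plus_1[OF \<open>translate_e1 \<mu> z \<in> ball 0 1\<close>] n by simp
  also have "\<dots> = (1 + \<mu>\<^sup>2) / (1 - \<mu>\<^sup>2) * hyp_T z + 2 * \<mu> / (1 - \<mu>\<^sup>2) * hyp_q z"
    using r \<mu>2 by (simp add: hyp_T_def hyp_q_def D_def divide_simps) (simp add: algebra_simps)
  finally show "hyp_T (translate_e1 \<mu> z) = (1 + \<mu>\<^sup>2) / (1 - \<mu>\<^sup>2) * hyp_T z + 2 * \<mu> / (1 - \<mu>\<^sup>2) * hyp_q z" .
  have "fst (translate_e1 \<mu> z) = ((1 + \<mu>\<^sup>2) * fst z + \<mu> * (1 + z \<bullet> z)) / D"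
    unfolding translate_e1_def D_def[symmetric] by (simp add: algebra_simps add_divide_distrib)
  then have "hyp_q (translate_e1 \<mu> z) = 2 * ((1 + \<mu>\<^sup>2) * fst z + \<mu> * (1 + z \<bullet> z)) / ((1 - \<mu>\<^sup>2) * (1 - z \<bullet> z))"
    unfolding hyp_q_def n using D by simp
  also have "\<dots> = (1 + \<mu>\<^sup>2) / (1 - \<mu>\<^sup>2) * hyp_q z + 2 * \<mu> / (1 - \<mu>\<^sup>2) * hyp_T z"
    using r \<mu>2 by (simp add: hyp_T_def hyp_q_def divide_simps)
  finally show "hyp_q (translate_e1 \<mu> z) = (1 + \<mu>\<^sup>2) / (1 - \<mu>\<^sup>2) * hyp_q z + 2 * \<mu> / (1 - \<mu>\<^sup>2) * hyp_T z" .
qed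

lemma blapl_translate_e1:
  fixes u :: "'k::finite pt \<Rightarrow> real"
  assumes \<mu>: "0 < \<mu>" "\<mu> < 1" and u: "blapl u g l"
  shows "\<exists>k. blapl (\<lambda>z. u (translate_e1 \<mu> z)) k (\<lambda>z. l (translate_e1 \<mu> z))"
proof -
  define c :: "'k pt" where "c = (1 / \<mu>) *\<^sub>R e1"
  have "\<mu>\<^sup>2 < 1" using \<mu> by (simp add: abs_square_less_1)
  then have c: "1 < c \<bullet> c" using \<mu> by (simp add: c_def field_simps power2_eq_square)
  have eq: "ball_inversion c (reflect_fst z) = translate_e1 \<mu> z" if "z \<in> ball 0 1" for z
    unfolding c_def by (rule translate_e1_eq_inversion[OF \<mu> that])
  obtain k where "blapl (\<lambda>z. u (ball_inversion c z)) k (\<lambda>z. l (ball_inversion c z))"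
    using blapl_ball_inversion[OF c u] by blast
  from blapl_orthogonal[OF reflect_fst_orthogonal this]
  have "blapl (\<lambda>z. u (translate_e1 \<mu> z)) (\<lambda>z. inv reflect_fst (k (reflect_fst z)))
      (\<lambda>z. l (ball_inversion c (reflect_fst z)))"
    by (rule lapl_transform[OF _ open_ball]) (simp only: eq)
  then have "blapl (\<lambda>z. u (translate_e1 \<mu> z)) (\<lambda>z. inv reflect_fst (k (reflect_fst z)))
      (\<lambda>z. l (translate_e1 \<mu> z))"
    by (rule lapl_cong) (simp only: eq)
  then show ?thesis by blast
qed

text \<open>The witness is the projection to the ball of the hyperboloid point with time t and
  coordinate \<theta> t along the axis; y takes up what the equation of the hyperboloid
  leaves.\<close>

lemma ex_hyp_point:
  assumes \<theta>: "\<bar>\<theta>\<bar> < 1"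
  shows "\<exists>z::'k::finite pt\<in>ball 0 1. T0 \<le> hyp_T z \<and> hyp_q z = \<theta> * hyp_T z"
proof -
  \<comment> \<open>With t \<ge> 1 and t \<ge> 1/(1 - \<theta>^2) one gets t^2 (1 - \<theta>^2)
    \<ge> 1, so |y|^2 comes out nonnegative.\<close>
  define t where "t = max T0 (1 / (1 - \<theta>\<^sup>2))"
  have \<theta>2: "\<theta>\<^sup>2 < 1" using \<theta> by (simp add: abs_square_less_1)
  have t1: "1 \<le> 1 / (1 - \<theta>\<^sup>2)" using \<theta>2 by simp
  have t: "T0 \<le> t" "1 / (1 - \<theta>\<^sup>2) \<le> t" "1 \<le> t" using t1 by (auto simp: t_def)
  have "1 \<le> t * (1 - \<theta>\<^sup>2)" using t(2) \<theta>2 by (simp add: pos_divide_le_eq)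
  then have "1 * 1 \<le> t * (t * (1 - \<theta>\<^sup>2))" using t(3) by (intro mult_mono) auto
  then have p: "0 \<le> t\<^sup>2 - 1 - \<theta>\<^sup>2 * t\<^sup>2" by (simp add: algebra_simps power2_eq_square)
  define y :: "real^'k" where "y = sqrt (t\<^sup>2 - 1 - \<theta>\<^sup>2 * t\<^sup>2) *\<^sub>R axis undefined 1"
  have y: "y \<bullet> y = t\<^sup>2 - 1 - \<theta>\<^sup>2 * t\<^sup>2" using p by (simp add: y_def inner_axis_axis)
  define z :: "'k pt" where "z = (1 / (1 + t)) *\<^sub>R (\<theta> * t, y)"
  have "z \<bullet> z = (1 / (1 + t))\<^sup>2 * ((\<theta> * t)\<^sup>2 + y \<bullet> y)"
    by (simp add: z_def inner_prod_def power2_eq_square algebra_simps add_divide_distrib)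
  also have "(\<theta> * t)\<^sup>2 + y \<bullet> y = t\<^sup>2 - 1" by (simp add: y power_mult_distrib)
  also have "(1 / (1 + t))\<^sup>2 * (t\<^sup>2 - 1) = (t - 1) / (t + 1)" using t(3)
    by (simp add: power_divide divide_simps) (simp add: algebra_simps power2_eq_square)
  finally have zz: "z \<bullet> z = (t - 1) / (t + 1)" .
  then have "z \<bullet> z < 1" using t(3) by simp
  then have "z \<in> ball 0 1" by (simp add: norm_eq_sqrt_inner)
  moreover have r: "1 - z \<bullet> z = 2 / (t + 1)" "1 + z \<bullet> z = 2 * t / (t + 1)"
    unfolding zz using t(3) by (simp_all add: field_simps)
  have "hyp_T z = t" unfolding hyp_T_def r using t(3) by simp
  moreover have "hyp_q z = \<theta> * t" unfolding hyp_q_def r using t(3) by (simp add: z_def add.commute)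
  ultimately show ?thesis using t(1) by auto
qed

section \<open>The sliding method\<close>

lemma translate_e1_0: "translate_e1 0 z = z"
  by (simp add: translate_e1_def)

lemma translate_e1_continuous:
  "continuous_on ({0..<1} \<times> ball 0 1) (\<lambda>(\<mu>, z :: 'k::finite pt). translate_e1 \<mu> z)"
  unfolding translate_e1_def[abs_def] case_prod_unfold
  by (intro continuous_intros) (force dest: translate_e1_denom_pos simp del: mem_ball_0)

lemma translate_e1_in_ball:
  "0 \<le> \<mu> \<Longrightarrow> \<mu> < 1 \<Longrightarrow> z \<in> ball 0 1 \<Longrightarrow> translate_e1 \<mu> z \<in> ball 0 1"
  using translate_e1_facts(1)[of \<mu> z] translate_e1_0[of z] by (cases "\<mu> = 0") auto

text \<open>Convergence on compact parts of the two open boundary hemispheres, expressed in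
  coordinates that translations transform linearly: as \<open>hyp_T\<close> tends to infinity, the
  ratio of \<open>hyp_q\<close> to \<open>hyp_T\<close> approaches the coordinate \<open>fst\<close>
  of the boundary point.\<close>

locale layer_solution = double_well_solution F f f' u g
  for F f f' and u :: "'k::finite pt \<Rightarrow> real" and g +
  assumes to_plus: "\<And>\<theta> \<epsilon>. 0 < \<theta> \<Longrightarrow> 0 < \<epsilon> \<Longrightarrow>
      \<exists>T0. \<forall>z\<in>ball 0 1. T0 \<le> hyp_T z \<longrightarrow> \<theta> * hyp_T z \<le> hyp_q z \<longrightarrow> \<bar>u z - 1\<bar> < \<epsilon>"
    and to_minus: "\<And>\<theta> \<epsilon>. 0 < \<theta> \<Longrightarrow> 0 < \<epsilon> \<Longrightarrow>
      \<exists>T0. \<forall>z\<in>ball 0 1. T0 \<le> hyp_T z \<longrightarrow> hyp_q z \<le> - \<theta> * hyp_T z \<longrightarrow> \<bar>u z + 1\<bar> < \<epsilon>"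
begin

lemma less_1:
  assumes z: "z \<in> ball 0 1"
  shows "u z < 1"
proof (rule ccontr)
  assume "\<not> u z < 1"
  then have uz: "u z = 1" using le_1[OF z] by simp
  obtain T0 where T0: "\<And>z. z \<in> ball 0 1 \<Longrightarrow> T0 \<le> hyp_T z \<Longrightarrow> hyp_q z \<le> - (1/2) * hyp_T z \<Longrightarrow> \<bar>u z + 1\<bar> < 1"
    using to_minus[OF half_gt_zero[OF zero_less_one] zero_less_one] by blast
  obtain y :: "'k pt" where y: "y \<in> ball 0 1" "T0 \<le> hyp_T y" "hyp_q y = - (1/2) * hyp_T y"
    using ex_hyp_point[of "- (1/2)" T0] by auto
  have "\<bar>u y + 1\<bar> < 1" using T0[OF y(1,2)] y(3) by simp
  moreover have "u y = 1" by (rule eq_1_if_touches_1[OF z uz y(1)])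
  ultimately show False by simp
qed

text \<open>As a \<le> b, the condition on \<open>a\<close> alone puts both values near 1 and the
  condition on \<open>b\<close> alone puts both near -1. In the sliding argument only one of the two
  compared values is known to be near its well.\<close>

lemma f_monotone_near_wells:
  "\<exists>\<epsilon> c. 0 < \<epsilon> \<and> \<epsilon> < 1 \<and> 0 < c \<and>
    (\<forall>a b. \<bar>a\<bar> \<le> 1 \<longrightarrow> \<bar>b\<bar> \<le> 1 \<longrightarrow> a \<le> b \<longrightarrow> 1 - \<epsilon> \<le> a \<or> b \<le> -1 + \<epsilon> \<longrightarrow> f a - f b \<le> c * (a - b))"
proof -
  interpret r: double_well "\<lambda>s. F (- s)" "\<lambda>s. - f (- s)" "\<lambda>s. f' (- s)" by (rule reflect)
  obtain \<epsilon>1 c1 where 1: "0 < \<epsilon>1" "\<epsilon>1 < 1" "0 < c1"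
    "\<And>a b. 1 - \<epsilon>1 \<le> a \<Longrightarrow> a \<le> b \<Longrightarrow> b \<le> 1 \<Longrightarrow> f a - f b \<le> c1 * (a - b)"
    using f_monotone_near_1 by blast
  obtain \<epsilon>2 c2 where 2: "0 < \<epsilon>2" "\<epsilon>2 < 1" "0 < c2"
    "\<And>a b. 1 - \<epsilon>2 \<le> a \<Longrightarrow> a \<le> b \<Longrightarrow> b \<le> 1 \<Longrightarrow> - f (- a) - - f (- b) \<le> c2 * (a - b)"
    using r.f_monotone_near_1 by blast
  show ?thesis
  proof (rule exI[of _ "min \<epsilon>1 \<epsilon>2"], rule exI[of _ "min c1 c2"], intro conjI allI impI)
    fix a b assume ab: "\<bar>a\<bar> \<le> 1" "\<bar>b\<bar> \<le> 1" "a \<le> b" "1 - min \<epsilon>1 \<epsilon>2 \<le> a \<or> b \<le> - 1 + min \<epsilon>1 \<epsilon>2"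
    have m: "c1 * (a - b) \<le> min c1 c2 * (a - b)" "c2 * (a - b) \<le> min c1 c2 * (a - b)"
      using ab(3) by (intro mult_right_mono_neg; simp)+
    from ab(4) show "f a - f b \<le> min c1 c2 * (a - b)"
    proof
      assume "1 - min \<epsilon>1 \<epsilon>2 \<le> a"
      then have "f a - f b \<le> c1 * (a - b)" using ab by (intro 1(4)) auto
      then show ?thesis using m by simp
    next
      assume "b \<le> - 1 + min \<epsilon>1 \<epsilon>2"
      then have "- f (- (- b)) - - f (- (- a)) \<le> c2 * (- b - - a)" using ab by (intro 2(4)) auto
      then show ?thesis using m by simp
    qed
  qed (use 1 2 in auto)
qed

end

text \<open>With \<mu> = tanh(t/2), C = cosh t and S = sinh t one has \<mu> C \<le> S \<le> C. Hence
  a point with q \<ge> - r T is moved to one with q' \<ge> (\<mu> - r) C T and T' \<le> 2 C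
  T.\<close>

lemma translate_e1_ratio:
  fixes y :: "'k::finite pt"
  assumes \<mu>: "0 < \<mu>" "\<mu> < 1" and y: "y \<in> ball 0 1" and r: "0 \<le> r" "- r * hyp_T y \<le> hyp_q y"
    and \<delta>: "0 \<le> \<delta>" "r + \<delta> \<le> \<mu>"
  shows "\<delta> / 2 * hyp_T (translate_e1 \<mu> y) \<le> hyp_q (translate_e1 \<mu> y)"
    and "\<delta> / (1 - \<mu>\<^sup>2) * hyp_T y \<le> hyp_T (translate_e1 \<mu> y)"
proof -
  define C where "C = (1 + \<mu>\<^sup>2) / (1 - \<mu>\<^sup>2)"
  define S where "S = 2 * \<mu> / (1 - \<mu>\<^sup>2)"
  have \<mu>2: "0 < 1 - \<mu>\<^sup>2" using \<mu> by (simp add: abs_square_less_1)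
  have C: "0 < C" "1 / (1 - \<mu>\<^sup>2) \<le> C" using \<mu>2
    by (auto simp: C_def intro!: divide_right_mono divide_pos_pos add_pos_nonneg simp del: zero_less_divide_iff)
  have SC: "\<mu> * C \<le> S" "S \<le> C"
  proof -
    have "\<mu> * (1 + \<mu>\<^sup>2) \<le> \<mu> * 2" using \<mu> \<mu>2 by (intro mult_left_mono) auto
    then show "\<mu> * C \<le> S" unfolding C_def S_def times_divide_eq_right
      using \<mu>2 by (intro divide_right_mono) auto
    have "0 \<le> (1 - \<mu>)\<^sup>2" by simp
    then have "2 * \<mu> \<le> 1 + \<mu>\<^sup>2" by (simp add: power2_eq_square algebra_simps)
    then show "S \<le> C" unfolding C_def S_def using \<mu>2 by (intro divide_right_mono) auto
  qed
  have T1: "1 \<le> hyp_T y" by (rule hyp_T_ge_1[OF y])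
  have q: "\<bar>hyp_q y\<bar> \<le> hyp_T y" by (rule abs_hyp_q_le[OF y])
  note facts = translate_e1_facts(2,3)[OF \<mu> y, folded C_def S_def]
  have "C * (- r * hyp_T y) \<le> C * hyp_q y" using r C by (intro mult_left_mono) auto
  moreover have "\<mu> * C * hyp_T y \<le> S * hyp_T y" using SC T1 by (intro mult_right_mono) auto
  moreover have "C * hyp_T y * (r + \<delta>) \<le> C * hyp_T y * \<mu>"
    using \<delta> C T1 by (intro mult_left_mono) auto
  ultimately have 1: "\<delta> * (C * hyp_T y) \<le> hyp_q (translate_e1 \<mu> y)"
    unfolding facts by (simp add: algebra_simps)
  have "S * hyp_q y \<le> C * hyp_T y" using SC q C \<mu> \<mu>2
    by (intro order_trans[OF mult_left_mono mult_right_mono]) (auto simp: S_def abs_le_iff)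
  then have "hyp_T (translate_e1 \<mu> y) \<le> 2 * (C * hyp_T y)" unfolding facts by simp
  then have "\<delta> / 2 * hyp_T (translate_e1 \<mu> y) \<le> \<delta> / 2 * (2 * (C * hyp_T y))"
    using \<delta> by (intro mult_left_mono) auto
  then show "\<delta> / 2 * hyp_T (translate_e1 \<mu> y) \<le> hyp_q (translate_e1 \<mu> y)" using 1 by simp
  have "\<delta> * (1 / (1 - \<mu>\<^sup>2) * hyp_T y) \<le> \<delta> * (C * hyp_T y)"
    using C \<delta> T1 by (intro mult_left_mono mult_right_mono) auto
  also note 1
  also have "hyp_q (translate_e1 \<mu> y) \<le> hyp_T (translate_e1 \<mu> y)"
    using abs_hyp_q_le[OF translate_e1_facts(1)[OF \<mu> y]] by simp
  finally show "\<delta> / (1 - \<mu>\<^sup>2) * hyp_T y \<le> hyp_T (translate_e1 \<mu> y)" by simp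
qed

context layer_solution
begin

text \<open>The parameter \<mu> descends from a value near 1 to \<open>\<mu>0\<close>, and
  \<open>W\<close> has to stay nonnegative. Its sign on a compact ball decides its sign everywhere
  (\<open>extend\<close>), so a first contact would occur on that ball, where the strong maximum
  principle excludes it.\<close>

lemma sliding:
  fixes c :: "'k pt"
  assumes c: "1 < c \<bullet> c" "fst c = 0" and \<mu>0: "0 < \<mu>0" "\<mu>0 < 1" and z0: "z0 \<in> ball 0 1"
  shows "u z0 \<le> u (translate_e1 \<mu>0 (ball_inversion c z0))"
proof -
  define h where "h = ball_inversion c"
  have hB: "h z \<in> ball 0 1" if "z \<in> ball 0 1" for z
    unfolding h_def by (rule ball_inversion_in(1)[OF c(1) that])
  have hq: "hyp_q (h z) = hyp_q z" if "z \<in> ball 0 1" for z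
    unfolding h_def by (rule hyp_q_ball_inversion[OF c that])
  obtain M where M: "1 \<le> M" "\<And>z. z \<in> ball 0 1 \<Longrightarrow> hyp_T (h z) \<le> M * hyp_T z"
    "\<And>z. z \<in> ball 0 1 \<Longrightarrow> hyp_T z \<le> M * hyp_T (h z)"
    using hyp_T_ball_inversion_le[OF c(1)] unfolding h_def by blast
  obtain \<epsilon> \<kappa> where \<epsilon>: "0 < \<epsilon>" "\<epsilon> < 1" "0 < \<kappa>"
    "\<And>a b. \<bar>a\<bar> \<le> 1 \<Longrightarrow> \<bar>b\<bar> \<le> 1 \<Longrightarrow> a \<le> b \<Longrightarrow> 1 - \<epsilon> \<le> a \<or> b \<le> -1 + \<epsilon> \<Longrightarrow> f a - f b \<le> \<kappa> * (a - b)"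
    using f_monotone_near_wells by blast
  \<comment> \<open>\<open>M\<close> is the distortion of \<open>hyp_T\<close> under h. A point with
    q \<ge> - \<theta> T is sent by h to one with q \<ge> - (\<mu>0/2) T, and a translation by \<mu>
    \<ge> \<mu>0 lifts this to q \<ge> (\<mu>0/4) T.\<close>
  define \<theta> where "\<theta> = \<mu>0 / (2 * M)"
  have \<theta>: "0 < \<theta>" "\<theta> < 1" "\<theta> * M = \<mu>0 / 2" using \<mu>0 M(1) by (auto simp: \<theta>_def field_simps)
  obtain Tp where Tp: "\<And>z. z \<in> ball 0 1 \<Longrightarrow> Tp \<le> hyp_T z \<Longrightarrow> \<mu>0 / 2 / 2 * hyp_T z \<le> hyp_q z \<Longrightarrow> \<bar>u z - 1\<bar> < \<epsilon>"
    using to_plus[OF half_gt_zero[OF half_gt_zero[OF \<mu>0(1)]] \<epsilon>(1)] by blast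
  obtain Tm where Tm: "\<And>z. z \<in> ball 0 1 \<Longrightarrow> Tm \<le> hyp_T z \<Longrightarrow> hyp_q z \<le> - \<theta> * hyp_T z \<Longrightarrow> \<bar>u z + 1\<bar> < \<epsilon>"
    using to_minus[OF \<theta>(1) \<epsilon>(1)] by blast
  \<comment> \<open>Beyond this level both asymptotic statements apply: \<open>Tm\<close> to the
    point itself, and the last entry ensures \<open>Tp\<close> at its image under h and the
    translation.\<close>
  define T1 where "T1 = max 1 (max Tm (2 * M * \<bar>Tp\<bar> / \<mu>0))"
  define W where "W \<mu> z = u (translate_e1 \<mu> (h z)) - u z" for \<mu> z
  have far_plus: "1 - \<epsilon> < u (translate_e1 \<mu> (h z))"
    if \<mu>: "\<mu>0 \<le> \<mu>" "\<mu> < 1" and z: "z \<in> ball 0 1" "T1 \<le> hyp_T z" "- \<theta> * hyp_T z \<le> hyp_q z" for \<mu> z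
  proof -
    have \<mu>p: "0 < \<mu>" using \<mu> \<mu>0 by simp
    have "\<theta> * hyp_T z \<le> \<theta> * (M * hyp_T (h z))" using \<theta>(1) M(3)[OF z(1)] by simp
    also have "\<dots> = \<mu>0 / 2 * hyp_T (h z)" using \<theta>(3) by (simp add: mult.assoc[symmetric])
    finally have r: "- (\<mu>0 / 2) * hyp_T (h z) \<le> hyp_q (h z)" using z(3) hq[OF z(1)] by simp
    note ratio = translate_e1_ratio[OF \<mu>p \<mu>(2) hB[OF z(1)] _ r, of "\<mu>0 / 2"]
    have "2 * M * \<bar>Tp\<bar> / \<mu>0 \<le> M * hyp_T (h z)" using z(2) M(3)[OF z(1)] by (simp add: T1_def)
    then have "M * (2 * \<bar>Tp\<bar> / \<mu>0) \<le> M * hyp_T (h z)" by (simp add: mult_ac)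
    then have "2 * \<bar>Tp\<bar> / \<mu>0 \<le> hyp_T (h z)"
      by (rule mult_left_le_imp_le) (use M(1) in simp)
    then have "\<bar>Tp\<bar> \<le> \<mu>0 / 2 * hyp_T (h z)" using \<mu>0 by (simp add: field_simps)
    also have "\<dots> \<le> \<mu>0 / 2 / (1 - \<mu>\<^sup>2) * hyp_T (h z)"
    proof (rule mult_right_mono)
      have "0 < 1 - \<mu>\<^sup>2" "1 - \<mu>\<^sup>2 \<le> 1" using \<mu>p \<mu> by (auto simp: abs_square_less_1)
      then show "\<mu>0 / 2 \<le> \<mu>0 / 2 / (1 - \<mu>\<^sup>2)" using \<mu>0 by (simp add: pos_le_divide_eq)
      show "0 \<le> hyp_T (h z)" using hyp_T_ge_1[OF hB[OF z(1)]] by simp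
    qed
    also have "\<dots> \<le> hyp_T (translate_e1 \<mu> (h z))" using ratio(2) \<mu>0 \<mu> by simp
    finally have "Tp \<le> hyp_T (translate_e1 \<mu> (h z))" by simp
    then have "\<bar>u (translate_e1 \<mu> (h z)) - 1\<bar> < \<epsilon>"
      using ratio(1) \<mu>0 \<mu> by (intro Tp translate_e1_facts(1)[OF \<mu>p \<mu>(2) hB[OF z(1)]]) auto
    then show ?thesis by simp
  qed
  have far_minus: "u z < - 1 + \<epsilon>" if "z \<in> ball 0 1" "T1 \<le> hyp_T z" "hyp_q z \<le> - \<theta> * hyp_T z" for z
    using Tm[OF that(1) _ that(3)] that(2) by (auto simp: T1_def)
  \<comment> \<open>The Euclidean radius at which \<open>hyp_T\<close> equals
    \<open>T1\<close>.\<close>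
  define r1 where "r1 = sqrt ((T1 - 1) / (T1 + 1))"
  have T1: "1 \<le> T1" by (simp add: T1_def)
  have r1: "0 \<le> r1" "r1 < 1" using T1 by (auto simp: r1_def)
  have inK: "T1 \<le> hyp_T z" if z: "z \<in> ball 0 1" "z \<notin> cball 0 r1" for z
  proof -
    have "r1 < norm z" using z by simp
    then have "(T1 - 1) / (T1 + 1) < z \<bullet> z" by (simp add: r1_def norm_eq_sqrt_inner)
    then have "T1 - 1 < z \<bullet> z * (T1 + 1)" using T1 by (simp add: pos_divide_less_eq)
    then have "T1 * (1 - z \<bullet> z) \<le> 1 + z \<bullet> z" by (simp add: algebra_simps)
    then show ?thesis using inner_self_lt_1[OF z(1)] by (simp add: hyp_T_def pos_le_divide_eq)
  qed
  have KB: "cball 0 r1 \<subseteq> ball (0 :: 'k pt) 1" using r1 by auto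
  have W_sol: "\<exists>k. blapl (W \<mu>) k (\<lambda>z. f (u (translate_e1 \<mu> (h z))) - f (u z))"
    if \<mu>: "0 < \<mu>" "\<mu> < 1" for \<mu>
  proof -
    obtain k where "blapl (\<lambda>z. u (translate_e1 \<mu> z)) k (\<lambda>z. f (u (translate_e1 \<mu> z)))"
      using blapl_translate_e1[OF \<mu> sol] by blast
    then obtain k' where "blapl (\<lambda>z. u (translate_e1 \<mu> (h z))) k' (\<lambda>z. f (u (translate_e1 \<mu> (h z))))"
      using blapl_ball_inversion[OF c(1)] unfolding h_def by blast
    from lapl_diff[OF this sol] show ?thesis unfolding W_def[abs_def] by blast
  qed
  have abs1: "\<bar>u (translate_e1 \<mu> (h z))\<bar> \<le> 1" if "0 \<le> \<mu>" "\<mu> < 1" "z \<in> ball 0 1" for \<mu> z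
    using abs_le_1[OF translate_e1_in_ball[OF that(1,2) hB[OF that(3)]]] .
  \<comment> \<open>Outside the compact ball either the translated value is near 1 or the original
    one is near -1, so wherever W is negative the difference of the two values of f is bounded above
    by a negative multiple of the gap.\<close>
  have extend: "0 \<le> W \<mu> z" if \<mu>: "\<mu>0 \<le> \<mu>" "\<mu> < 1" and K: "\<And>z. z \<in> cball 0 r1 \<Longrightarrow> 0 \<le> W \<mu> z"
    and z: "z \<in> ball 0 1" for \<mu> z
  proof -
    have \<mu>p: "0 < \<mu>" using \<mu> \<mu>0 by simp
    obtain k where k: "blapl (W \<mu>) k (\<lambda>z. f (u (translate_e1 \<mu> (h z))) - f (u z))"
      using W_sol[OF \<mu>p \<mu>(2)] by blast
    show ?thesis
    proof (rule maximum_principle_at_infinity[OF k _ _ z, of 2])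
      fix z :: "'k pt" assume z: "z \<in> ball 0 1"
      show "- 2 \<le> W \<mu> z" using abs1[OF less_imp_le[OF \<mu>p] \<mu>(2) z] abs_le_1[OF z] by (simp add: W_def abs_le_iff)
    next
      fix \<delta> :: real assume \<delta>: "0 < \<delta>"
      have "f (u (translate_e1 \<mu> (h z))) - f (u z) \<le> - (\<kappa> * \<delta>)"
        if z: "z \<in> ball 0 1" "W \<mu> z < - \<delta>" for z
      proof -
        have "z \<notin> cball 0 r1" using K z(2) \<delta> by fastforce
        then have T: "T1 \<le> hyp_T z" by (rule inK[OF z(1)])
        have "1 - \<epsilon> < u (translate_e1 \<mu> (h z)) \<or> u z < - 1 + \<epsilon>"
          using far_plus[OF \<mu> z(1) T] far_minus[OF z(1) T] by linarith
        then have "f (u (translate_e1 \<mu> (h z))) - f (u z) \<le> \<kappa> * (u (translate_e1 \<mu> (h z)) - u z)"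
          using abs1[OF less_imp_le[OF \<mu>p] \<mu>(2) z(1)] abs_le_1[OF z(1)] z(2) \<delta>
          by (intro \<epsilon>(4)) (auto simp: W_def)
        also have "\<dots> \<le> \<kappa> * (- \<delta>)" using z(2) \<epsilon>(3) by (intro mult_left_mono) (auto simp: W_def)
        finally show ?thesis by simp
      qed
      then show "\<exists>\<kappa>>0. \<forall>z\<in>ball 0 1. W \<mu> z < - \<delta> \<longrightarrow> f (u (translate_e1 \<mu> (h z))) - f (u z) \<le> - \<kappa>"
        using \<delta> \<epsilon>(3) by (intro exI[of _ "\<kappa> * \<delta>"]) auto
    qed
  qed
  have cont_u: "continuous_on (ball 0 1) u" by (rule lapl_continuous_on[OF sol])
  \<comment> \<open>On the compact ball u stays below its maximum u p < 1. For \<mu> close to 1 the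
    translation carries the whole image of that ball under h into the region where u exceeds u
    p.\<close>
  have start: "\<exists>\<mu>1. \<mu>0 < \<mu>1 \<and> \<mu>1 < 1 \<and> (\<forall>z\<in>cball 0 r1. 0 < W \<mu>1 z)"
  proof -
    have "continuous_on (cball 0 r1) u" using cont_u KB continuous_on_subset by blast
    then obtain p where p: "p \<in> cball 0 r1" "\<And>z. z \<in> cball 0 r1 \<Longrightarrow> u z \<le> u p"
      using continuous_attains_sup[of "cball (0 :: 'k pt) r1" u] r1 by auto
    define \<epsilon>2 where "\<epsilon>2 = 1 - u p"
    have \<epsilon>2: "0 < \<epsilon>2" using less_1[of p] p(1) KB by (auto simp: \<epsilon>2_def)
    define B where "B = M * T1"
    have B: "1 \<le> B" using M(1) T1 mult_mono[of 1 M 1 T1] by (simp add: B_def)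
    \<comment> \<open>Since q^2 + 1 \<le> T^2, a bound T \<le> B confines the ratio |q|/T to at most
      sqrt(1 - 1/B^2).\<close>
    define r where "r = sqrt (1 - 1 / B\<^sup>2)"
    have B2: "1 \<le> B\<^sup>2" using B by simp
    have Bp: "0 < B\<^sup>2" using B by simp
    then have Bi: "1 / B\<^sup>2 \<le> 1" using B2 by (simp only: divide_le_eq_1_pos)
    have r: "0 \<le> r" "r < 1" using Bi Bp by (simp_all add: r_def)
    define \<delta> where "\<delta> = (1 - r) / 2"
    have \<delta>: "0 < \<delta>" using r by (simp add: \<delta>_def)
    obtain T2 where T2: "\<And>z. z \<in> ball 0 1 \<Longrightarrow> T2 \<le> hyp_T z \<Longrightarrow> \<delta> / 2 * hyp_T z \<le> hyp_q z \<Longrightarrow> \<bar>u z - 1\<bar> < \<epsilon>2"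
      using to_plus[OF half_gt_zero[OF \<delta>] \<epsilon>2] by blast
    define Y where "Y = \<bar>T2\<bar> / \<delta> + 1"
    have Y: "1 \<le> Y" using \<delta> by (simp add: Y_def)
    \<comment> \<open>The three entries give room \<delta> over the ratio r, force \<delta>/(1 -
      \<mu>^2) above \<open>T2\<close> so that the images lie far out, and exceed
      \<open>\<mu>0\<close>.\<close>
    define \<mu> where "\<mu> = max (max (r + \<delta>) (1 - 1 / (2 * Y))) ((1 + \<mu>0) / 2)"
    have \<mu>: "r + \<delta> \<le> \<mu>" "1 - 1 / (2 * Y) \<le> \<mu>" "\<mu>0 < \<mu>" "\<mu> < 1"
    proof -
      show "r + \<delta> \<le> \<mu>" "1 - 1 / (2 * Y) \<le> \<mu>" by (simp_all add: \<mu>_def)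
      have "(1 + \<mu>0) / 2 \<le> \<mu>" by (simp add: \<mu>_def)
      then show "\<mu>0 < \<mu>" using \<mu>0 by simp
      have "r + \<delta> < 1" using r by (simp add: \<delta>_def field_simps)
      then show "\<mu> < 1" using Y \<mu>0 by (simp add: \<mu>_def)
    qed
    have \<mu>p: "0 < \<mu>" using \<mu> \<mu>0 by simp
    have "1 - \<mu>\<^sup>2 = (1 - \<mu>) * (1 + \<mu>)" by (simp add: power2_eq_square algebra_simps)
    also have "\<dots> \<le> 1 / (2 * Y) * 2" using \<mu> \<mu>p Y by (intro mult_mono) auto
    finally have "1 - \<mu>\<^sup>2 \<le> 1 / Y" by simp
    moreover have \<mu>2: "0 < 1 - \<mu>\<^sup>2" using \<mu>p \<mu> by (simp add: abs_square_less_1)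
    ultimately have "Y \<le> 1 / (1 - \<mu>\<^sup>2)" using Y by (simp add: field_simps)
    then have "\<delta> * Y \<le> \<delta> * (1 / (1 - \<mu>\<^sup>2))" using \<delta> by (intro mult_left_mono) auto
    moreover have "T2 \<le> \<delta> * Y" using \<delta> by (simp add: Y_def algebra_simps)
    ultimately have T2_le: "T2 \<le> \<delta> / (1 - \<mu>\<^sup>2)" by simp
    have "0 < W \<mu> z" if z: "z \<in> cball 0 r1" for z
    proof -
      have zB: "z \<in> ball 0 1" using z KB by blast
      note yB = hB[OF zB]
      have "hyp_T z \<le> T1"
      proof -
        have "norm z \<le> r1" using z by simp
        then have "z \<bullet> z \<le> (T1 - 1) / (T1 + 1)" by (simp add: r1_def norm_eq_sqrt_inner)
        then have "z \<bullet> z * (T1 + 1) \<le> T1 - 1" using T1 by (simp add: pos_le_divide_eq)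
        then have "1 + z \<bullet> z \<le> T1 * (1 - z \<bullet> z)" by (simp add: algebra_simps)
        then show ?thesis using inner_self_lt_1[OF zB] by (simp add: hyp_T_def pos_divide_le_eq)
      qed
      then have "M * hyp_T z \<le> M * T1" using M(1) by simp
      then have "hyp_T (h z) \<le> B" using M(2)[OF zB] by (simp add: B_def)
      moreover have T1y: "1 \<le> hyp_T (h z)" by (rule hyp_T_ge_1[OF yB])
      ultimately have "(hyp_T (h z))\<^sup>2 \<le> B\<^sup>2" by (intro power_mono) auto
      then have "(hyp_T (h z))\<^sup>2 / B\<^sup>2 \<le> 1" using Bp by (simp only: divide_le_eq_1_pos)
      then have "(hyp_q (h z))\<^sup>2 \<le> (1 - 1 / B\<^sup>2) * (hyp_T (h z))\<^sup>2"
        using hyp_q_square_le[OF yB] by (simp add: algebra_simps)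
      also have "1 - 1 / B\<^sup>2 = r\<^sup>2" using Bi unfolding r_def by (subst real_sqrt_pow2) auto
      finally have "(hyp_q (h z))\<^sup>2 \<le> (r * hyp_T (h z))\<^sup>2" by (simp add: power_mult_distrib)
      then have "\<bar>hyp_q (h z)\<bar> \<le> r * hyp_T (h z)"
        using abs_le_square_iff[of "hyp_q (h z)" "r * hyp_T (h z)"] r T1y by simp
      then have q: "- r * hyp_T (h z) \<le> hyp_q (h z)" by simp
      note ratio = translate_e1_ratio[OF \<mu>p \<mu>(4) yB r(1) q less_imp_le[OF \<delta>] \<mu>(1)]
      have "\<delta> / (1 - \<mu>\<^sup>2) * 1 \<le> \<delta> / (1 - \<mu>\<^sup>2) * hyp_T (h z)"
        using T1y \<delta> \<mu>2 by (intro mult_left_mono) auto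
      then have "T2 \<le> hyp_T (translate_e1 \<mu> (h z))" using ratio(2) T2_le by simp
      then have "\<bar>u (translate_e1 \<mu> (h z)) - 1\<bar> < \<epsilon>2"
        by (rule T2[OF translate_e1_facts(1)[OF \<mu>p \<mu>(4) yB] _ ratio(1)])
      then show ?thesis using p(2)[OF z] by (simp add: W_def \<epsilon>2_def)
    qed
    then show ?thesis using \<mu> by blast
  qed
  then obtain \<mu>1 where \<mu>1: "\<mu>0 < \<mu>1" "\<mu>1 < 1" "\<And>z. z \<in> cball 0 r1 \<Longrightarrow> 0 < W \<mu>1 z" by blast
  define X where "X = {\<mu>0..\<mu>1} \<times> cball (0 :: 'k pt) r1"
  have "compact X" unfolding X_def by (intro compact_Times) auto
  have cont_W: "continuous_on ({\<mu>0..\<mu>1} \<times> ball 0 1) (\<lambda>x. W (fst x) (snd x))"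
  proof -
    have h: "continuous_on ({\<mu>0..\<mu>1} \<times> ball 0 1) (\<lambda>x::real \<times> 'k pt. h (snd x))"
      unfolding h_def
      by (rule continuous_on_compose2[OF ball_inversion_continuous[OF c(1)]])
        (auto intro!: continuous_intros less_imp_le)
    have "continuous_on ({\<mu>0..\<mu>1} \<times> ball 0 1) (\<lambda>x::real \<times> 'k pt. (fst x, h (snd x)))"
      by (intro continuous_on_Pair continuous_intros h)
    moreover have in_dom: "0 \<le> fst x" "fst x < 1" "h (snd x) \<in> ball 0 1"
      if "x \<in> {\<mu>0..\<mu>1} \<times> ball 0 1" for x :: "real \<times> 'k pt"
      using that \<mu>0 \<mu>1 hB[of "snd x"] unfolding mem_Times_iff by auto
    have "(\<lambda>x::real \<times> 'k pt. (fst x, h (snd x))) ` ({\<mu>0..\<mu>1} \<times> ball 0 1) \<subseteq> {0..<1} \<times> ball 0 1"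
    proof (rule image_subsetI)
      fix x :: "real \<times> 'k pt" assume "x \<in> {\<mu>0..\<mu>1} \<times> ball 0 1"
      from in_dom[OF this] show "(fst x, h (snd x)) \<in> {0..<1} \<times> ball 0 1" by simp
    qed
    ultimately have "continuous_on ({\<mu>0..\<mu>1} \<times> ball 0 1)
        (\<lambda>x::real \<times> 'k pt. translate_e1 (fst x) (h (snd x)))"
      using continuous_on_compose2[OF translate_e1_continuous] by fastforce
    moreover have "(\<lambda>x. translate_e1 (fst x) (h (snd x))) ` ({\<mu>0..\<mu>1} \<times> ball 0 1) \<subseteq> ball 0 1"
      using in_dom translate_e1_in_ball unfolding image_subset_iff by blast
    ultimately have "continuous_on ({\<mu>0..\<mu>1} \<times> ball 0 1)
        (\<lambda>x::real \<times> 'k pt. u (translate_e1 (fst x) (h (snd x))))"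
      by (rule continuous_on_compose2[OF cont_u])
    moreover have "continuous_on ({\<mu>0..\<mu>1} \<times> ball 0 1) (\<lambda>x::real \<times> 'k pt. u (snd x))"
      by (rule continuous_on_compose2[OF cont_u]) (auto intro!: continuous_intros)
    ultimately show ?thesis unfolding W_def by (rule continuous_on_diff)
  qed
  \<comment> \<open>Contact set in parameter and point jointly. Being compact, it has an element
    with largest parameter if it is not empty: the first contact on the way down from
    \<open>\<mu>1\<close>.\<close>
  define Z where "Z = {x \<in> X. W (fst x) (snd x) \<in> {..0}}"
  have subX: "X \<subseteq> {\<mu>0..\<mu>1} \<times> ball 0 1" using KB by (auto simp: X_def)
  have "closed Z"
  proof -
    have "Z = X \<inter> (\<lambda>x. W (fst x) (snd x)) -` {..0}" by (auto simp: Z_def)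
    then show ?thesis
      using continuous_closed_preimage[OF continuous_on_subset[OF cont_W subX] compact_imp_closed[OF \<open>compact X\<close>] closed_atMost]
      by simp
  qed
  then have "compact (X \<inter> Z)" using \<open>compact X\<close> by (rule_tac compact_Int_closed)
  then have "compact Z" by (metis (no_types, lifting) Int_absorb1 Z_def mem_Collect_eq subsetI)
  have "Z = {}"
  proof (rule ccontr)
    assume "Z \<noteq> {}"
    moreover have "continuous_on Z fst" by (intro continuous_intros)
    ultimately obtain x where x: "x \<in> Z" "\<And>y. y \<in> Z \<Longrightarrow> fst y \<le> fst x"
      using continuous_attains_sup[OF \<open>compact Z\<close>, of fst] by blast
    define \<mu> where "\<mu> = fst x"
    define p where "p = snd x"
    have \<mu>: "\<mu>0 \<le> \<mu>" "\<mu> \<le> \<mu>1" and p: "p \<in> cball 0 r1" "W \<mu> p \<le> 0"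
      using x(1) by (auto simp: Z_def X_def \<mu>_def p_def)
    have "\<mu> \<noteq> \<mu>1" using \<mu>1(3)[OF p(1)] p(2) by auto
    then have \<mu>lt: "\<mu> < \<mu>1" using \<mu> by simp
    \<comment> \<open>For parameters between \<mu> and \<open>\<mu>1\<close> there is no contact, by
      maximality of \<mu>; continuity passes the inequality to \<mu> itself.\<close>
    have K: "0 \<le> W \<mu> z" if z: "z \<in> cball 0 r1" for z
    proof -
      have "continuous_on {\<mu>..\<mu>1} (\<lambda>m. W (fst (m, z)) (snd (m, z)))"
        by (rule continuous_on_compose2[OF cont_W])
          (use \<mu> z KB in \<open>auto intro!: continuous_intros simp: subset_iff\<close>)
      then have cont: "continuous_on (closure {\<mu><..<\<mu>1}) (\<lambda>m. W m z)" using \<mu>lt by simp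
      have "0 \<le> W m z" if m: "m \<in> {\<mu><..<\<mu>1}" for m
      proof (rule ccontr)
        assume "\<not> 0 \<le> W m z"
        then have "(m, z) \<in> Z" using m z \<mu> by (auto simp: Z_def X_def)
        then show False using x(2)[of "(m, z)"] m by (simp add: \<mu>_def)
      qed
      then show ?thesis using continuous_ge_on_closure[OF cont, of \<mu> 0] \<mu>lt by simp
    qed
    have \<mu>p: "0 < \<mu>" "\<mu> < 1" using \<mu> \<mu>0 \<mu>1 by auto
    obtain k where k: "blapl (W \<mu>) k (\<lambda>z. f (u (translate_e1 \<mu> (h z))) - f (u z))"
      using W_sol[OF \<mu>p] by blast
    obtain C where C: "\<And>s t. \<bar>s\<bar> \<le> 1 \<Longrightarrow> \<bar>t\<bar> \<le> 1 \<Longrightarrow> \<bar>f s - f t\<bar> \<le> C * \<bar>s - t\<bar>"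
      using f_lipschitz_interval by blast
    have nn: "0 \<le> W \<mu> z" if "z \<in> ball 0 1" for z using extend[OF \<mu>(1) \<mu>p(2) K that] .
    \<comment> \<open>A ratio of exactly - \<theta> lies in both asymptotic regions: u is near -1 at
      y and near 1 at its image, so W cannot vanish there.\<close>
    obtain y :: "'k pt" where y: "y \<in> ball 0 1" "T1 \<le> hyp_T y" "hyp_q y = - \<theta> * hyp_T y"
      using ex_hyp_point[of "- \<theta>" T1] \<theta> by auto
    have "W \<mu> y = 0"
    proof (rule strong_maximum_principle[OF k nn _ _ _ y(1), of C p])
      fix z :: "'k pt" assume z: "z \<in> ball 0 1"
      show "f (u (translate_e1 \<mu> (h z))) - f (u z) \<le> C * W \<mu> z"
        using C[OF abs1[OF less_imp_le[OF \<mu>p(1)] \<mu>p(2) z] abs_le_1[OF z]] nn[OF z]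
        by (simp add: W_def abs_le_iff)
    next
      show "p \<in> ball 0 1" using p(1) KB by blast
      then show "W \<mu> p = 0" using nn[of p] p(2) by simp
    qed
    moreover have "1 - \<epsilon> < u (translate_e1 \<mu> (h y))"
      using far_plus[OF \<mu>(1) \<mu>p(2) y(1,2)] y(3) by simp
    moreover have "u y < - 1 + \<epsilon>" using far_minus[OF y(1,2)] y(3) by simp
    ultimately show False using \<epsilon> by (simp add: W_def)
  qed
  have "0 \<le> W \<mu>0 z" if z: "z \<in> cball 0 r1" for z
  proof (rule ccontr)
    assume "\<not> 0 \<le> W \<mu>0 z"
    then have "(\<mu>0, z) \<in> Z" using z \<mu>1(1) by (simp add: Z_def X_def)
    then show False using \<open>Z = {}\<close> by blast
  qed
  from extend[OF order_refl \<mu>0(2) this z0] show ?thesis by (simp add: W_def h_def)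
qed

lemma invariant_ball_inversion:
  fixes c :: "'k pt"
  assumes c: "1 < c \<bullet> c" "fst c = 0" and z: "z \<in> ball 0 1"
  shows "u (ball_inversion c z) = u z"
proof -
  have le: "u z \<le> u (ball_inversion c z)" if z: "z \<in> ball 0 1" for z
  proof -
    define y where "y = ball_inversion c z"
    have y: "y \<in> ball 0 1" unfolding y_def by (rule ball_inversion_in(1)[OF c(1) z])
    have pair: "continuous_on {0..1/2::real} (\<lambda>m. (m, y))" by (intro continuous_intros)
    have "(\<lambda>m. (m, y)) ` {0..1/2::real} \<subseteq> {0..<1} \<times> ball 0 1" using y by auto
    from continuous_on_compose2[OF translate_e1_continuous pair this]
    have "continuous_on {0..1/2::real} (\<lambda>m. translate_e1 m y)" by simp
    moreover have "(\<lambda>m. translate_e1 m y) ` {0..1/2::real} \<subseteq> ball 0 1"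
      by (rule image_subsetI) (use y in \<open>simp add: translate_e1_in_ball del: mem_ball_0 mem_ball\<close>)
    ultimately have "continuous_on {0..1/2::real} (\<lambda>m. u (translate_e1 m y))"
      by (rule continuous_on_compose2[OF lapl_continuous_on[OF sol]])
    then have cont: "continuous_on (closure {0<..<1/2::real}) (\<lambda>m. u (translate_e1 m y))" by simp
    have "u z \<le> u (translate_e1 m y)" if "m \<in> {0<..<1/2}" for m
      unfolding y_def by (rule sliding[OF c _ _ z]) (use that in auto)
    then have "u z \<le> u (translate_e1 0 y)"
      using continuous_ge_on_closure[OF cont, of 0 "u z"] by simp
    then show ?thesis by (simp add: translate_e1_0 y_def)
  qed
  have "u (ball_inversion c z) \<le> u (ball_inversion c (ball_inversion c z))"
    by (rule le[OF ball_inversion_in(1)[OF c(1) z]])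
  then show ?thesis
    using le[OF z] ball_inversion_involution[OF c(1), of z] inner_self_lt_1[OF z] by simp
qed

end

section \<open>Moving points to the axis orthogonal to the hyperplane\<close>

text \<open>With centre (0, \<kappa> y), y = \<open>snd z\<close>, the reflected point has second
  component a multiple of y, which vanishes when m \<kappa>^2 - a \<kappa> + 1 = 0, where m = |y|^2
  and a = 1 + |z|^2. The discriminant is at least (1 - |z|^2)^2.\<close>

lemma ex_ball_inversion_snd_0:
  fixes z :: "'k::finite pt"
  assumes z: "z \<in> ball 0 1" and y: "snd z \<noteq> 0"
  shows "\<exists>c. 1 < c \<bullet> c \<and> fst c = 0 \<and> snd (ball_inversion c z) = 0"
proof -
  define m where "m = snd z \<bullet> snd z"
  define a where "a = 1 + z \<bullet> z"
  have m: "0 < m" using y by (simp add: m_def)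
  have zz: "m \<le> z \<bullet> z" "z \<bullet> z < 1" using inner_pt[of z] inner_self_lt_1[OF z] by (auto simp: m_def)
  have "0 < (1 - z \<bullet> z)\<^sup>2" using zz by simp
  then have disc: "0 < a\<^sup>2 - 4 * m" using zz by (simp add: a_def power2_eq_square algebra_simps)
  \<comment> \<open>The larger root is the one that gives m \<kappa>^2 > 1, that is, a centre
    outside the closed unit ball.\<close>
  define \<kappa> where "\<kappa> = (a + sqrt (a\<^sup>2 - 4 * m)) / (2 * m)"
  have a: "1 < a" unfolding a_def using m zz by linarith
  have q: "m * \<kappa>\<^sup>2 = a * \<kappa> - 1"
  proof -
    have "(2 * m * \<kappa> - a)\<^sup>2 = a\<^sup>2 - 4 * m" using m disc by (simp add: \<kappa>_def)
    then have "4 * m * (m * \<kappa>\<^sup>2) = 4 * m * (a * \<kappa> - 1)" by (simp add: power2_eq_square algebra_simps)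
    then show ?thesis using m by simp
  qed
  have big: "1 < m * \<kappa>\<^sup>2"
  proof -
    have "a < 2 * m * \<kappa>" using m disc by (simp add: \<kappa>_def)
    then have "a\<^sup>2 < (2 * m * \<kappa>)\<^sup>2" using a by (intro power_strict_mono) auto
    then have "4 * m * 1 < 4 * m * (m * \<kappa>\<^sup>2)" using disc by (simp add: power2_eq_square algebra_simps)
    then show ?thesis using m by simp
  qed
  define c :: "'k pt" where "c = (0, \<kappa> *\<^sub>R snd z)"
  have cc: "c \<bullet> c = m * \<kappa>\<^sup>2" by (simp add: c_def inner_prod_def m_def power2_eq_square)
  have c1: "1 < c \<bullet> c" using big cc by simp
  define s where "s = (z - c) \<bullet> (z - c)"
  have "0 < s" unfolding s_def using ball_inversion_center_dist[OF c1] zz by simp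
  have "s = z \<bullet> z - 2 * (z \<bullet> c) + c \<bullet> c"
    by (simp add: s_def inner_diff_left inner_diff_right inner_commute[of c z])
  also have "z \<bullet> c = \<kappa> * m" by (simp add: c_def inner_prod_def m_def)
  finally have s: "s = (a - 1) - 2 * (\<kappa> * m) + (a * \<kappa> - 1)" using q by (simp add: cc a_def)
  have "\<kappa> * s = \<kappa> * (a - 1) - 2 * (m * \<kappa>\<^sup>2) + \<kappa> * (a * \<kappa> - 1)"
    unfolding s by (simp add: power2_eq_square algebra_simps)
  also have "\<dots> = (m * \<kappa>\<^sup>2 - 1) * (\<kappa> - 1)" unfolding q by (simp add: algebra_simps)
  finally have \<kappa>s: "\<kappa> * s = (m * \<kappa>\<^sup>2 - 1) * (\<kappa> - 1)" .
  define \<rho> where "\<rho> = (c \<bullet> c - 1) / s"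
  have "\<kappa> = \<rho> * (\<kappa> - 1)" using \<open>0 < s\<close> \<kappa>s by (simp add: \<rho>_def cc eq_divide_eq)
  then have k0: "\<kappa> + \<rho> * (1 - \<kappa>) = 0" by (simp add: algebra_simps)
  have "snd (ball_inversion c z) = (\<kappa> + \<rho> * (1 - \<kappa>)) *\<^sub>R snd z"
    unfolding ball_inversion_def s_def[symmetric] \<rho>_def[symmetric]
    by (simp add: c_def scaleR_add_left scaleR_diff_right algebra_simps)
  then show ?thesis using c1 k0 by (intro exI[of _ c]) (simp add: c_def)
qed

text \<open>On the axis \<open>fst z\<close> is tanh(t/2) and \<open>hyp_q z\<close> is sinh t, so
  this is tanh(t/2) = sinh t / (1 + cosh t). In particular \<open>hyp_q\<close> determines the point
  of the axis.\<close>

lemma hyp_q_snd_0: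
  fixes z :: "'k::finite pt"
  assumes z: "z \<in> ball 0 1" and y: "snd z = 0"
  shows "fst z = hyp_q z / (1 + sqrt (1 + (hyp_q z)\<^sup>2))"
proof -
  define x where "x = fst z"
  have x: "x\<^sup>2 < 1" using inner_self_lt_1[OF z] inner_pt[of z] y by (simp add: x_def)
  have q: "hyp_q z = 2 * x / (1 - x\<^sup>2)" using inner_pt[of z] y by (simp add: hyp_q_def x_def)
  have "1 + (hyp_q z)\<^sup>2 = ((1 + x\<^sup>2) / (1 - x\<^sup>2))\<^sup>2"
    unfolding q using x by (simp add: power_divide divide_simps) (simp add: power2_eq_square algebra_simps)
  then have "sqrt (1 + (hyp_q z)\<^sup>2) = (1 + x\<^sup>2) / (1 - x\<^sup>2)" using x by (simp add: real_sqrt_divide)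
  then have "1 + sqrt (1 + (hyp_q z)\<^sup>2) = 2 / (1 - x\<^sup>2)" using x by (simp add: field_simps)
  then show ?thesis unfolding q using x by (simp add: x_def[symmetric])
qed

lemma (in layer_solution) depends_on_hyp_q:
  assumes z: "z \<in> ball 0 1" "w \<in> ball 0 1" and q: "hyp_q z = hyp_q w"
  shows "u z = u w"
proof -
  have "\<exists>y\<in>ball 0 1. snd y = 0 \<and> hyp_q y = hyp_q z \<and> u y = u z" if z: "z \<in> ball 0 1" for z
  proof (cases "snd z = 0")
    case False
    then obtain c where c: "1 < c \<bullet> c" "fst c = 0" "snd (ball_inversion c z) = 0"
      using ex_ball_inversion_snd_0[OF z] by blast
    then show ?thesis
      using invariant_ball_inversion[OF c(1,2) z] hyp_q_ball_inversion[OF c(1,2) z]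
        ball_inversion_in(1)[OF c(1) z] by blast
  qed (use z in blast)
  note slice = this
  obtain y where y: "y \<in> ball 0 1" "snd y = 0" "hyp_q y = hyp_q z" "u y = u z"
    using slice[OF z(1)] by blast
  obtain y' where y': "y' \<in> ball 0 1" "snd y' = 0" "hyp_q y' = hyp_q w" "u y' = u w"
    using slice[OF z(2)] by blast
  have "fst y = fst y'" using hyp_q_snd_0[OF y(1,2)] hyp_q_snd_0[OF y'(1,2)] y(3) y'(3) q by simp
  then have "y = y'" using y(2) y'(2) by (simp add: prod_eq_iff)
  then show ?thesis using y(4) y'(4) by simp
qed

section \<open>Arbitrary totally geodesic hyperplanes\<close>

text \<open>An isometry together with its inverse, extended continuously to the closed ball because
  the hypotheses of convergence live on the boundary sphere. Invariance of the Laplacian is recorded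
  as a clause, so no smoothness has to be extracted from a mere distance-preserving map.\<close>

definition ball_motion :: "('a::euclidean_space \<Rightarrow> 'a) \<Rightarrow> ('a \<Rightarrow> 'a) \<Rightarrow> bool" where
  "ball_motion \<Psi> \<Psi>' \<longleftrightarrow>
     continuous_on (cball 0 1) \<Psi> \<and> continuous_on (cball 0 1) \<Psi>' \<and>
     (\<forall>z\<in>cball 0 1. \<Psi> z \<in> cball 0 1 \<and> \<Psi>' z \<in> cball 0 1 \<and> \<Psi>' (\<Psi> z) = z \<and> \<Psi> (\<Psi>' z) = z) \<and>
     (\<forall>z\<in>ball 0 1. \<Psi> z \<in> ball 0 1 \<and> \<Psi>' z \<in> ball 0 1) \<and>
     (\<forall>u g l. blapl u g l \<longrightarrow> (\<exists>k. blapl (\<lambda>z. u (\<Psi> z)) k (\<lambda>z. l (\<Psi> z))))"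

lemma ball_motion_inversion: "1 < c \<bullet> c \<Longrightarrow> ball_motion (ball_inversion c) (ball_inversion c)"
  unfolding ball_motion_def
  using ball_inversion_continuous[of c] ball_inversion_in[of c] blapl_ball_inversion[of c]
    ball_inversion_involution[of c]
  by (auto simp: norm_eq_sqrt_inner simp del: mem_ball mem_ball_0)

lemma ball_motion_orthogonal:
  fixes Q :: "'a::euclidean_space \<Rightarrow> 'a"
  assumes Q: "orthogonal_transformation Q"
  shows "ball_motion Q (inv Q)"
proof -
  note Q' = orthogonal_transformation_inv[OF Q]
  have "continuous_on (cball 0 1) Q" "continuous_on (cball 0 1) (inv Q)"
    using Q Q' by (auto intro: linear_continuous_on simp: orthogonal_transformation_linear linear_linear)
  moreover have "bij Q" by (rule orthogonal_transformation_bij[OF Q])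
  then have "inv Q (Q z) = z" "Q (inv Q z) = z" for z
    by (auto simp: bij_def surj_f_inv_f)
  moreover have "\<exists>k. blapl (\<lambda>z. u (Q z)) k (\<lambda>z. l (Q z))" if "blapl u g l" for u g l
    using blapl_orthogonal[OF Q that] by - (rule exI)
  ultimately show ?thesis unfolding ball_motion_def
    using orthogonal_transformation_norm[OF Q] orthogonal_transformation_norm[OF Q'] by simp
qed

lemma ball_motionD:
  assumes "ball_motion \<Psi> \<Psi>'"
  shows "continuous_on (cball 0 1) \<Psi>" "continuous_on (cball 0 1) \<Psi>'"
    and "z \<in> cball 0 1 \<Longrightarrow> \<Psi> z \<in> cball 0 1" "z \<in> cball 0 1 \<Longrightarrow> \<Psi>' z \<in> cball 0 1"
    and "z \<in> cball 0 1 \<Longrightarrow> \<Psi>' (\<Psi> z) = z" "z \<in> cball 0 1 \<Longrightarrow> \<Psi> (\<Psi>' z) = z"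
    and "z \<in> ball 0 1 \<Longrightarrow> \<Psi> z \<in> ball 0 1" "z \<in> ball 0 1 \<Longrightarrow> \<Psi>' z \<in> ball 0 1"
    and "blapl u g l \<Longrightarrow> \<exists>k. blapl (\<lambda>z. u (\<Psi> z)) k (\<lambda>z. l (\<Psi> z))"
  using assms unfolding ball_motion_def by blast+

lemma ball_motion_compose:
  assumes 1: "ball_motion \<Psi> \<Psi>'" and 2: "ball_motion \<Theta> \<Theta>'"
  shows "ball_motion (\<lambda>z. \<Psi> (\<Theta> z)) (\<lambda>z. \<Theta>' (\<Psi>' z))"
  unfolding ball_motion_def
proof (intro conjI ballI allI impI)
  show "continuous_on (cball 0 1) (\<lambda>z. \<Psi> (\<Theta> z))"
    by (rule continuous_on_compose2[OF ball_motionD(1)[OF 1] ball_motionD(1)[OF 2]])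
      (use ball_motionD(3)[OF 2] in blast)
  show "continuous_on (cball 0 1) (\<lambda>z. \<Theta>' (\<Psi>' z))"
    by (rule continuous_on_compose2[OF ball_motionD(2)[OF 2] ball_motionD(2)[OF 1]])
      (use ball_motionD(4)[OF 1] in blast)
  fix u :: "'a \<Rightarrow> real" and g l assume "blapl u g l"
  then obtain k where "blapl (\<lambda>z. u (\<Psi> z)) k (\<lambda>z. l (\<Psi> z))" using ball_motionD(9)[OF 1] by blast
  from ball_motionD(9)[OF 2 this]
  show "\<exists>k. blapl (\<lambda>z. u (\<Psi> (\<Theta> z))) k (\<lambda>z. l (\<Psi> (\<Theta> z)))" .
next
  fix z :: 'a assume z: "z \<in> cball 0 1"
  show "\<Psi> (\<Theta> z) \<in> cball 0 1" by (intro ball_motionD(3)[OF 1] ball_motionD(3)[OF 2] z)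
  show "\<Theta>' (\<Psi>' z) \<in> cball 0 1" by (intro ball_motionD(4)[OF 1] ball_motionD(4)[OF 2] z)
  show "\<Theta>' (\<Psi>' (\<Psi> (\<Theta> z))) = z"
    using ball_motionD(5)[OF 1 ball_motionD(3)[OF 2 z]] ball_motionD(5)[OF 2 z] by simp
  show "\<Psi> (\<Theta> (\<Theta>' (\<Psi>' z))) = z"
    using ball_motionD(6)[OF 2 ball_motionD(4)[OF 1 z]] ball_motionD(6)[OF 1 z] by simp
next
  fix z :: 'a assume z: "z \<in> ball 0 1"
  show "\<Psi> (\<Theta> z) \<in> ball 0 1" by (intro ball_motionD(7)[OF 1] ball_motionD(7)[OF 2] z)
  show "\<Theta>' (\<Psi>' z) \<in> ball 0 1" by (intro ball_motionD(8)[OF 1] ball_motionD(8)[OF 2] z)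
qed

lemma ball_hdist_eq_iff:
  fixes z :: "'a::euclidean_space" and z' :: "'b::euclidean_space"
  assumes "z \<in> ball 0 1" "w \<in> ball 0 1" "z' \<in> ball 0 1" "w' \<in> ball 0 1"
    and "ball_hdist z w = ball_hdist z' w'"
  shows "(norm (z - w))\<^sup>2 / ((1 - (norm z)\<^sup>2) * (1 - (norm w)\<^sup>2))
    = (norm (z' - w'))\<^sup>2 / ((1 - (norm z')\<^sup>2) * (1 - (norm w')\<^sup>2))"
proof -
  have nn: "0 \<le> 2 * (norm (z - w))\<^sup>2 / ((1 - (norm z)\<^sup>2) * (1 - (norm w)\<^sup>2))"
    if "z \<in> ball 0 1" "w \<in> ball 0 1" for z w :: "'c::euclidean_space"
    using that by (intro divide_nonneg_nonneg mult_nonneg_nonneg) (auto simp: abs_square_le_1)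
  have c: "cosh (ball_hdist z w) = 1 + 2 * ((norm (z - w))\<^sup>2 / ((1 - (norm z)\<^sup>2) * (1 - (norm w)\<^sup>2)))"
    if "z \<in> ball 0 1" "w \<in> ball 0 1" for z w :: "'c::euclidean_space"
    using nn[OF that] unfolding ball_hdist_def by (subst cosh_arcosh_real) simp_all
  show ?thesis using c[OF assms(1,2)] c[OF assms(3,4)] assms(5) by simp
qed

text \<open>The distance to 0 determines the Euclidean norm; with norms preserved, the hyperbolic
  distance formula gives back Euclidean distances and then inner products. The sphere of radius 1/2,
  rescaled to the unit sphere, supplies the orthogonal map, and inner products show that it agrees
  with \<psi> everywhere.\<close>

lemma ball_isometry_fixing_0:
  fixes \<psi> :: "'a::euclidean_space \<Rightarrow> 'a"
  assumes ball: "\<And>z. z \<in> ball 0 1 \<Longrightarrow> \<psi> z \<in> ball 0 1"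
    and iso: "\<And>z w. z \<in> ball 0 1 \<Longrightarrow> w \<in> ball 0 1 \<Longrightarrow> ball_hdist (\<psi> z) (\<psi> w) = ball_hdist z w"
    and 0: "\<psi> 0 = 0"
  shows "\<exists>Q. orthogonal_transformation Q \<and> (\<forall>z\<in>ball 0 1. \<psi> z = Q z)"
proof -
  have lt: "(norm z)\<^sup>2 < 1" if "z \<in> ball 0 1" for z :: 'a using that by (simp add: abs_square_less_1)
  have norm: "(norm (\<psi> z))\<^sup>2 = (norm z)\<^sup>2" if z: "z \<in> ball 0 1" for z
  proof -
    have "(norm (\<psi> z))\<^sup>2 / (1 - (norm (\<psi> z))\<^sup>2) = (norm z)\<^sup>2 / (1 - (norm z)\<^sup>2)"
      using ball_hdist_eq_iff[OF ball[OF z] _ z _ , of 0 0] iso[OF z, of 0] 0 by simp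
    moreover have "(norm (\<psi> z))\<^sup>2 < 1" "(norm z)\<^sup>2 < 1" using lt z ball[OF z] by auto
    ultimately show ?thesis by (simp add: frac_eq_eq algebra_simps)
  qed
  have dist: "(norm (\<psi> z - \<psi> w))\<^sup>2 = (norm (z - w))\<^sup>2" if z: "z \<in> ball 0 1" "w \<in> ball 0 1" for z w
    using ball_hdist_eq_iff[OF ball[OF z(1)] ball[OF z(2)] z iso[OF z]] lt[OF z(1)] lt[OF z(2)]
    unfolding norm[OF z(1)] norm[OF z(2)] by simp
  have inner: "\<psi> z \<bullet> \<psi> w = z \<bullet> w" if z: "z \<in> ball 0 1" "w \<in> ball 0 1" for z w
    using dist[OF z] norm[OF z(1)] norm[OF z(2)] unfolding power2_norm_eq_inner
    by (simp add: inner_diff_left inner_diff_right inner_commute)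
  have half: "(1 / 2) *\<^sub>R x \<in> ball 0 1" if "norm x = 1" for x :: 'a using that by simp
  have "\<exists>Q. orthogonal_transformation Q \<and> (\<forall>x. norm x = 1 \<longrightarrow> Q x = 2 *\<^sub>R \<psi> ((1 / 2) *\<^sub>R x))"
  proof (rule isometry_sphere_extend)
    fix x :: 'a assume x: "norm x = 1"
    have "(norm (\<psi> ((1 / 2) *\<^sub>R x)))\<^sup>2 = (1 / 2)\<^sup>2"
      using norm[OF half[OF x]] x by (simp add: power_divide)
    then have "norm (\<psi> ((1 / 2) *\<^sub>R x)) = 1 / 2" by (rule power2_eq_imp_eq) auto
    then show "norm (2 *\<^sub>R \<psi> ((1 / 2) *\<^sub>R x)) = 1" by simp
    fix y :: 'a assume y: "norm y = 1"
    have "(norm (\<psi> ((1 / 2) *\<^sub>R x) - \<psi> ((1 / 2) *\<^sub>R y)))\<^sup>2 = (norm ((1 / 2) *\<^sub>R x - (1 / 2) *\<^sub>R y))\<^sup>2"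
      by (rule dist[OF half[OF x] half[OF y]])
    then have e: "norm (\<psi> ((1 / 2) *\<^sub>R x) - \<psi> ((1 / 2) *\<^sub>R y)) = norm ((1 / 2) *\<^sub>R x - (1 / 2) *\<^sub>R y)"
      by (rule power2_eq_imp_eq) simp_all
    have "dist (2 *\<^sub>R \<psi> ((1 / 2) *\<^sub>R x)) (2 *\<^sub>R \<psi> ((1 / 2) *\<^sub>R y))
      = 2 * norm (\<psi> ((1 / 2) *\<^sub>R x) - \<psi> ((1 / 2) *\<^sub>R y))"
      unfolding dist_norm scaleR_diff_right[symmetric] norm_scaleR by simp
    also have "\<dots> = dist x y" unfolding e dist_norm scaleR_diff_right[symmetric] norm_scaleR by simp
    finally show "dist (2 *\<^sub>R \<psi> ((1 / 2) *\<^sub>R x)) (2 *\<^sub>R \<psi> ((1 / 2) *\<^sub>R y)) = dist x y" .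
  qed
  then obtain Q where Q: "orthogonal_transformation Q"
    "\<And>x. norm x = 1 \<Longrightarrow> Q x = 2 *\<^sub>R \<psi> ((1 / 2) *\<^sub>R x)" by blast
  have "\<psi> z = Q z" if z: "z \<in> ball 0 1" for z
  proof (cases "z = 0")
    case True
    then show ?thesis using 0 Q(1) by (simp add: orthogonal_transformation_def linear_0)
  next
    case False
    define x where "x = (1 / norm z) *\<^sub>R z"
    have x: "norm x = 1" "z = norm z *\<^sub>R x" using False by (auto simp: x_def)
    have "Q z = norm z *\<^sub>R Q x"
      using Q(1) x(2) by (metis orthogonal_transformation_linear linear_cmul)
    then have "\<psi> z \<bullet> Q z = norm z * (2 * (\<psi> z \<bullet> \<psi> ((1 / 2) *\<^sub>R x)))" using Q(2)[OF x(1)] by simp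
    also have "\<dots> = norm z * (z \<bullet> x)" using inner[OF z half[OF x(1)]] by simp
    also have "\<dots> = z \<bullet> z" using False by (simp add: x_def)
    finally have "(\<psi> z - Q z) \<bullet> (\<psi> z - Q z) = 0"
      using inner[OF z z] Q(1)
      by (simp add: inner_diff_left inner_diff_right inner_commute[of "Q z" "\<psi> z"] orthogonal_transformation_def)
    then show ?thesis by simp
  qed
  then show ?thesis using Q(1) by blast
qed

lemma ball_isometry_eq_motion:
  fixes \<phi> :: "'a::euclidean_space \<Rightarrow> 'a"
  assumes \<phi>: "ball_isometry \<phi>"
  shows "\<exists>\<Psi> \<Psi>'. ball_motion \<Psi> \<Psi>' \<and> (\<forall>z\<in>ball 0 1. \<phi> z = \<Psi> z)"
proof -
  have ball: "\<phi> z \<in> ball 0 1" if "z \<in> ball 0 1" for z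
    using \<phi> that unfolding ball_isometry_def by (meson bij_betwE)
  have iso: "ball_hdist (\<phi> z) (\<phi> w) = ball_hdist z w" if "z \<in> ball 0 1" "w \<in> ball 0 1" for z w
    using \<phi> that unfolding ball_isometry_def by blast
  show ?thesis
  proof (cases "\<phi> 0 = 0")
    case True
    then show ?thesis using ball_isometry_fixing_0[OF ball iso] ball_motion_orthogonal by blast
  next
    case False
    define a where "a = \<phi> 0"
    have a: "a \<in> ball 0 1" "a \<noteq> 0" using ball[of 0] False by (auto simp: a_def)
    have aa: "0 < a \<bullet> a" "a \<bullet> a < 1" using a inner_self_lt_1[OF a(1)] by auto
    \<comment> \<open>The image of a under inversion in the unit sphere; the reflection centred
      there exchanges 0 and a, which reduces to the case of a fixed origin.\<close>
    define c where "c = (1 / (a \<bullet> a)) *\<^sub>R a"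
    have cc: "c \<bullet> c = 1 / (a \<bullet> a)" using aa by (simp add: c_def)
    have c: "1 < c \<bullet> c" unfolding cc using aa by simp
    have "ball_inversion c 0 = (1 - (c \<bullet> c - 1) / (c \<bullet> c)) *\<^sub>R c"
      by (simp add: ball_inversion_def scaleR_diff_left)
    also have "\<dots> = a" using aa unfolding cc by (simp add: c_def field_simps)
    finally have "ball_inversion c a = 0" using ball_inversion_involution[OF c, of 0] by simp
    then have "\<exists>Q. orthogonal_transformation Q \<and> (\<forall>z\<in>ball 0 1. ball_inversion c (\<phi> z) = Q z)"
      using ball iso
      by (intro ball_isometry_fixing_0)
        (simp_all add: ball_inversion_in[OF c] ball_inversion_hdist[OF c] a_def[symmetric] del: mem_ball mem_ball_0)
    then obtain Q where Q: "orthogonal_transformation Q" "\<And>z. z \<in> ball 0 1 \<Longrightarrow> ball_inversion c (\<phi> z) = Q z"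
      by blast
    have "\<phi> z = ball_inversion c (Q z)" if z: "z \<in> ball 0 1" for z
      using ball_inversion_involution[OF c, of "\<phi> z"] inner_self_lt_1[OF ball[OF z]] Q(2)[OF z] by simp
    then show ?thesis
      using ball_motion_compose[OF ball_motion_inversion[OF c] ball_motion_orthogonal[OF Q(1)]] by blast
  qed
qed

section \<open>Boundary hemispheres and the two components\<close>

lemma ball_motion_sphere:
  assumes "ball_motion \<Psi> \<Psi>'" "z \<in> sphere 0 1"
  shows "\<Psi> z \<in> sphere 0 1" "\<Psi>' z \<in> sphere 0 1"
proof -
  have z: "z \<in> cball 0 1" "z \<notin> ball 0 1" using assms(2) by auto
  have "\<Psi> z \<in> cball 0 1" "\<Psi>' z \<in> cball 0 1" "\<Psi> z \<notin> ball 0 1" "\<Psi>' z \<notin> ball 0 1"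
    using assms(1) z unfolding ball_motion_def by metis+
  then show "\<Psi> z \<in> sphere 0 1" "\<Psi>' z \<in> sphere 0 1" by auto
qed

abbreviation hemisphere :: "real \<Rightarrow> 'k::finite pt set" where
  "hemisphere s \<equiv> {z \<in> sphere 0 1. 0 < s * fst z}"

lemma connected_hemisphere:
  assumes s: "s = 1 \<or> s = -1"
  shows "connected (hemisphere s :: 'k::finite pt set)"
proof -
  have "hemisphere s = (\<lambda>y::real^'k. (s * sqrt (1 - y \<bullet> y), y)) ` ball 0 1"
  proof (intro equalityI subsetI)
    fix z :: "'k pt" assume z: "z \<in> hemisphere s"
    then have "(fst z)\<^sup>2 = 1 - snd z \<bullet> snd z" using inner_pt[of z] by (simp add: norm_eq_sqrt_inner)
    moreover have "fst z = s * \<bar>fst z\<bar>" "fst z \<noteq> 0" using z s by auto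
    ultimately have "fst z = s * sqrt (1 - snd z \<bullet> snd z)" "snd z \<bullet> snd z < 1"
      by (metis real_sqrt_abs) (metis \<open>(fst z)\<^sup>2 = 1 - snd z \<bullet> snd z\<close> \<open>fst z \<noteq> 0\<close> diff_gt_0_iff_gt zero_less_power2)
    then show "z \<in> (\<lambda>y. (s * sqrt (1 - y \<bullet> y), y)) ` ball 0 1"
      by (intro image_eqI[of _ _ "snd z"]) (auto simp: prod_eq_iff norm_eq_sqrt_inner)
  next
    fix z :: "'k pt" assume "z \<in> (\<lambda>y. (s * sqrt (1 - y \<bullet> y), y)) ` ball 0 1"
    then obtain y where y: "z = (s * sqrt (1 - y \<bullet> y), y)" "y \<bullet> y < 1" using inner_self_lt_1 by blast
    have "z \<bullet> z = 1" unfolding inner_pt using y s by (auto simp: power_mult_distrib)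
    moreover have "0 < s * fst z" using y s by auto
    ultimately show "z \<in> hemisphere s" by (simp add: norm_eq_sqrt_inner)
  qed
  moreover have "connected (ball (0 :: real^'k) 1)" by simp
  ultimately show ?thesis
    by (simp only:) (intro connected_continuous_image continuous_intros)
qed

text \<open>The closure is the image of the closed flat disc \<open>E\<close>: it is contained in
  that image by compactness, and every point of \<open>E\<close> is approached radially from
  \<open>P0\<close>.\<close>

lemma sphere_minus_hyperplane:
  fixes \<phi> :: "'k::finite pt \<Rightarrow> 'k pt"
  assumes \<Psi>: "ball_motion \<Psi> \<Psi>'" and eq: "\<And>z. z \<in> ball 0 1 \<Longrightarrow> \<phi> z = \<Psi> z"
  shows "sphere 0 1 - closure (\<phi> ` P0) = {z \<in> sphere 0 1. fst (\<Psi>' z) \<noteq> 0}"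
proof -
  have P0: "P0 \<subseteq> ball 0 1" by (auto simp: P0_def)
  then have im: "\<phi> ` P0 = \<Psi> ` P0" using eq by (intro image_cong) auto
  define E where "E = cball 0 1 \<inter> {z :: 'k pt. fst z = 0}"
  have cont: "continuous_on (cball 0 1) \<Psi>" using \<Psi> by (simp add: ball_motion_def)
  have "closed {z :: 'k pt. fst z = 0}"
    by (intro closed_Collect_eq continuous_intros)
  then have E: "compact E" "E \<subseteq> cball 0 1" unfolding E_def by (auto intro: compact_Int_closed)
  have sub: "\<Psi> ` P0 \<subseteq> \<Psi> ` E" by (intro image_mono) (auto simp: P0_def E_def)
  have "closed (\<Psi> ` E)"
    using E cont by (intro compact_imp_closed compact_continuous_image) (auto intro: continuous_on_subset)
  then have 1: "closure (\<Psi> ` P0) \<subseteq> \<Psi> ` E" using sub by (simp add: closure_minimal)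
  have "E \<subseteq> closure P0"
  proof
    fix z assume z: "z \<in> E"
    have "(\<lambda>t. t *\<^sub>R z) ` closure {0<..<1::real} \<subseteq> closure P0"
    proof (rule image_closure_subset)
      show "(\<lambda>t. t *\<^sub>R z) ` {0<..<1} \<subseteq> closure P0"
      proof (rule image_subsetI, rule subsetD[OF closure_subset])
        fix t :: real assume t: "t \<in> {0<..<1}"
        have "t * norm z \<le> t * 1" using z t by (intro mult_left_mono) (auto simp: E_def)
        then have "t * norm z < 1" by (rule le_less_trans) (use t in simp)
        then show "t *\<^sub>R z \<in> P0" using z t by (auto simp: P0_def E_def)
      qed
    qed (auto intro!: continuous_intros)
    moreover have "1 \<in> closure {0<..<1::real}" by simp
    ultimately have "1 *\<^sub>R z \<in> closure P0" by blast
    then show "z \<in> closure P0" by simp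
  qed
  moreover have "closure P0 \<subseteq> cball (0 :: 'k pt) 1"
    using P0 by (intro closure_minimal) auto
  then have "\<Psi> ` closure P0 \<subseteq> closure (\<Psi> ` P0)"
    using cont by (intro image_closure_subset closure_subset) (auto intro: continuous_on_subset)
  ultimately have "closure (\<Psi> ` P0) = \<Psi> ` E" using 1 by blast
  moreover have "z \<in> \<Psi> ` E \<longleftrightarrow> fst (\<Psi>' z) = 0" if "z \<in> sphere 0 1" for z
  proof -
    have "z \<in> cball 0 1" using that by auto
    then have "\<Psi> (\<Psi>' z) = z" "\<Psi>' z \<in> cball 0 1" using \<Psi> unfolding ball_motion_def by blast+
    moreover have "\<Psi>' (\<Psi> w) = w" if "w \<in> E" for w using \<Psi> that unfolding ball_motion_def E_def by blast
    ultimately show ?thesis unfolding E_def by force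
  qed
  ultimately show ?thesis unfolding im by blast
qed

text \<open>The coordinate \<open>fst\<close> of the pulled-back point has no zero on the connected
  set C, hence one sign; conversely each hemisphere is connected, so maximality of C gives
  equality.\<close>

lemma components_sphere_minus_hyperplane:
  fixes \<phi> :: "'k::finite pt \<Rightarrow> 'k pt"
  assumes \<Psi>: "ball_motion \<Psi> \<Psi>'" and eq: "\<And>z. z \<in> ball 0 1 \<Longrightarrow> \<phi> z = \<Psi> z"
    and C: "C \<in> components (sphere 0 1 - closure (\<phi> ` P0))"
  shows "C = \<Psi> ` hemisphere 1 \<or> C = \<Psi> ` hemisphere (-1)"
proof -
  let ?S = "{z \<in> sphere 0 1. fst (\<Psi>' z) \<noteq> 0}"
  have S: "sphere 0 1 - closure (\<phi> ` P0) = ?S" by (rule sphere_minus_hyperplane[OF \<Psi> eq])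
  have inv: "\<Psi>' (\<Psi> z) = z" "\<Psi> (\<Psi>' z) = z" if "z \<in> sphere 0 1" for z
  proof -
    have "z \<in> cball 0 1" using that by auto
    then show "\<Psi>' (\<Psi> z) = z" "\<Psi> (\<Psi>' z) = z" using \<Psi> unfolding ball_motion_def by blast+
  qed
  have H: "\<Psi> ` hemisphere s = {z \<in> sphere 0 1. 0 < s * fst (\<Psi>' z)}" for s
  proof (intro equalityI subsetI)
    fix z assume "z \<in> \<Psi> ` hemisphere s"
    then show "z \<in> {z \<in> sphere 0 1. 0 < s * fst (\<Psi>' z)}"
      using inv(1) ball_motion_sphere(1)[OF \<Psi>] by auto
  next
    fix z assume z: "z \<in> {z \<in> sphere 0 1. 0 < s * fst (\<Psi>' z)}"
    then have "z = \<Psi> (\<Psi>' z)" "\<Psi>' z \<in> hemisphere s"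
      using inv(2) ball_motion_sphere(2)[OF \<Psi>] by auto
    then show "z \<in> \<Psi> ` hemisphere s" by (rule image_eqI)
  qed
  have conn: "connected (\<Psi> ` hemisphere s)" if "s = 1 \<or> s = -1" for s
  proof (rule connected_continuous_image[OF _ connected_hemisphere[OF that]])
    show "continuous_on (hemisphere s) \<Psi>"
      using \<Psi> unfolding ball_motion_def by (auto intro: continuous_on_subset)
  qed
  have CS: "C \<subseteq> ?S" "connected C" "C \<noteq> {}"
    using C S in_components_subset in_components_connected in_components_nonempty by metis+
  have "connected ((\<lambda>z. fst (\<Psi>' z)) ` C)"
  proof (rule connected_continuous_image[OF _ CS(2)])
    have "C \<subseteq> cball 0 1" using CS(1) by auto
    then show "continuous_on C (\<lambda>z. fst (\<Psi>' z))"
      using \<Psi> unfolding ball_motion_def by (auto intro!: continuous_intros intro: continuous_on_subset)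
  qed
  moreover have "0 \<notin> (\<lambda>z. fst (\<Psi>' z)) ` C" using CS(1) by auto
  ultimately have same: "0 < fst (\<Psi>' w)" if "z \<in> C" "w \<in> C" "0 < fst (\<Psi>' z)" for z w
    using connectedD_interval[of "(\<lambda>z. fst (\<Psi>' z)) ` C" "fst (\<Psi>' w)" "fst (\<Psi>' z)" 0] that
    by (meson imageI not_le less_imp_le)
  obtain z where z: "z \<in> C" using CS(3) by blast
  show ?thesis
  proof (cases "0 < fst (\<Psi>' z)")
    case True
    have "C \<subseteq> \<Psi> ` hemisphere 1" unfolding H using same[OF z _ True] CS(1) by auto
    moreover have "\<Psi> ` hemisphere 1 \<subseteq> C"
      by (rule components_maximal[OF C conn]) (use H[of 1] z True CS(1) S in auto)
    ultimately show ?thesis by blast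
  next
    case False
    have neg: "fst (\<Psi>' w) < 0" if "w \<in> C" for w using same[OF that z] False CS(1) that by (force simp: not_less le_less)
    have "C \<subseteq> \<Psi> ` hemisphere (-1)" unfolding H using neg CS(1) by auto
    moreover have "\<Psi> ` hemisphere (-1) \<subseteq> C"
    proof (rule components_maximal[OF C conn])
      show "\<Psi> ` hemisphere (-1) \<subseteq> sphere 0 1 - closure (\<phi> ` P0)" unfolding H S by auto
      have "z \<in> \<Psi> ` hemisphere (-1)" unfolding H using z neg CS(1) by auto
      then show "C \<inter> \<Psi> ` hemisphere (-1) \<noteq> {}" using z by blast
    qed simp
    ultimately show ?thesis by blast
  qed
qed

lemma conv_to_boundary_near_hemisphere:
  fixes u :: "'k::finite pt \<Rightarrow> real"
  assumes \<Psi>: "ball_motion \<Psi> \<Psi>'" and s: "s = 1 \<or> s = -1"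
    and conv: "\<And>K. compact K \<Longrightarrow> K \<subseteq> \<Psi> ` hemisphere s \<Longrightarrow> conv_to_boundary_set u K a"
    and pos: "0 < \<theta>" "0 < \<epsilon>"
  shows "\<exists>T0. \<forall>z\<in>ball 0 1. T0 \<le> hyp_T z \<longrightarrow> \<theta> * hyp_T z \<le> s * hyp_q z \<longrightarrow> \<bar>u (\<Psi> z) - a\<bar> < \<epsilon>"
proof -
  \<comment> \<open>From q \<ge> \<theta> T, T + 1 \<le> 2 T and T + 1 = 2/(1 - |z|^2) one gets
    \<open>fst z\<close> \<ge> \<theta>/2 up to the sign s; the radial projection to the sphere only
    enlarges it.\<close>
  define K where "K = sphere 0 1 \<inter> {z :: 'k pt. \<theta> / 2 \<le> s * fst z}"
  have "closed {z :: 'k pt. \<theta> / 2 \<le> s * fst z}"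
    by (intro closed_Collect_le continuous_intros)
  then have K: "compact K" unfolding K_def by (simp add: compact_Int_closed)
  have cont: "continuous_on (cball 0 1) \<Psi>" using \<Psi> by (simp add: ball_motion_def)
  have "compact (\<Psi> ` K)"
    by (rule compact_continuous_image[OF continuous_on_subset[OF cont] K]) (auto simp: K_def)
  moreover have "\<Psi> ` K \<subseteq> \<Psi> ` hemisphere s" using pos by (intro image_mono) (auto simp: K_def)
  ultimately have "conv_to_boundary_set u (\<Psi> ` K) a" by (rule conv)
  then have "\<exists>\<delta>>0. \<forall>z\<in>ball 0 1. (\<exists>k\<in>\<Psi> ` K. dist z k < \<delta>) \<longrightarrow> \<bar>u z - a\<bar> < \<epsilon>"
    unfolding conv_to_boundary_set_def using pos(2) by (rule_tac mp[OF spec[of _ \<epsilon>]])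
  then obtain \<delta> where "\<delta> > 0"
    and \<delta>_all: "\<forall>z\<in>ball 0 1. (\<exists>k\<in>\<Psi> ` K. dist z k < \<delta>) \<longrightarrow> \<bar>u z - a\<bar> < \<epsilon>" by (elim exE conjE)
  have \<delta>: "\<bar>u z - a\<bar> < \<epsilon>" if "z \<in> ball 0 1" "k \<in> \<Psi> ` K" "dist z k < \<delta>" for z k
  proof -
    have "\<exists>k\<in>\<Psi> ` K. dist z k < \<delta>" using that(3,2) by (rule bexI)
    then show ?thesis using \<delta>_all that(1) by blast
  qed
  have "uniformly_continuous_on (cball 0 1) \<Psi>"
    by (rule compact_uniformly_continuous[OF cont]) simp
  then obtain \<delta>' where "\<delta>' > 0" and
    \<delta>'_all: "\<forall>z\<in>cball 0 1. \<forall>w\<in>cball 0 1. dist w z < \<delta>' \<longrightarrow> dist (\<Psi> w) (\<Psi> z) < \<delta>"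
    unfolding uniformly_continuous_on_def using \<open>\<delta> > 0\<close> by blast
  have \<delta>': "0 < \<delta>'" "\<And>z w. z \<in> cball 0 1 \<Longrightarrow> w \<in> cball 0 1 \<Longrightarrow> dist z w < \<delta>' \<Longrightarrow> dist (\<Psi> z) (\<Psi> w) < \<delta>"
    using \<open>\<delta>' > 0\<close> \<delta>'_all by blast+
  show ?thesis
  \<comment> \<open>The distance to the radial projection is 1 - |z| \<le> 1 - |z|^2 = 2/(T + 1),
    which is below \<open>\<delta>'\<close> for T \<ge> 2/\<delta>'.\<close>
  proof (rule exI[of _ "2 / \<delta>'"], intro ballI impI)
    fix z :: "'k pt" assume z: "z \<in> ball 0 1" and T: "2 / \<delta>' \<le> hyp_T z" and q: "\<theta> * hyp_T z \<le> s * hyp_q z"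
    have r: "0 < 1 - z \<bullet> z" using inner_self_lt_1[OF z] by simp
    have T1: "1 \<le> hyp_T z" by (rule hyp_T_ge_1[OF z])
    have "\<theta> / 2 * (hyp_T z + 1) \<le> \<theta> / 2 * (2 * hyp_T z)" using T1 pos by (intro mult_left_mono) auto
    also have "\<dots> \<le> s * hyp_q z" using q by simp
    finally have "\<theta> / 2 * (2 / (1 - z \<bullet> z)) \<le> s * (2 * fst z / (1 - z \<bullet> z))"
      unfolding hyp_T_plus_1[OF z] hyp_q_def .
    then have x: "\<theta> / 2 \<le> s * fst z" using r by (simp add: divide_le_cancel)
    then have z0: "z \<noteq> 0" using pos by auto
    define w where "w = (1 / norm z) *\<^sub>R z"
    have nz: "0 < norm z" "norm z < 1" using z z0 by auto
    have w: "w \<in> K"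
    proof -
      have "\<theta> / 2 * norm z \<le> \<theta> / 2 * 1" using nz pos by (intro mult_left_mono) auto
      then have "\<theta> / 2 \<le> s * fst z / norm z" using x nz by (simp add: pos_le_divide_eq)
      then show ?thesis using nz by (simp add: K_def w_def)
    qed
    have "z - w = (1 - 1 / norm z) *\<^sub>R z" by (simp add: w_def scaleR_diff_left)
    then have "dist z w = \<bar>1 - 1 / norm z\<bar> * norm z" by (simp add: dist_norm)
    also have "\<dots> = 1 - norm z" using nz by (simp add: abs_if field_simps)
    also have "\<dots> \<le> 1 - z \<bullet> z"
      using nz mult_left_le[of "norm z" "norm z"] by (simp add: power2_norm_eq_inner[symmetric] power2_eq_square)
    also have "\<dots> = 2 / (hyp_T z + 1)" unfolding hyp_T_plus_1[OF z] using r by simp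
    also have "\<dots> < \<delta>'"
    proof -
      have "2 < \<delta>' * (hyp_T z + 1)" using T \<delta>'(1) by (simp add: pos_divide_le_eq algebra_simps)
      then show ?thesis using T1 by (simp add: pos_divide_less_eq)
    qed
    finally have "dist (\<Psi> z) (\<Psi> w) < \<delta>" using z w by (intro \<delta>'(2)) (auto simp: K_def)
    moreover have "\<Psi> z \<in> ball 0 1" using \<Psi> z unfolding ball_motion_def by blast
    ultimately show "\<bar>u (\<Psi> z) - a\<bar> < \<epsilon>" by (rule_tac \<delta>[OF _ imageI[OF w]])
  qed
qed

lemma (in double_well_solution) ball_motion_solution:
  assumes "ball_motion \<Psi> \<Psi>'"
  shows "\<exists>k. double_well_solution F f f' (\<lambda>z. u (\<Psi> z)) k"
proof -
  obtain k where k: "blapl (\<lambda>z. u (\<Psi> z)) k (\<lambda>z. f (u (\<Psi> z)))"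
    using assms sol unfolding ball_motion_def by blast
  have "(\<lambda>z. u (\<Psi> z)) ` ball 0 1 \<subseteq> u ` ball 0 1" using assms unfolding ball_motion_def by blast
  then have "bounded ((\<lambda>z. u (\<Psi> z)) ` ball 0 1)" using bdd bounded_subset by blast
  then have "double_well_solution F f f' (\<lambda>z. u (\<Psi> z)) k" using k by unfold_locales
  then show ?thesis by - (rule exI)
qed

lemma double_well_solution_layer:
  fixes u :: "'k::finite pt \<Rightarrow> real"
  assumes dws: "double_well_solution F f f' u g" and \<Psi>: "ball_motion \<Psi> \<Psi>'"
    and plus: "\<And>K. compact K \<Longrightarrow> K \<subseteq> \<Psi> ` hemisphere 1 \<Longrightarrow> conv_to_boundary_set u K 1"
    and minus: "\<And>K. compact K \<Longrightarrow> K \<subseteq> \<Psi> ` hemisphere (-1) \<Longrightarrow> conv_to_boundary_set u K (-1)"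
    and z: "z \<in> ball 0 1" "w \<in> ball 0 1" and q: "hyp_q z = hyp_q w"
  shows "u (\<Psi> z) = u (\<Psi> w)"
proof -
  obtain k where "double_well_solution F f f' (\<lambda>z. u (\<Psi> z)) k"
    using double_well_solution.ball_motion_solution[OF dws \<Psi>] by blast
  then interpret v: double_well_solution F f f' "\<lambda>z. u (\<Psi> z)" k .
  interpret v: layer_solution F f f' "\<lambda>z. u (\<Psi> z)" k
  proof
    fix \<theta> \<epsilon> :: real assume pos: "0 < \<theta>" "0 < \<epsilon>"
    show "\<exists>T0. \<forall>z\<in>ball 0 1. T0 \<le> hyp_T z \<longrightarrow> \<theta> * hyp_T z \<le> hyp_q z \<longrightarrow> \<bar>u (\<Psi> z) - 1\<bar> < \<epsilon>"
      using conv_to_boundary_near_hemisphere[where s = 1, OF \<Psi> _ plus pos] by simp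
    obtain T0 where "\<And>z. z \<in> ball 0 1 \<Longrightarrow> T0 \<le> hyp_T z \<Longrightarrow> \<theta> * hyp_T z \<le> - 1 * hyp_q z \<Longrightarrow> \<bar>u (\<Psi> z) - - 1\<bar> < \<epsilon>"
      using conv_to_boundary_near_hemisphere[OF \<Psi> _ minus pos] by blast
    then show "\<exists>T0. \<forall>z\<in>ball 0 1. T0 \<le> hyp_T z \<longrightarrow> hyp_q z \<le> - \<theta> * hyp_T z \<longrightarrow> \<bar>u (\<Psi> z) + 1\<bar> < \<epsilon>"
      by (intro exI[of _ T0]) fastforce
  qed
  show ?thesis by (rule v.depends_on_hyp_q[OF z q])
qed

section \<open>Signed distance to the hyperplane\<close>

lemma P0_ball_inversion:
  fixes c :: "'k::finite pt"
  assumes c: "1 < c \<bullet> c" "fst c = 0"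
  shows "ball_inversion c ` P0 = P0"
proof -
  have in_P0: "ball_inversion c p \<in> P0" if "p \<in> P0" for p
    using that ball_inversion_in(1)[OF c(1), of p] by (simp add: P0_def ball_inversion_def c(2))
  moreover have "p = ball_inversion c (ball_inversion c p)" if "p \<in> P0" for p
    using that ball_inversion_involution[OF c(1), of p] inner_self_lt_1[of p] by (simp add: P0_def)
  ultimately show ?thesis by blast
qed

text \<open>For a point of the axis the nearest point of \<open>P0\<close> is the origin. Any other
  point is first moved to the axis by a reflection that preserves \<open>P0\<close>; x is the
  coordinate of its image there.\<close>

lemma INF_hdist_P0:
  fixes z :: "'k::finite pt"
  assumes z: "z \<in> ball 0 1"
  shows "\<exists>x. x\<^sup>2 < 1 \<and> hyp_q z = 2 * x / (1 - x\<^sup>2) \<and>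
    (INF p\<in>P0. ball_hdist z p) = arcosh (1 + 2 * x\<^sup>2 / (1 - x\<^sup>2))"
proof -
  have axis: "(INF p\<in>P0. ball_hdist y p) = arcosh (1 + 2 * (fst y)\<^sup>2 / (1 - (fst y)\<^sup>2)) \<and> (fst y)\<^sup>2 < 1
      \<and> hyp_q y = 2 * fst y / (1 - (fst y)\<^sup>2)"
    if y: "y \<in> ball 0 1" "snd y = 0" for y :: "'k pt"
  proof (intro conjI)
    have ny: "(norm y)\<^sup>2 = (fst y)\<^sup>2" "y \<bullet> y = (fst y)\<^sup>2" using y(2) inner_pt[of y] by (simp_all add: power2_norm_eq_inner)
    show x: "(fst y)\<^sup>2 < 1" using inner_self_lt_1[OF y(1)] ny by simp
    show "hyp_q y = 2 * fst y / (1 - (fst y)\<^sup>2)" by (simp add: hyp_q_def ny)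
    have "(INF p\<in>P0. ball_hdist y p) = ball_hdist y 0"
    proof (rule cInf_eq_minimum)
      show "ball_hdist y 0 \<in> ball_hdist y ` P0" by (rule imageI) (simp add: P0_def)
      fix d assume "d \<in> ball_hdist y ` P0"
      then obtain p where p: "p \<in> P0" "d = ball_hdist y p" by blast
      have "(norm (y - p))\<^sup>2 = (fst y)\<^sup>2 + (norm p)\<^sup>2"
        using p(1) y(2) unfolding power2_norm_eq_inner inner_pt by (simp add: P0_def)
      moreover define m where "m = (norm p)\<^sup>2"
      moreover have m: "0 \<le> m" "m < 1" using p(1) by (auto simp: m_def P0_def abs_square_less_1)
      moreover define X where "X = (fst y)\<^sup>2"
      ultimately have d: "d = arcosh (1 + 2 * (X + m) / ((1 - X) * (1 - m)))"
        "ball_hdist y 0 = arcosh (1 + 2 * X / (1 - X))" and X: "0 \<le> X" "X < 1"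
        using p(2) ny x by (auto simp: ball_hdist_def)
      have "2 * X / (1 - X) = 2 * (X * (1 - m)) / ((1 - X) * (1 - m))" using m by simp
      also have "X * (1 - m) \<le> X + m" using m X mult_nonneg_nonneg[of X m] by (simp add: algebra_simps)
      then have "2 * (X * (1 - m)) / ((1 - X) * (1 - m)) \<le> 2 * (X + m) / ((1 - X) * (1 - m))"
        using m X by (intro divide_right_mono) auto
      finally have "1 + 2 * X / (1 - X) \<le> 1 + 2 * (X + m) / ((1 - X) * (1 - m))" by simp
      moreover have "1 \<le> 1 + 2 * X / (1 - X)" using X by simp
      ultimately have "\<not> d < ball_hdist y 0" unfolding d by (subst arcosh_less_iff_real) linarith+
      then show "ball_hdist y 0 \<le> d" by simp
    qed
    also have "\<dots> = arcosh (1 + 2 * (fst y)\<^sup>2 / (1 - (fst y)\<^sup>2))" by (simp add: ball_hdist_def ny)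
    finally show "(INF p\<in>P0. ball_hdist y p) = arcosh (1 + 2 * (fst y)\<^sup>2 / (1 - (fst y)\<^sup>2))" .
  qed
  show ?thesis
  proof (cases "snd z = 0")
    case False
    then obtain c where c: "1 < c \<bullet> c" "fst c = 0" "snd (ball_inversion c z) = 0"
      using ex_ball_inversion_snd_0[OF z] by blast
    have "ball_hdist (ball_inversion c z) (ball_inversion c p) = ball_hdist z p" if "p \<in> P0" for p
      using that by (intro ball_inversion_hdist[OF c(1) z]) (simp add: P0_def)
    then have "(\<lambda>p. ball_hdist z p) ` P0 = ball_hdist (ball_inversion c z) ` ball_inversion c ` P0"
      unfolding image_image by (intro image_cong) auto
    then have "(INF p\<in>P0. ball_hdist z p) = (INF p\<in>P0. ball_hdist (ball_inversion c z) p)"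
      unfolding P0_ball_inversion[OF c(1,2)] by simp
    then show ?thesis
      using axis[OF ball_inversion_in(1)[OF c(1) z] c(3)] hyp_q_ball_inversion[OF c(1,2) z] by metis
  qed (use axis[OF z] in blast)
qed

text \<open>The unsigned distance is an injective function of x^2 and vanishes only at x = 0, while
  the sign factor records the sign of x; together they determine x, hence
  \<open>hyp_q\<close>.\<close>

lemma signed_dist_eq_imp_hyp_q_eq:
  fixes \<phi> :: "'k::finite pt \<Rightarrow> 'k pt"
  assumes \<phi>: "ball_isometry \<phi>" and z: "z \<in> ball 0 1" "w \<in> ball 0 1"
    and eq: "signed_dist \<phi> (\<phi> z) = signed_dist \<phi> (\<phi> w)"
  shows "hyp_q z = hyp_q w"
proof -
  define A where "A x = arcosh (1 + 2 * x\<^sup>2 / (1 - x\<^sup>2))" for x :: real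
  have ge1: "1 \<le> 1 + 2 * x\<^sup>2 / (1 - x\<^sup>2)" if "x\<^sup>2 < 1" for x :: real using that by simp
  have A_inj: "x\<^sup>2 = y\<^sup>2" if "x\<^sup>2 < 1" "y\<^sup>2 < 1" "A x = A y" for x y
  proof -
    have "1 + 2 * x\<^sup>2 / (1 - x\<^sup>2) = 1 + 2 * y\<^sup>2 / (1 - y\<^sup>2)"
      using arg_cong[OF that(3), of cosh] cosh_arcosh_real[OF ge1] that(1,2) by (simp add: A_def)
    then show ?thesis using that(1,2) by (simp add: frac_eq_eq algebra_simps)
  qed
  have A_nn: "0 \<le> A x" if "x\<^sup>2 < 1" for x unfolding A_def by (rule arcosh_nonneg_real[OF ge1[OF that]])
  have A0: "A 0 = 0" by (simp add: A_def)
  have sd: "\<exists>x. x\<^sup>2 < 1 \<and> hyp_q z = 2 * x / (1 - x\<^sup>2) \<and> signed_dist \<phi> (\<phi> z) = (if 0 \<le> x then 1 else -1) * A x"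
    if z: "z \<in> ball 0 1" for z
  proof -
    obtain x where x: "x\<^sup>2 < 1" "hyp_q z = 2 * x / (1 - x\<^sup>2)" "(INF p\<in>P0. ball_hdist z p) = A x"
      using INF_hdist_P0[OF z] unfolding A_def by blast
    have "inj_on \<phi> (ball 0 1)" using \<phi> by (auto simp: ball_isometry_def bij_betw_def)
    then have inv: "inv_into (ball 0 1) \<phi> (\<phi> z) = z" using z by (rule inv_into_f_f)
    have "ball_hdist (\<phi> z) (\<phi> p) = ball_hdist z p" if "p \<in> P0" for p
      using \<phi> z that unfolding ball_isometry_def P0_def by blast
    then have "ball_hdist (\<phi> z) ` \<phi> ` P0 = ball_hdist z ` P0"
      unfolding image_image by (intro image_cong) auto
    moreover have "0 \<le> fst z \<longleftrightarrow> 0 \<le> x"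
    proof -
      have "0 \<le> fst z \<longleftrightarrow> 0 \<le> hyp_q z" using inner_self_lt_1[OF z] by (simp add: hyp_q_def zero_le_divide_iff)
      also have "\<dots> \<longleftrightarrow> 0 \<le> x" using x(1) by (simp add: x(2) zero_le_divide_iff)
      finally show ?thesis .
    qed
    ultimately show ?thesis using x by (intro exI[of _ x]) (simp add: signed_dist_def inv)
  qed
  obtain x where x: "x\<^sup>2 < 1" "hyp_q z = 2 * x / (1 - x\<^sup>2)"
    "signed_dist \<phi> (\<phi> z) = (if 0 \<le> x then 1 else -1) * A x" using sd[OF z(1)] by blast
  obtain y where y: "y\<^sup>2 < 1" "hyp_q w = 2 * y / (1 - y\<^sup>2)"
    "signed_dist \<phi> (\<phi> w) = (if 0 \<le> y then 1 else -1) * A y" using sd[OF z(2)] by blast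
  have e: "(if 0 \<le> x then 1 else -1) * A x = (if 0 \<le> y then 1 else -1) * A y" using eq x(3) y(3) by simp
  have "A x = A y"
    using e A_nn[OF x(1)] A_nn[OF y(1)] by (auto split: if_splits)
  then have "x\<^sup>2 = y\<^sup>2" by (rule A_inj[OF x(1) y(1)])
  then have xy: "x = y \<or> x = - y" by (simp add: power2_eq_iff)
  have "x = y"
  proof (rule ccontr)
    assume "x \<noteq> y"
    then have "x = - y" "y \<noteq> 0" using xy by auto
    then have "A x = 0" using e A_nn[OF x(1)] A_nn[OF y(1)] by (auto split: if_splits)
    then have "A x = A 0" using A0 by simp
    then have "x\<^sup>2 = 0\<^sup>2" by (intro A_inj x(1)) auto
    then show False using \<open>x = - y\<close> \<open>y \<noteq> 0\<close> by simp
  qed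
  then show ?thesis using x(2) y(2) by simp
qed

lemma hyperplane_symmetry:
  fixes u :: "'k::finite pt \<Rightarrow> real"
  assumes dws: "double_well_solution F f f' u g" and \<phi>: "ball_isometry \<phi>"
    and Sm: "Sm \<in> components (sphere 0 1 - closure (\<phi> ` P0))"
    and Sp: "Sp \<in> components (sphere 0 1 - closure (\<phi> ` P0))" and ne: "Sm \<noteq> Sp"
    and minus: "\<And>K. compact K \<Longrightarrow> K \<subseteq> Sm \<Longrightarrow> conv_to_boundary_set u K (-1)"
    and plus: "\<And>K. compact K \<Longrightarrow> K \<subseteq> Sp \<Longrightarrow> conv_to_boundary_set u K 1"
  shows "\<exists>g. \<forall>z\<in>ball 0 1. u z = g (signed_dist \<phi> z)"
proof -
  obtain \<Psi> \<Psi>' where \<Psi>: "ball_motion \<Psi> \<Psi>'" and eq: "\<And>z. z \<in> ball 0 1 \<Longrightarrow> \<phi> z = \<Psi> z"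
    using ball_isometry_eq_motion[OF \<phi>] by blast
  have q: "u (\<Psi> z) = u (\<Psi> w)" if z: "z \<in> ball 0 1" "w \<in> ball 0 1" "hyp_q z = hyp_q w" for z w
  proof -
    consider "Sp = \<Psi> ` hemisphere 1" "Sm = \<Psi> ` hemisphere (-1)"
      | "Sp = \<Psi> ` hemisphere (-1)" "Sm = \<Psi> ` hemisphere 1"
      using components_sphere_minus_hyperplane[OF \<Psi> eq Sm] components_sphere_minus_hyperplane[OF \<Psi> eq Sp] ne
      by blast
    then show ?thesis
    proof cases
      case 1
      then show ?thesis using double_well_solution_layer[OF dws \<Psi> _ _ z] plus minus by blast
    next
      \<comment> \<open>The components are given without orientation. Precomposing with
        \<open>reflect_fst\<close> exchanges the hemispheres and changes the sign of
        \<open>hyp_q\<close> at both points, so equality of the two values is kept.\<close>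
      case 2
      let ?R = "reflect_fst :: 'k pt \<Rightarrow> 'k pt"
      have R: "ball_motion ?R (inv ?R)" by (rule ball_motion_orthogonal[OF reflect_fst_orthogonal])
      have RR: "?R (?R z) = z" "norm (?R z) = norm z" for z
        by (simp_all add: reflect_fst_def norm_prod_def)
      have "?R ` hemisphere (- s) = hemisphere s" for s
      proof (intro equalityI subsetI)
        fix z :: "'k pt" assume "z \<in> hemisphere s"
        then have "?R z \<in> hemisphere (- s)" using RR(2)[of z] by (simp add: reflect_fst_def)
        then show "z \<in> ?R ` hemisphere (- s)" by (rule image_eqI[where f = "?R", OF RR(1)[of z, symmetric]])
      qed (use RR(2) in \<open>auto simp: reflect_fst_def\<close>)
      from this[of 1] this[of "-1"] have H: "(\<lambda>z. \<Psi> (?R z)) ` hemisphere 1 = Sp"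
        "(\<lambda>z. \<Psi> (?R z)) ` hemisphere (-1) = Sm" unfolding image_image[symmetric] 2 by simp_all
      have "u (\<Psi> (?R (?R z))) = u (\<Psi> (?R (?R w)))"
      proof (rule double_well_solution_layer[OF dws ball_motion_compose[OF \<Psi> R]])
        show "?R z \<in> ball 0 1" "?R w \<in> ball 0 1" using z RR(2) by simp_all
        show "hyp_q (?R z) = hyp_q (?R w)"
          using z(3) by (simp add: hyp_q_def reflect_fst_def inner_prod_def)
      qed (use plus minus H in auto)
      then show ?thesis unfolding RR(1) .
    qed
  qed
  have *: "u z = u w" if z: "z \<in> ball 0 1" "w \<in> ball 0 1" and sd: "signed_dist \<phi> z = signed_dist \<phi> w" for z w
  proof -
    have "\<phi> ` ball 0 1 = ball 0 1" using \<phi> by (simp add: ball_isometry_def bij_betw_def)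
    then have "z \<in> \<phi> ` ball 0 1" "w \<in> \<phi> ` ball 0 1" using z by simp_all
    then obtain z' w' where zw: "z' \<in> ball 0 1" "w' \<in> ball 0 1" "z = \<phi> z'" "w = \<phi> w'"
      by blast
    then have "hyp_q z' = hyp_q w'" using signed_dist_eq_imp_hyp_q_eq[OF \<phi>] sd by blast
    then show ?thesis using q[OF zw(1,2)] zw(3,4) eq[OF zw(1)] eq[OF zw(2)] by simp
  qed
  define h where "h s = u (SOME z. z \<in> ball 0 1 \<and> signed_dist \<phi> z = s)" for s
  have "u z = h (signed_dist \<phi> z)" if z: "z \<in> ball 0 1" for z
  proof -
    define y where "y = (SOME y. y \<in> ball 0 1 \<and> signed_dist \<phi> y = signed_dist \<phi> z)"
    have y: "y \<in> ball 0 1 \<and> signed_dist \<phi> y = signed_dist \<phi> z"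
      unfolding y_def by (rule someI[of _ z]) (use z in simp)
    have "u z = u y" by (rule *[OF z]) (use y in simp_all)
    then show ?thesis unfolding h_def y_def .
  qed
  then show ?thesis by blast
qed

theorem theorem1p2:
  fixes F f f' :: "real \<Rightarrow> real"
    and u :: "'k::finite pt \<Rightarrow> real"
    and n lam L :: real
  defines "n \<equiv> real CARD('k) + 1"
    and "lam \<equiv> - f' 0"
    and "L \<equiv> Inf {C. C-lipschitz_on {-1..1} f}"
  assumes F_deriv: "\<And>s. (F has_real_derivative f s) (at s)"
    and f_deriv: "\<And>s. (f has_real_derivative f' s) (at s)"
    and f'_cont: "continuous_on UNIV f'"
    and F_nonneg: "\<And>s. F s \<ge> 0"
    and F_infty: "filterlim F at_top at_infinity"
    and F_zeros: "{s. F s = 0} = {-1, 1}"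
    and F''_pos: "f' (-1) > 0" "f' 1 > 0"
    and F_outer: "\<And>s. \<bar>s\<bar> \<ge> 1 \<Longrightarrow> s * f s \<ge> 0"
    and F_crit: "{s. f s = 0} = {-1, 0, 1}"
    and F_locmax: "\<exists>\<epsilon>>0. \<forall>s. \<bar>s\<bar> < \<epsilon> \<longrightarrow> F s \<le> F 0"
    and lam_pos: "lam > 0"
    and u_bdd: "bounded (u ` hball)"
    and u_C2: "C2_on hball u"
    and u_sol: "\<And>z. z \<in> hball \<Longrightarrow> ball_lap u z = f (u z)"
  shows
    \<comment> \<open>(i), first part\<close>
    "(\<forall>\<eta>\<in>{-1, 1}.
        (\<forall>\<epsilon>>0. \<exists>r<1. \<forall>z\<in>hball. norm z > r \<longrightarrow> \<bar>u z - \<eta>\<bar> < \<epsilon>)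
        \<longrightarrow> (\<forall>z\<in>hball. u z = \<eta>))
   \<and> \<comment> \<open>(i), second part\<close>
    ((L \<le> (n - 1)\<^sup>2 / 4 \<and>
      (\<exists>\<epsilon>>0. \<exists>\<delta>>0. \<exists>K. \<forall>s t. \<bar>s\<bar> < \<epsilon> \<longrightarrow> \<bar>t\<bar> < \<epsilon> \<longrightarrow>
           \<bar>f' s - f' t\<bar> \<le> K * \<bar>s - t\<bar> powr \<delta>) \<and>
      (\<exists>\<alpha> C. \<alpha> > root_minus n lam \<and>
           (\<forall>z\<in>hball. \<bar>u z\<bar> / (1 - norm z) powr \<alpha> \<le> C)))
     \<longrightarrow> (\<forall>z\<in>hball. u z = 0))
   \<and> \<comment> \<open>(i), third part\<close>
    ((L \<le> (n - 1)\<^sup>2 / 4 \<and>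
      (\<exists>\<alpha> C. \<alpha> > root_minus n L \<and>
           (\<forall>z\<in>hball. \<bar>u z\<bar> / (1 - norm z) powr \<alpha> \<le> C)))
     \<longrightarrow> (\<forall>z\<in>hball. u z = 0))
   \<and> \<comment> \<open>(ii): upper half-space model, the point (x,y) with x > 0 corresponds to cayley (x,y)\<close>
    ((L \<le> (n - 1)\<^sup>2 / 4 \<and>
      (\<exists>\<alpha> C. \<alpha> > root_minus n lam \<and>
           (\<forall>x>0. \<forall>y. \<bar>u (cayley (x, y))\<bar> \<le> C * x powr \<alpha>)) \<and>
      (\<forall>C1>0. \<forall>C2. \<forall>y0. \<forall>\<epsilon>>0. \<exists>R. \<forall>x y.
           x > C1 * norm (y - y0) + C2 \<longrightarrow> x > 0 \<longrightarrow> norm (x, y) > R \<longrightarrow>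
           \<bar>u (cayley (x, y)) - 1\<bar> < \<epsilon>))
     \<longrightarrow> ((\<forall>m :: real^'k \<Rightarrow> real^'k. (\<forall>a b. dist (m a) (m b) = dist a b) \<longrightarrow>
             (\<forall>x>0. \<forall>y. u (cayley (x, m y)) = u (cayley (x, y))))
          \<and> (\<exists>g. \<forall>x>0. \<forall>y. u (cayley (x, y)) = g x)))
   \<and> \<comment> \<open>(iii): P = \<phi> ` P0 an arbitrary totally geodesic hyperplane\<close>
    (\<forall>\<phi> Sm Sp. ball_isometry \<phi> \<longrightarrow>
        Sm \<in> components (sphere 0 1 - closure (\<phi> ` P0)) \<longrightarrow>
        Sp \<in> components (sphere 0 1 - closure (\<phi> ` P0)) \<longrightarrow> Sm \<noteq> Sp \<longrightarrow>
        (\<forall>K. compact K \<longrightarrow> K \<subseteq> Sm \<longrightarrow> conv_to_boundary_set u K (-1)) \<longrightarrow>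
        (\<forall>K. compact K \<longrightarrow> K \<subseteq> Sp \<longrightarrow> conv_to_boundary_set u K 1) \<longrightarrow>
        (\<exists>g. \<forall>z\<in>hball. u z = g (signed_dist \<phi> z)))"
proof -
  note dw = F_deriv f_deriv f'_cont F_nonneg F_zeros F''_pos F_outer F_crit
  have "double_well F f f'"
    by unfold_locales (fact dw)+
  obtain g where "blapl u g (ball_lap u)" using C2_on_imp_blapl[OF u_C2] by blast
  then have sol: "blapl u g (\<lambda>z. f (u z))" by (rule lapl_cong) (rule u_sol)
  interpret double_well F f f' by fact
  interpret double_well_solution F f f' u g
    by unfold_locales (fact u_bdd, fact sol)
  have dws: "double_well_solution F f f' u g" by unfold_locales
  have neg: "f' 0 < 0" using lam_pos by (simp add: lam_def)
  \<comment> \<open>L is an infimum of Lipschitz constants, so the bound is obtained for the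
    quotient |f s|/|s|, a lower bound of that nonempty set.\<close>
  have lip: "\<bar>f s\<bar> \<le> L * \<bar>s\<bar>" if s: "\<bar>s\<bar> \<le> 1" for s
  proof (cases "s = 0")
    case False
    have "\<bar>f s\<bar> / \<bar>s\<bar> \<le> L" unfolding L_def
    proof (rule cInf_greatest)
      obtain C where "0 \<le> C" "\<And>s t. \<bar>s\<bar> \<le> 1 \<Longrightarrow> \<bar>t\<bar> \<le> 1 \<Longrightarrow> \<bar>f s - f t\<bar> \<le> C * \<bar>s - t\<bar>"
        using f_lipschitz_interval by blast
      then have "C-lipschitz_on {-1..1} f" by (intro lipschitz_onI) (auto simp: dist_real_def)
      then show "{C. C-lipschitz_on {-1..1} f} \<noteq> {}" by blast
      fix C assume "C \<in> {C. C-lipschitz_on {-1..1} f}"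
      then have "dist (f s) (f 0) \<le> C * dist s 0" using s by (intro lipschitz_onD[where X = "{-1..1}"]) auto
      then have "\<bar>f s\<bar> \<le> C * \<bar>s\<bar>" using f_zero by (simp add: dist_real_def)
      then show "\<bar>f s\<bar> / \<bar>s\<bar> \<le> C" using False by (simp add: pos_divide_le_eq)
    qed
    then show ?thesis using False by (simp add: pos_divide_le_eq)
  qed (use f_zero in simp)
  \<comment> \<open>The slope of f at 0 is - lam, which a Lipschitz bound dominates. It follows that
    the smaller root for L is at least the one for lam, so the stronger exponent condition reduces
    to the weaker one.\<close>
  have lam_le_L: "lam \<le> L"
  proof (rule ccontr)
    assume "\<not> lam \<le> L"
    have "((\<lambda>s. f s + L * s) has_real_derivative f' 0 + L) (at 0)"
      by (auto intro!: derivative_eq_intros f_deriv)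
    then obtain d where d: "d > 0" "\<And>h. 0 < h \<Longrightarrow> h < d \<Longrightarrow> f h + L * h < 0"
      using DERIV_neg_dec_right[of "\<lambda>s. f s + L * s" "f' 0 + L" 0] \<open>\<not> lam \<le> L\<close> f_zero
      by (auto simp: lam_def)
    define h where "h = min d 1 / 2"
    have h: "0 < h" "h < d" "h \<le> 1" using d(1) by (auto simp: h_def)
    have "f h + L * h < 0" using d(2) h by blast
    moreover have "\<bar>f h\<bar> \<le> L * h" using lip[of h] h by simp
    ultimately show False by linarith
  qed
  have root_mono: "root_minus n lam \<le> root_minus n L"
    unfolding root_minus_def using lam_le_L by (simp add: divide_right_mono)
  have root_pos: "0 < root_minus n lam"
  proof -
    have "sqrt ((n - 1)\<^sup>2 - 4 * lam) < sqrt ((n - 1)\<^sup>2)"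
      using lam_pos by (intro real_sqrt_less_mono) simp
    also have "\<dots> = n - 1" by (simp add: n_def)
    finally show ?thesis by (simp add: root_minus_def)
  qed
  have half: "\<forall>z\<in>hball. u z = 0"
    if L: "L \<le> (n - 1)\<^sup>2 / 4" and \<alpha>: "root_minus n lam < \<alpha>"
      and d: "\<And>x y. 0 < x \<Longrightarrow> \<bar>u (cayley (x, y))\<bar> \<le> C * x powr \<alpha>" for \<alpha> C
  proof
    fix z :: "'k pt" assume z: "z \<in> hball"
    show "u z = 0"
    proof (rule abs_half_space_liouville[OF dws neg lip _ _ _ z])
      show "L \<le> (real CARD('k))\<^sup>2 / 4" using L by (simp add: n_def)
      show "root_minus (real CARD('k) + 1) (- f' 0) < \<alpha>" using \<alpha> by (simp add: n_def lam_def)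
      show "\<bar>u (cayley w)\<bar> \<le> C * fst w powr \<alpha>" if "0 < fst w" for w
        using d[OF that, of "snd w"] by simp
    qed
  qed
  \<comment> \<open>Decay in the distance to the unit sphere implies decay in the height: 1 - |z|
    \<le> 1 - |z|^2 = 4 x / s \<le> 4 x because s \<ge> 1. Positivity of \<alpha> makes the power
    monotone.\<close>
  have ball: "\<forall>z\<in>hball. u z = 0"
    if L: "L \<le> (n - 1)\<^sup>2 / 4" and \<alpha>: "root_minus n lam < \<alpha>"
      and d: "\<And>z. z \<in> hball \<Longrightarrow> \<bar>u z\<bar> / (1 - norm z) powr \<alpha> \<le> C" for \<alpha> C
  proof (rule half[OF L \<alpha>])
    fix x :: real and y :: "real^'k" assume x: "0 < x"
    define z where "z = cayley (x, y)"
    define s where "s = ((x, y) + e1) \<bullet> ((x, y) + e1)"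
    have z: "z \<in> hball" unfolding z_def using cayley_facts(3)[of "(x, y)"] x by simp
    have nz: "norm z < 1" using z by simp
    have p: "0 < (1 - norm z) powr \<alpha>" using nz by simp
    have C: "0 \<le> C" using order_trans[OF _ d[OF z]] p by simp
    have "s = (x + 1)\<^sup>2 + y \<bullet> y" by (simp add: s_def e1_def inner_prod_def power2_eq_square)
    moreover have "1 \<le> (x + 1)\<^sup>2" using x by simp
    ultimately have s: "1 \<le> s" using inner_ge_zero[of y] by linarith
    have "(1 - z \<bullet> z) / 2 = 2 / s * x"
      using cayley_facts(2)[of "(x, y)"] x by (simp add: z_def s_def)
    then have "1 - z \<bullet> z = 4 * x / s" by simp
    also have "\<dots> \<le> 4 * x" using s x by (simp add: pos_divide_le_eq)
    finally have "1 - z \<bullet> z \<le> 4 * x" .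
    moreover have "z \<bullet> z \<le> norm z"
      using nz mult_left_le[of "norm z" "norm z"] by (simp add: power2_norm_eq_inner[symmetric] power2_eq_square)
    ultimately have le: "1 - norm z \<le> 4 * x" by linarith
    have "\<bar>u z\<bar> \<le> C * (1 - norm z) powr \<alpha>" using d[OF z] p by (simp add: pos_divide_le_eq)
    also have "\<dots> \<le> C * (4 * x) powr \<alpha>"
      using C le nz root_pos \<alpha> by (intro mult_left_mono powr_mono2) auto
    also have "\<dots> = C * 4 powr \<alpha> * x powr \<alpha>" using x by (simp add: powr_mult)
    finally show "\<bar>u (cayley (x, y))\<bar> \<le> C * 4 powr \<alpha> * x powr \<alpha>" by (simp add: z_def)
  qed
  have dim: "2 \<le> DIM('k pt)" by (simp add: Suc_le_eq)
  have i1: "\<forall>\<eta>\<in>{-1, 1}. (\<forall>\<epsilon>>0. \<exists>r<1. \<forall>z\<in>hball. norm z > r \<longrightarrow> \<bar>u z - \<eta>\<bar> < \<epsilon>)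
        \<longrightarrow> (\<forall>z\<in>hball. u z = \<eta>)"
  proof (intro ballI impI)
    fix \<eta> :: real and z :: "'k pt"
    assume \<eta>: "\<eta> \<in> {-1, 1}" and lim: "\<forall>\<epsilon>>0. \<exists>r<1. \<forall>z\<in>hball. norm z > r \<longrightarrow> \<bar>u z - \<eta>\<bar> < \<epsilon>"
      and z: "z \<in> hball"
    show "u z = \<eta>"
    proof (cases "\<eta> = 1")
      case True
      show ?thesis unfolding True by (rule eq_1_if_tendsto_1[OF dim lim[unfolded True] z])
    next
      case False
      then have m: "\<eta> = -1" using \<eta> by simp
      have "\<bar>- u z - 1\<bar> = \<bar>u z - (-1)\<bar>" for z by simp
      then have "\<forall>\<epsilon>>0. \<exists>r<1. \<forall>z\<in>hball. norm z > r \<longrightarrow> \<bar>- u z - 1\<bar> < \<epsilon>"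
        using lim unfolding m by simp
      from double_well_solution.eq_1_if_tendsto_1[OF reflect_solution dim this z] show ?thesis
        unfolding m by simp
    qed
  qed
  have ii: "(\<forall>m :: real^'k \<Rightarrow> real^'k. (\<forall>a b. dist (m a) (m b) = dist a b) \<longrightarrow>
             (\<forall>x>0. \<forall>y. u (cayley (x, m y)) = u (cayley (x, y))))
          \<and> (\<exists>g. \<forall>x>0. \<forall>y. u (cayley (x, y)) = g x)" if u0: "\<forall>z\<in>hball. u z = 0"
  proof -
    have "u (cayley (x, y)) = 0" if "0 < x" for x and y :: "real^'k"
      using u0 cayley_facts(3)[of "(x, y)"] that by simp
    then show ?thesis by auto
  qed
  show ?thesis
  proof (intro conjI)
    show "(L \<le> (n - 1)\<^sup>2 / 4 \<and>
      (\<exists>\<epsilon>>0. \<exists>\<delta>>0. \<exists>K. \<forall>s t. \<bar>s\<bar> < \<epsilon> \<longrightarrow> \<bar>t\<bar> < \<epsilon> \<longrightarrow>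
           \<bar>f' s - f' t\<bar> \<le> K * \<bar>s - t\<bar> powr \<delta>) \<and>
      (\<exists>\<alpha> C. \<alpha> > root_minus n lam \<and>
           (\<forall>z\<in>hball. \<bar>u z\<bar> / (1 - norm z) powr \<alpha> \<le> C)))
     \<longrightarrow> (\<forall>z\<in>hball. u z = 0)"
      using ball by metis
    show "(L \<le> (n - 1)\<^sup>2 / 4 \<and>
      (\<exists>\<alpha> C. \<alpha> > root_minus n L \<and>
           (\<forall>z\<in>hball. \<bar>u z\<bar> / (1 - norm z) powr \<alpha> \<le> C)))
     \<longrightarrow> (\<forall>z\<in>hball. u z = 0)"
      using ball le_less_trans[OF root_mono] by metis
    show "(L \<le> (n - 1)\<^sup>2 / 4 \<and>
      (\<exists>\<alpha> C. \<alpha> > root_minus n lam \<and>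
           (\<forall>x>0. \<forall>y. \<bar>u (cayley (x, y))\<bar> \<le> C * x powr \<alpha>)) \<and>
      (\<forall>C1>0. \<forall>C2. \<forall>y0. \<forall>\<epsilon>>0. \<exists>R. \<forall>x y.
           x > C1 * norm (y - y0) + C2 \<longrightarrow> x > 0 \<longrightarrow> norm (x, y) > R \<longrightarrow>
           \<bar>u (cayley (x, y)) - 1\<bar> < \<epsilon>))
     \<longrightarrow> ((\<forall>m :: real^'k \<Rightarrow> real^'k. (\<forall>a b. dist (m a) (m b) = dist a b) \<longrightarrow>
             (\<forall>x>0. \<forall>y. u (cayley (x, m y)) = u (cayley (x, y))))
          \<and> (\<exists>g. \<forall>x>0. \<forall>y. u (cayley (x, y)) = g x))"
    proof (rule impI, elim conjE exE)
      fix \<alpha> C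
      assume "L \<le> (n - 1)\<^sup>2 / 4" "\<alpha> > root_minus n lam"
        "\<forall>x>0. \<forall>y. \<bar>u (cayley (x, y))\<bar> \<le> C * x powr \<alpha>"
      then have "\<forall>z\<in>hball. u z = 0" by (intro half) auto
      then show "(\<forall>m :: real^'k \<Rightarrow> real^'k. (\<forall>a b. dist (m a) (m b) = dist a b) \<longrightarrow>
             (\<forall>x>0. \<forall>y. u (cayley (x, m y)) = u (cayley (x, y))))
          \<and> (\<exists>g. \<forall>x>0. \<forall>y. u (cayley (x, y)) = g x)" by (rule ii)
    qed
    show "\<forall>\<phi> Sm Sp. ball_isometry \<phi> \<longrightarrow>
        Sm \<in> components (sphere 0 1 - closure (\<phi> ` P0)) \<longrightarrow>
        Sp \<in> components (sphere 0 1 - closure (\<phi> ` P0)) \<longrightarrow> Sm \<noteq> Sp \<longrightarrow>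
        (\<forall>K. compact K \<longrightarrow> K \<subseteq> Sm \<longrightarrow> conv_to_boundary_set u K (-1)) \<longrightarrow>
        (\<forall>K. compact K \<longrightarrow> K \<subseteq> Sp \<longrightarrow> conv_to_boundary_set u K 1) \<longrightarrow>
        (\<exists>g. \<forall>z\<in>hball. u z = g (signed_dist \<phi> z))"
      by (intro allI impI) (rule hyperplane_symmetry[OF dws], auto)
  qed (rule i1)
qed

end
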